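(* Let $N\ge1$, let $p>1$ be an integer, let $E\subset\mathfrak{LC}_p(\mathbb R^{2N},\mathbb R^N)$, and let $D'\subset\mathbb R^N$ and $D\subset\mathbb R^{2N}$ be any countable dense subsets. (i) Suppose $E$ has $L^1_{loc}$-equicontinuous $m$-bounds. Let $\Theta=\{\theta^I_j\}$ be the suitable set of moduli of continuity given by the $m$-bounds of $E$, i.e. $\theta^I_j(s)=\sup_{t\in I,\,f\in E}\int_t^{t+s}m^j_f(u)\,du$, let $\widehat\Theta=\{\hat\theta^I_j\}$ with $\hat\theta^I_j=\max\{\theta^I_j,\tau_j\}$, where $\tau_j(h)=\sup\{|\phi(t)-\phi(s)|: t,s\in[-1,0],\ |t-s|<h,\ \|\phi\|_{\mathcal C^{1,p}}\le j\}$ for $0\le h\le1$ (with $\tau_j(0)=0$) and $\tau_j(h)=\tau_j(1)$ for $h>1$, and let $\overline E$ be the closure of $E$ in $\mathfrak{LC}_p(\mathbb R^{2N},\mathbb R^N)$ with respect to $\mathcal T_{\Theta\widehat\Theta}$. Then, for any sequence $(f_n)_{n\in\mathbb N}$ in $\overline E$ converging to $f$ in $(\overline E,\mathcal T_{\Theta\widehat\Theta})$ and any sequence $(\phi_n)_{n\in\mathbb N}$ in $\mathcal C^{1,p}$ converging uniformly to $\phi\in\mathcal C^{1,p}$, one has $$\|x(\cdot,f_n,\phi_n)-x(\cdot,f,\phi)\|_{\mathcal C^{1,p}([-1,T])}\xrightarrow{n\to\infty}0\qquad( * )$$ for any $[-1,T]\subset I_{f,\phi}$. (ii) If $E$ has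 $L^1_{loc}$-equicontinuous $m$-bounds and $L^p_{loc}$-bounded $l_2$-bounds, then $( * )$ holds when the closure of $E$, and hence the convergence of $(f_n)_{n\in\mathbb N}$ to $f$, is taken with respect to $\mathcal T_{\Theta D'}$, for the same $\Theta$ as in (i). (iii) If $E$ has $L^p_{loc}$-bounded $l$-bounds, then $( * )$ holds when the closure of $E$, and hence the convergence of $(f_n)_{n\in\mathbb N}$ to $f$, is taken with respect to $\mathcal T_D$.
   Context: $B_j$ is the closed ball of radius $j$ centered at the origin; $C(I,W)$ is the space of continuous functions $I\to W$. $L^p_{loc}$ is the set of real functions on $\mathbb R$ belonging to $L^p(I)$ for every compact interval $I$. For a compact interval $I$, $\mathcal C^{1,p}(I)$ is the space of continuous functions $x:I\to\mathbb R^N$ which are differentiable a.e. and satisfy $\dot x\in L^p(I)$, normed by $\|x\|_{\mathcal C^{1,p}(I)}=\|x\|_{L^\infty(I)}+\|\dot x\|_{L^p(I)}$; $\mathcal C^{1,p}=\mathcal C^{1,p}([-1,0])$. $\mathfrak{LC}_p(\mathbb R^{2N},\mathbb R^N)$ is the set of functions $f:\mathbb R\times\mathbb R^{2N}\to\mathbb R^N$ such that: $f$ is Borel measurable; for every compact $K\subset\mathbb R^{2N}$ there are $m^K,l^K\in L^p_{loc}$ such that for a.e. $t\in\mathbb R$, $|f(t,z)|\le m^K(t)$ and $|f(t,z_1)-f(t,z_2)|\le l^K(t)|z_1-z_2|$ for all $z,z_1,z_2\in K$. Functions differing only on a negligible set are identified. Points of $\mathbb R^{2N}$ are written $(x,u)$.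 Optimal bounds of $f$ on $B_j\subset\mathbb R^{2N}$: $m^j_f(t)=\sup_{z\in B_j}|f(t,z)|$, $l^j_f(t)=\sup_{z_1\neq z_2\in B_j}|f(t,z_1)-f(t,z_2)|/|z_1-z_2|$, $l^j_{2,f}(t)=\sup|f(t,x,u_1)-f(t,x,u_2)|/|u_1-u_2|$ over $(x,u_1),(x,u_2)\in B_j$, $u_1\ne u_2$. $E$ has $L^1_{loc}$-equicontinuous $m$-bounds if for every $j\in\mathbb N$, $r,\varepsilon>0$ there is $\delta>0$ with $\sup_{f\in E}\int_s^t m^j_f(u)\,du<\varepsilon$ whenever $-r\le s\le t\le r$, $t-s<\delta$. $E$ has $L^p_{loc}$-bounded $l$-bounds (resp. $l_2$-bounds) if $\sup_{f\in E}\int_{-r}^r l^j_f(t)^p\,dt<\infty$ (resp. $\sup_{f\in E}\int_{-r}^r l^j_{2,f}(t)^p\,dt<\infty$) for every $j\in\mathbb N$, $r>0$. A suitable set of moduli of continuity is a countable set $\{\theta^I_j: j\in\mathbb N,\ I=[q_1,q_2],\ q_1,q_2\in\mathbb Q\}$ of non-decreasing continuous functions $[0,\infty)\to[0,\infty)$ with $\theta^I_j(0)=0$ and $\theta^{I_1}_{j_1}\le\theta^{I_2}_{j_2}$ whenever $I_1\subseteq I_2$, $j_1\le j_2$. $\mathcal K^I_j$ (resp. $\widehat{\mathcal K}^I_j$) is the set of $x\in C(I,B_j)$, $B_j\subset\mathbb R^N$, with $|x(t)-x(s)|\le\theta^I_j(|t-s|)$ (resp. $\hat\theta^I_j(|t-s|)$)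 for all $t,s\in I$. Topologies, generated by the following seminorms over all $I=[q_1,q_2]$, $q_1,q_2\in\mathbb Q$, $j\in\mathbb N$ ($I-1$ is the translate of $I$): - $\mathcal T_{\Theta\widehat\Theta}$: $\sup_{x\in\mathcal K^I_j,\,u\in\widehat{\mathcal K}^{I-1}_j}[\int_I|f(t,x(t),u(t-1))|^pdt]^{1/p}$; - $\mathcal T_{\Theta D'}$: $\sup_{x\in\mathcal K^I_j}[\int_I|f(t,x(t),u)|^pdt]^{1/p}$, $u\in D'$; - $\mathcal T_D$: $[\int_I|f(t,z)|^pdt]^{1/p}$, $z\in D$. For $f\in\mathfrak{LC}_p(\mathbb R^{2N},\mathbb R^N)$ and $\phi\in C([-1,0],\mathbb R^N)$, $x(\cdot,f,\phi)$ denotes the unique maximal continuous (Carathéodory) solution, with maximal interval of definition $I_{f,\phi}=[-1,b_{f,\phi})$, of $\dot x=f(t,x(t),x(t-1))$ for $t>0$, $x(t)=\phi(t)$ for $t\in[-1,0]$; if $b_{f,\phi}<\infty$ then $|x(t,f,\phi)|\to\infty$ as $t\to b_{f,\phi}$. Convergence on $[-1,T]$ is understood for $n$ large enough that $[-1,T]\subset I_{f_n,\phi_n}$, this being part of the assertion.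
   Formalization: Uniform convergence of φ_n alone does not give ( * ) (f_n=f=0, φ_n=sin(nt)/n·e_1). Proved: sup-norm convergence on [-1,T] and L^p convergence of derivatives on [0,T]; ( * ) in full when moreover φ_n→φ in C^{1,p}([-1,0]). *)

theory Defs
  imports "HOL-Analysis.Analysis"
begin

section \<open>Function spaces\<close>

text \<open>Functions of time are total functions on \<^typ>\<open>real\<close>; only their values on the interval at
  hand matter.\<close>

definition Lp :: "nat \<Rightarrow> real set \<Rightarrow> (real \<Rightarrow> 'b::euclidean_space) set" where
  "Lp p I = {g. g \<in> borel_measurable (lebesgue_on I) \<and>
                integrable (lebesgue_on I) (\<lambda>t. norm (g t) ^ p)}"

definition Lp_norm :: "nat \<Rightarrow> real set \<Rightarrow> (real \<Rightarrow> 'b::euclidean_space) \<Rightarrow> real" where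
  "Lp_norm p I g = (LINT t|lebesgue_on I. norm (g t) ^ p) powr (1 / real p)"

definition Lp_loc :: "nat \<Rightarrow> (real \<Rightarrow> real) set" where
  "Lp_loc p = {g. \<forall>a b. g \<in> Lp p {a..b}}"

text \<open>The one-sided derivatives that \<open>at t within I\<close> gives at the endpoints of \<open>I\<close> play no role,
  since everything is up to null sets. As in the definition of $C^{1,p}$, absolute
  continuity is not required.\<close>

definition deriv_on :: "real set \<Rightarrow> (real \<Rightarrow> 'b::euclidean_space) \<Rightarrow> real \<Rightarrow> 'b" where
  "deriv_on I x = (\<lambda>t. vector_derivative x (at t within I))"

definition C1p :: "nat \<Rightarrow> real set \<Rightarrow> (real \<Rightarrow> 'b::euclidean_space) set" where
  "C1p p I = {x. continuous_on I x \<and> (AE t in lebesgue_on I. x differentiable (at t within I)) \<and>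
                 deriv_on I x \<in> Lp p I}"

text \<open>For continuous functions on a compact interval the essential supremum is the supremum.\<close>

definition C1p_norm :: "nat \<Rightarrow> real set \<Rightarrow> (real \<Rightarrow> 'b::euclidean_space) \<Rightarrow> real" where
  "C1p_norm p I x = (SUP t\<in>I. norm (x t)) + Lp_norm p I (deriv_on I x)"

section \<open>Lipschitz Caratheodory functions and their optimal bounds\<close>

text \<open>The factor $R^{2N}$ is the product \<open>(real^'n) \<times> (real^'n)\<close>, whose norm is the
  Euclidean one. Functions that agree up to a null set are not formally identified; they
  have the same solutions, their bounds agree almost everywhere, and they are topologically
  indistinguishable in the (non-Hausdorff) topologies below.\<close>

type_synonym 'n rhs = "real \<times> (real^'n) \<times> (real^'n) \<Rightarrow> real^'n"

definition LC :: "nat \<Rightarrow> ('n::finite) rhs set" where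
  "LC p = {f. f \<in> borel_measurable borel \<and>
     (\<forall>K. compact K \<longrightarrow> (\<exists>m\<in>Lp_loc p. \<exists>l\<in>Lp_loc p. AE t in lebesgue.
        (\<forall>z\<in>K. norm (f (t, z)) \<le> m t) \<and>
        (\<forall>z1\<in>K. \<forall>z2\<in>K. norm (f (t, z1) - f (t, z2)) \<le> l t * norm (z1 - z2))))}"

definition m_bound :: "('n::finite) rhs \<Rightarrow> nat \<Rightarrow> real \<Rightarrow> ennreal" where
  "m_bound f j t = (SUP z\<in>cball 0 (real j). ennreal (norm (f (t, z))))"

definition l_bound :: "('n::finite) rhs \<Rightarrow> nat \<Rightarrow> real \<Rightarrow> ennreal" where
  "l_bound f j t =
     (SUP (z1, z2)\<in>{(z1, z2). z1 \<in> cball 0 (real j) \<and> z2 \<in> cball 0 (real j) \<and> z1 \<noteq> z2}.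
        ennreal (norm (f (t, z1) - f (t, z2)) / norm (z1 - z2)))"

definition l2_bound :: "('n::finite) rhs \<Rightarrow> nat \<Rightarrow> real \<Rightarrow> ennreal" where
  "l2_bound f j t =
     (SUP (x, u1, u2)\<in>{(x, u1, u2). (x, u1) \<in> cball 0 (real j) \<and> (x, u2) \<in> cball 0 (real j) \<and> u1 \<noteq> u2}.
        ennreal (norm (f (t, x, u1) - f (t, x, u2)) / norm (u1 - u2)))"

definition L1_equicontinuous_m_bounds :: "('n::finite) rhs set \<Rightarrow> bool" where
  "L1_equicontinuous_m_bounds E \<longleftrightarrow>
     (\<forall>j. \<forall>r>0. \<forall>\<epsilon>>0. \<exists>\<delta>>0. \<forall>s t. - r \<le> s \<and> s \<le> t \<and> t \<le> r \<and> t - s < \<delta> \<longrightarrow>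
        (SUP f\<in>E. \<integral>\<^sup>+u\<in>{s..t}. m_bound f j u \<partial>lebesgue) < ennreal \<epsilon>)"

definition Lp_bounded_l_bounds :: "nat \<Rightarrow> ('n::finite) rhs set \<Rightarrow> bool" where
  "Lp_bounded_l_bounds p E \<longleftrightarrow>
     (\<forall>j. \<forall>r>0. (SUP f\<in>E. \<integral>\<^sup>+t\<in>{-r..r}. l_bound f j t ^ p \<partial>lebesgue) < \<infinity>)"

definition Lp_bounded_l2_bounds :: "nat \<Rightarrow> ('n::finite) rhs set \<Rightarrow> bool" where
  "Lp_bounded_l2_bounds p E \<longleftrightarrow>
     (\<forall>j. \<forall>r>0. (SUP f\<in>E. \<integral>\<^sup>+t\<in>{-r..r}. l2_bound f j t ^ p \<partial>lebesgue) < \<infinity>)"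

section \<open>Moduli of continuity\<close>

text \<open>A family of moduli is given as \<open>\<theta> a b j s\<close> $= \theta^{[a,b]}_j(s)$.\<close>

type_synonym moduli = "real \<Rightarrow> real \<Rightarrow> nat \<Rightarrow> real \<Rightarrow> real"

text \<open>The supremum is finite when \<open>E\<close> has $L^1_{loc}$-equicontinuous $m$-bounds.\<close>

definition theta :: "('n::finite) rhs set \<Rightarrow> moduli" where
  "theta E a b j s =
     enn2real (SUP t\<in>{a..b}. SUP f\<in>E. \<integral>\<^sup>+u\<in>{t..t + s}. m_bound f j u \<partial>lebesgue)"

text \<open>The type argument fixes the dimension of the range of the functions \<open>\<phi>\<close>.\<close>

definition tau :: "'n::finite itself \<Rightarrow> nat \<Rightarrow> nat \<Rightarrow> real \<Rightarrow> real" where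
  "tau _ p j h = (if h = 0 then 0 else
     Sup {norm (\<phi> t - \<phi> s) | (\<phi> :: real \<Rightarrow> real^'n) t s.
            t \<in> {-1..0} \<and> s \<in> {-1..0} \<and> \<bar>t - s\<bar> < min h 1 \<and>
            \<phi> \<in> C1p p {-1..0} \<and> C1p_norm p {-1..0} \<phi> \<le> real j})"

definition theta_hat :: "nat \<Rightarrow> ('n::finite) rhs set \<Rightarrow> moduli" where
  "theta_hat p E a b j s = max (theta E a b j s) (tau TYPE('n) p j s)"

definition Kset :: "moduli \<Rightarrow> real \<Rightarrow> real \<Rightarrow> nat \<Rightarrow> (real \<Rightarrow> real^'n::finite) set" where
  "Kset \<theta> a b j = {x. continuous_on {a..b} x \<and> x ` {a..b} \<subseteq> cball 0 (real j) \<and>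
                     (\<forall>t\<in>{a..b}. \<forall>s\<in>{a..b}. norm (x t - x s) \<le> \<theta> a b j \<bar>t - s\<bar>)}"

section \<open>Topologies\<close>

definition seminorm_topology :: "'a::minus set \<Rightarrow> ('a \<Rightarrow> real) set \<Rightarrow> 'a topology" where
  "seminorm_topology V P =
     topology_generated_by {{g \<in> V. \<rho> (g - f) < \<epsilon>} | \<rho> f \<epsilon>. \<rho> \<in> P \<and> f \<in> V \<and> 0 < \<epsilon>}"

definition T_Theta_Theta :: "nat \<Rightarrow> moduli \<Rightarrow> moduli \<Rightarrow> ('n::finite) rhs topology" where
  "T_Theta_Theta p \<theta> \<theta>' = seminorm_topology (LC p)
     {(\<lambda>f. SUP (x, u)\<in>Kset \<theta> a b j \<times> Kset \<theta>' (a - 1) (b - 1) j.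
            Lp_norm p {a..b} (\<lambda>t. f (t, x t, u (t - 1)))) | a b j.
        a \<in> \<rat> \<and> b \<in> \<rat> \<and> a < b}"

definition T_Theta_D :: "nat \<Rightarrow> moduli \<Rightarrow> (real^'n) set \<Rightarrow> ('n::finite) rhs topology" where
  "T_Theta_D p \<theta> D' = seminorm_topology (LC p)
     {(\<lambda>f. SUP x\<in>Kset \<theta> a b j. Lp_norm p {a..b} (\<lambda>t. f (t, x t, u))) | a b j u.
        a \<in> \<rat> \<and> b \<in> \<rat> \<and> a < b \<and> u \<in> D'}"

definition T_D :: "nat \<Rightarrow> ((real^'n) \<times> (real^'n)) set \<Rightarrow> ('n::finite) rhs topology" where
  "T_D p D = seminorm_topology (LC p)
     {(\<lambda>f. Lp_norm p {a..b} (\<lambda>t. f (t, z))) | a b z. a \<in> \<rat> \<and> b \<in> \<rat> \<and> a < b \<and> z \<in> D}"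

section \<open>Solutions of the delay equation\<close>

definition dde_dom :: "ereal \<Rightarrow> real set" where
  "dde_dom b = {t. -1 \<le> t \<and> ereal t < b}"

text \<open>Caratheodory solutions on $[-1,b)$, in integral form.\<close>

definition dde_solution ::
  "('n::finite) rhs \<Rightarrow> (real \<Rightarrow> real^'n) \<Rightarrow> ereal \<Rightarrow> (real \<Rightarrow> real^'n) \<Rightarrow> bool" where
  "dde_solution f \<phi> b x \<longleftrightarrow> 0 < b \<and> continuous_on (dde_dom b) x \<and> (\<forall>t\<in>{-1..0}. x t = \<phi> t) \<and>
     (\<forall>t\<ge>0. ereal t < b \<longrightarrow>
        set_integrable lebesgue {0..t} (\<lambda>s. f (s, x s, x (s - 1))) \<and>
        x t = \<phi> 0 + (LINT s:{0..t}|lebesgue. f (s, x s, x (s - 1))))"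

text \<open>Membership in \<^const>\<open>extensional\<close> fixes the irrelevant values outside $[-1,b)$, so that the
  maximal solution is unique as a total function.\<close>

definition dde_maximal_solution ::
  "('n::finite) rhs \<Rightarrow> (real \<Rightarrow> real^'n) \<Rightarrow> ereal \<Rightarrow> (real \<Rightarrow> real^'n) \<Rightarrow> bool" where
  "dde_maximal_solution f \<phi> b x \<longleftrightarrow> dde_solution f \<phi> b x \<and> x \<in> extensional (dde_dom b) \<and>
     (\<forall>c y. dde_solution f \<phi> c y \<and> b \<le> c \<and> (\<forall>t\<in>dde_dom b. y t = x t) \<longrightarrow> c = b)"

definition dde_end :: "('n::finite) rhs \<Rightarrow> (real \<Rightarrow> real^'n) \<Rightarrow> ereal" where
  "dde_end f \<phi> = (THE b. \<exists>x. dde_maximal_solution f \<phi> b x)"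

definition dde_sol :: "('n::finite) rhs \<Rightarrow> (real \<Rightarrow> real^'n) \<Rightarrow> real \<Rightarrow> real^'n" where
  "dde_sol f \<phi> = (THE x. dde_maximal_solution f \<phi> (dde_end f \<phi>) x)"

section \<open>Continuous dependence\<close>

text \<open>Convergence of the solutions in $C^{1,p}([-1,T])$, with the assertion that they are
  eventually defined on $[-1,T]$. On $[-1,0]$ this contains the convergence of the derivatives
  of the initial data in $L^p$.\<close>

definition solutions_converge_C1p ::
  "nat \<Rightarrow> real \<Rightarrow> (nat \<Rightarrow> ('n::finite) rhs) \<Rightarrow> (nat \<Rightarrow> real \<Rightarrow> real^'n) \<Rightarrow> 'n rhs \<Rightarrow>
     (real \<Rightarrow> real^'n) \<Rightarrow> bool" where
  "solutions_converge_C1p p T fs \<phi>s f \<phi> \<longleftrightarrow>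
     dde_sol f \<phi> \<in> C1p p {-1..T} \<and>
     (\<forall>\<^sub>F n in sequentially. ereal T < dde_end (fs n) (\<phi>s n) \<and>
        dde_sol (fs n) (\<phi>s n) \<in> C1p p {-1..T}) \<and>
     (\<lambda>n. C1p_norm p {-1..T} (\<lambda>t. dde_sol (fs n) (\<phi>s n) t - dde_sol f \<phi> t)) \<longlonglongrightarrow> 0"

text \<open>The same, except that the derivatives are compared on $[0,T]$ only. Uniform convergence of
  the initial data alone cannot give more: for $f_n = f = 0$ and $\phi_n(t) = n^{-1}\sin(nt)\,e_1$
  the solutions converge uniformly to 0, but their derivatives do not converge in
  $L^p([-1,0])$.\<close>

definition solutions_converge ::
  "nat \<Rightarrow> real \<Rightarrow> (nat \<Rightarrow> ('n::finite) rhs) \<Rightarrow> (nat \<Rightarrow> real \<Rightarrow> real^'n) \<Rightarrow> 'n rhs \<Rightarrow>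
     (real \<Rightarrow> real^'n) \<Rightarrow> bool" where
  "solutions_converge p T fs \<phi>s f \<phi> \<longleftrightarrow>
     dde_sol f \<phi> \<in> C1p p {-1..T} \<and>
     (\<forall>\<^sub>F n in sequentially. ereal T < dde_end (fs n) (\<phi>s n) \<and>
        dde_sol (fs n) (\<phi>s n) \<in> C1p p {-1..T}) \<and>
     (\<lambda>n. (SUP t\<in>{-1..T}. norm (dde_sol (fs n) (\<phi>s n) t - dde_sol f \<phi> t)) +
          Lp_norm p {0..T} (deriv_on {0..T} (\<lambda>t. dde_sol (fs n) (\<phi>s n) t - dde_sol f \<phi> t)))
       \<longlonglongrightarrow> 0"

definition continuous_dependence :: "nat \<Rightarrow> ('n::finite) rhs topology \<Rightarrow> 'n rhs set \<Rightarrow> bool" where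
  "continuous_dependence p \<T> E \<longleftrightarrow>
     (\<forall>fs f \<phi>s \<phi>.
        (\<forall>n. fs n \<in> \<T> closure_of E) \<and>
        limitin (subtopology \<T> (\<T> closure_of E)) fs f sequentially \<and>
        (\<forall>n. \<phi>s n \<in> C1p p {-1..0}) \<and> \<phi> \<in> C1p p {-1..0} \<and>
        uniform_limit {-1..0} \<phi>s \<phi> sequentially \<longrightarrow>
        (\<forall>T\<ge>-1. ereal T < dde_end f \<phi> \<longrightarrow>
           solutions_converge p T fs \<phi>s f \<phi> \<and>
           ((\<lambda>n. C1p_norm p {-1..0} (\<lambda>t. \<phi>s n t - \<phi> t)) \<longlonglongrightarrow> 0 \<longrightarrow>
              solutions_converge_C1p p T fs \<phi>s f \<phi>)))"

end

theory Submission
  imports Defs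
begin

text \<open>
  Along a bounded solution of the perturbed equation, the difference of the two right-hand sides
  is bounded by \<open>L (\<bar>x - y\<bar> + \<bar>x(\<cdot> - 1) - y(\<cdot> - 1)\<bar>) + r\<close> with \<open>L\<close> bounded in \<open>L\<^sup>p\<close> and \<open>r\<close> tending to 0 in
  \<open>L\<^sup>p\<close>. Gronwall's inequality then gives uniform convergence as long as the perturbed solution stays
  in a fixed ball; since it cannot leave a neighbourhood of the limit solution, it exists on the
  whole interval, and the bound on the right-hand sides gives the convergence of the derivatives.

  In (i) and (ii) one uses that the integrated \<open>m\<close>-bounds of \<open>E\<close> pass to its closure by Fatou's lemma,
  so that the perturbed solutions belong to the sets \<open>K\<close> over which the seminorms take suprema. In (i),
  \<open>L\<close> is a Lipschitz bound of the limit and \<open>r\<close> is the difference \<open>f\<^sub>n - f\<close> along \<open>x\<^sub>n\<close>; no modulus of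
  continuity of the delayed argument is needed, because \<open>\<tau>\<^sub>j(h) \<ge> 2j\<close> for \<open>h > 0\<close> (there are singular
  functions with small norm in \<open>C\<^sup>1\<^sup>,\<^sup>p\<close>). In (ii) and (iii) the \<open>l\<close>-bounds also pass to the closure, and
  the limit trajectory is replaced by the points of a finite net in the dense set.
\<close>

section \<open>Integral estimates and \<open>L\<^sup>p\<close> spaces\<close>

text \<open>Perturbed solutions are not known in advance to exist up to \<open>T\<close>. The
  estimate along them is therefore required for every solution on every shorter interval
  \<open>[-1,S]\<close> that stays in a fixed ball, with one constant fixed before the accuracy.
  \<open>perturbation\<close> records this, and the three topologies differ only in how it is
  verified. The closure of \<open>E\<close> is topological, but in each topology suitable seminorms
  dominate the L^p norm of the evaluation at fixed points. A member of the closure is thus the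
  limit, for almost every time and at countably many points, of a sequence in \<open>E\<close>; this
  makes Fatou's lemma applicable, and continuity in the state carries the result from the countable
  set to a ball. The same countable sets replace the uncountable suprema in the optimal bounds,
  whose measurability is not evident. Estimates are made with nonnegative integrals of p-th powers;
  smallness passes from L^p to L^1 through a \<le> \<eta> + a^p / \<eta>^(p-1) with a free parameter
  \<eta>.\<close>

lemma add_power_le:
  fixes a b :: real
  assumes "0 \<le> a" "0 \<le> b"
  shows "(a + b) ^ p \<le> 2 ^ p * (a ^ p + b ^ p)"
proof -
  have "(a + b) ^ p \<le> (2 * max a b) ^ p" using assms by (intro power_mono) auto
  also have "\<dots> = 2 ^ p * max a b ^ p" by (simp add: power_mult_distrib)
  also have "\<dots> \<le> 2 ^ p * (a ^ p + b ^ p)"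
    using assms by (intro mult_left_mono) (auto simp: max_def)
  finally show ?thesis .
qed

text \<open>If \<open>a\<close> exceeds \<eta>, then a = \<eta> (a/\<eta>) \<le> \<eta>
  (a/\<eta>)^p. This takes the place of Hoelder's inequality: on a bounded interval a small L^p
  integral gives a small L^1 integral, \<eta> being chosen first.\<close>

lemma le_add_power_divide:
  fixes a \<eta> :: real
  assumes "0 \<le> a" "0 < \<eta>" "0 < p"
  shows "a \<le> \<eta> + a ^ p / \<eta> ^ (p - 1)"
proof (cases "a \<le> \<eta>")
  case True
  then show ?thesis using assms by (auto intro: add_increasing2)
next
  case False
  then have "a * \<eta> ^ (p - 1) \<le> a * a ^ (p - 1)"
    using assms by (intro mult_left_mono power_mono) auto
  also have "\<dots> = a ^ p" using \<open>0 < p\<close> by (simp add: power_eq_if)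
  finally have "a \<le> a ^ p / \<eta> ^ (p - 1)" using assms by (simp add: pos_le_divide_eq)
  then show ?thesis using assms by linarith
qed

lemma set_nn_integral_mono_AE:
  assumes "AE t in lebesgue. t \<in> A \<longrightarrow> F t \<le> G t"
  shows "(\<integral>\<^sup>+t\<in>A. F t \<partial>lebesgue) \<le> (\<integral>\<^sup>+t\<in>A. G t \<partial>lebesgue)"
  by (rule nn_integral_mono_AE) (use assms in \<open>auto split: split_indicator elim: AE_mp\<close>)

lemma Lp_lebesgue_iff:
  fixes g :: "real \<Rightarrow> 'b::euclidean_space"
  assumes "g \<in> borel_measurable lebesgue" "S \<in> sets lebesgue"
  shows "g \<in> Lp p S \<longleftrightarrow> (\<integral>\<^sup>+t\<in>S. ennreal (norm (g t) ^ p) \<partial>lebesgue) < \<infinity>"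
  using assms
  by (auto simp: Lp_def integrable_iff_bounded nn_integral_restrict_space measurable_restrict_space1)

text \<open>Valid also for infinite integrals, because a non-integrable function has Bochner
  integral 0 and \<open>enn2real\<close> sends infinity to 0.\<close>

lemma Lp_norm_eq_nn:
  fixes g :: "real \<Rightarrow> 'b::euclidean_space"
  assumes "g \<in> borel_measurable (lebesgue_on S)" "S \<in> sets lebesgue"
  shows "Lp_norm p S g = enn2real (\<integral>\<^sup>+t\<in>S. ennreal (norm (g t) ^ p) \<partial>lebesgue) powr (1 / real p)"
proof -
  have "(LINT t|lebesgue_on S. norm (g t) ^ p) = enn2real (\<integral>\<^sup>+t. ennreal (norm (g t) ^ p) \<partial>lebesgue_on S)"
    using assms by (intro integral_eq_nn_integral) auto
  then show ?thesis using assms by (simp add: Lp_norm_def nn_integral_restrict_space)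
qed

text \<open>Inside \<open>Lp\<close> the integral is finite, so norm and integral of p-th powers
  determine each other. Estimates are made on the integral side and translated back only for norms
  and seminorms.\<close>

lemma nn_integral_Lp:
  fixes g :: "real \<Rightarrow> 'b::euclidean_space"
  assumes "g \<in> Lp p S" "S \<in> sets lebesgue" "0 < p"
  shows "(\<integral>\<^sup>+t\<in>S. ennreal (norm (g t) ^ p) \<partial>lebesgue) = ennreal (Lp_norm p S g ^ p)"
proof -
  have m: "g \<in> borel_measurable (lebesgue_on S)" and i: "integrable (lebesgue_on S) (\<lambda>t. norm (g t) ^ p)"
    using assms by (auto simp: Lp_def)
  have "(\<integral>\<^sup>+t\<in>S. ennreal (norm (g t) ^ p) \<partial>lebesgue) = (\<integral>\<^sup>+t. ennreal (norm (g t) ^ p) \<partial>lebesgue_on S)"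
    using assms by (simp add: nn_integral_restrict_space)
  also have "\<dots> = ennreal (LINT t|lebesgue_on S. norm (g t) ^ p)"
    using i by (intro nn_integral_eq_integral) auto
  also have "(LINT t|lebesgue_on S. norm (g t) ^ p) = Lp_norm p S g ^ p"
  proof -
    have "c = (c powr (1 / real p)) ^ p" if "0 \<le> c" for c :: real
      using that \<open>0 < p\<close> by (cases "c = 0") (simp_all add: powr_power)
    then show ?thesis by (simp add: Lp_norm_def integral_nonneg_AE)
  qed
  finally show ?thesis .
qed

lemma Lp_norm_nonneg [simp]: "0 \<le> Lp_norm p S g"
  by (simp add: Lp_norm_def)

text \<open>Convergence to 0 makes the integrals eventually finite, so neither
  \<open>enn2real\<close> nor the root disturbs the limit.\<close>

lemma Lp_norm_tendsto_0:
  fixes g :: "'i \<Rightarrow> real \<Rightarrow> 'b::euclidean_space"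
  assumes "S \<in> sets lebesgue" "0 < p"
    and "\<forall>\<^sub>F n in F. g n \<in> borel_measurable (lebesgue_on S)"
    and "((\<lambda>n. \<integral>\<^sup>+t\<in>S. ennreal (norm (g n t) ^ p) \<partial>lebesgue) \<longlongrightarrow> 0) F"
  shows "((\<lambda>n. Lp_norm p S (g n)) \<longlongrightarrow> 0) F"
proof -
  have "((\<lambda>n. enn2real (\<integral>\<^sup>+t\<in>S. ennreal (norm (g n t) ^ p) \<partial>lebesgue) powr (1 / real p)) \<longlongrightarrow> 0 powr (1 / real p)) F"
    using tendsto_enn2real[of _ "0::real" F] assms(4) \<open>0 < p\<close>
    by (intro tendsto_powr') auto
  then have "((\<lambda>n. enn2real (\<integral>\<^sup>+t\<in>S. ennreal (norm (g n t) ^ p) \<partial>lebesgue) powr (1 / real p)) \<longlongrightarrow> 0) F"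
    by simp
  then show ?thesis
    by (rule Lim_transform_eventually)
       (use assms(3) in eventually_elim, use assms(1) in \<open>simp add: Lp_norm_eq_nn\<close>)
qed

lemma Lp_diff:
  fixes g h :: "real \<Rightarrow> 'b::euclidean_space"
  assumes "g \<in> Lp p S" "h \<in> Lp p S"
  shows "(\<lambda>t. g t - h t) \<in> Lp p S"
proof -
  have m: "g \<in> borel_measurable (lebesgue_on S)" "h \<in> borel_measurable (lebesgue_on S)"
    and i: "integrable (lebesgue_on S) (\<lambda>t. norm (g t) ^ p)" "integrable (lebesgue_on S) (\<lambda>t. norm (h t) ^ p)"
    using assms by (auto simp: Lp_def)
  have "integrable (lebesgue_on S) (\<lambda>t. norm (g t - h t) ^ p)"
  proof (rule Bochner_Integration.integrable_bound)
    show "integrable (lebesgue_on S) (\<lambda>t. 2 ^ p * (norm (g t) ^ p + norm (h t) ^ p))"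
      using i by auto
    have "norm (g t - h t) ^ p \<le> 2 ^ p * (norm (g t) ^ p + norm (h t) ^ p)" for t
      by (rule order_trans[OF power_mono[OF norm_triangle_ineq4] add_power_le]) auto
    then show "AE t in lebesgue_on S. norm (norm (g t - h t) ^ p) \<le> norm (2 ^ p * (norm (g t) ^ p + norm (h t) ^ p))"
      by (auto intro: order_trans)
  qed (use m in measurable)
  then show ?thesis using m by (auto simp: Lp_def)
qed

text \<open>Measurability of \<open>h\<close> comes from the completeness of Lebesgue measure. It is
  what puts \<open>deriv_on\<close> into \<open>Lp\<close>, a function known only up to null
  sets.\<close>

lemma Lp_cong_AE:
  fixes g h :: "real \<Rightarrow> 'b::euclidean_space"
  assumes "S \<in> sets lebesgue" "g \<in> Lp p S" "AE t in lebesgue. t \<in> S \<longrightarrow> g t = h t"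
  shows "h \<in> Lp p S"
proof -
  have ae: "AE t in lebesgue_on S. g t = h t" using assms by (simp add: AE_restrict_space_iff)
  have m: "g \<in> borel_measurable (lebesgue_on S)" and i: "integrable (lebesgue_on S) (\<lambda>t. norm (g t) ^ p)"
    using assms by (auto simp: Lp_def)
  have h: "h \<in> borel_measurable (lebesgue_on S)"
  proof -
    have "(\<lambda>t. if t \<in> S then g t else 0) \<in> borel_measurable lebesgue"
      using m assms(1) borel_measurable_if by blast
    then have "(\<lambda>t. if t \<in> S then h t else 0) \<in> borel_measurable lebesgue"
      by (rule borel_measurable_AE) (use assms(3) in \<open>auto elim: AE_mp\<close>)
    then show ?thesis using assms(1) borel_measurable_if by blast
  qed
  moreover have "integrable (lebesgue_on S) (\<lambda>t. norm (h t) ^ p)"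
    using i ae h m by (subst integrable_cong_AE[of _ _ "\<lambda>t. norm (g t) ^ p"]) (auto elim!: AE_mp)
  ultimately show ?thesis by (simp add: Lp_def)
qed

lemma absolutely_integrable_nnI:
  fixes g :: "real \<Rightarrow> 'b::euclidean_space"
  assumes "g \<in> borel_measurable lebesgue" "S \<in> sets lebesgue"
    "(\<integral>\<^sup>+t\<in>S. ennreal (norm (g t)) \<partial>lebesgue) < \<infinity>"
  shows "g absolutely_integrable_on S"
  unfolding set_integrable_def
proof (rule integrableI_bounded)
  show "(\<lambda>t. indicat_real S t *\<^sub>R g t) \<in> borel_measurable lebesgue" using assms by measurable
  have "(\<integral>\<^sup>+t. ennreal (norm (indicat_real S t *\<^sub>R g t)) \<partial>lebesgue) = (\<integral>\<^sup>+t\<in>S. ennreal (norm (g t)) \<partial>lebesgue)"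
    by (rule nn_integral_cong) (auto split: split_indicator)
  then show "(\<integral>\<^sup>+t. ennreal (norm (indicat_real S t *\<^sub>R g t)) \<partial>lebesgue) < \<infinity>" using assms by simp
qed

lemma nn_integral_absolutely_integrable:
  fixes g :: "real \<Rightarrow> 'b::euclidean_space"
  assumes "g absolutely_integrable_on S"
  shows "(\<integral>\<^sup>+t\<in>S. ennreal (norm (g t)) \<partial>lebesgue) = ennreal (integral S (\<lambda>t. norm (g t)))"
proof -
  have n: "(\<lambda>t. norm (g t)) absolutely_integrable_on S"
    using assms set_integrable_norm by blast
  have "(\<integral>\<^sup>+t\<in>S. ennreal (norm (g t)) \<partial>lebesgue) = (\<integral>\<^sup>+t. ennreal (indicat_real S t *\<^sub>R norm (g t)) \<partial>lebesgue)"
    by (rule nn_integral_cong) (auto split: split_indicator)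
  also have "\<dots> = ennreal (LINT t:S|lebesgue. norm (g t))"
    using n unfolding set_integrable_def set_lebesgue_integral_def
    by (intro nn_integral_eq_integral) auto
  finally show ?thesis using n by (simp add: set_lebesgue_integral_eq_integral)
qed

text \<open>Caratheodory bounds hold for almost every time only; passing through the Lebesgue
  integral makes the exceptional null set harmless.\<close>

lemma norm_integral_le_AE:
  fixes g :: "real \<Rightarrow> 'b::euclidean_space"
  assumes "g absolutely_integrable_on S" "k absolutely_integrable_on S"
    "AE t in lebesgue. t \<in> S \<longrightarrow> norm (g t) \<le> k t"
  shows "norm (integral S g) \<le> integral S k"
proof -
  have "norm (integral S g) = norm (LINT t:S|lebesgue. g t)"
    using assms by (simp add: set_lebesgue_integral_eq_integral)
  also have "\<dots> \<le> (LINT t:S|lebesgue. norm (g t))"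
    unfolding set_lebesgue_integral_def
    by (rule order_trans[OF integral_norm_bound]) (simp add: indicator_def)
  also have "\<dots> \<le> (LINT t:S|lebesgue. k t)"
    unfolding set_lebesgue_integral_def
    using assms set_integrable_norm[OF assms(1)] unfolding set_integrable_def
    by (intro integral_mono_AE) (auto elim!: AE_mp split: split_indicator)
  also have "\<dots> = integral S k" using assms by (simp add: set_lebesgue_integral_eq_integral)
  finally show ?thesis .
qed

lemma absolutely_integrable_AE_bound:
  fixes g :: "real \<Rightarrow> 'b::euclidean_space"
  assumes "g \<in> borel_measurable lebesgue" "S \<in> sets lebesgue" "k absolutely_integrable_on S"
    "AE t in lebesgue. t \<in> S \<longrightarrow> norm (g t) \<le> k t"
  shows "g absolutely_integrable_on S"
proof (rule absolutely_integrable_nnI)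
  have "(\<integral>\<^sup>+t\<in>S. ennreal (norm (g t)) \<partial>lebesgue) \<le> (\<integral>\<^sup>+t\<in>S. ennreal (norm (k t)) \<partial>lebesgue)"
    by (rule set_nn_integral_mono_AE) (use assms(4) in \<open>auto elim!: AE_mp intro!: ennreal_leI\<close>)
  then show "(\<integral>\<^sup>+t\<in>S. ennreal (norm (g t)) \<partial>lebesgue) < \<infinity>"
    using nn_integral_absolutely_integrable[OF assms(3)] by (simp add: le_less_trans)
qed (use assms in auto)

text \<open>Taking \<eta> = 1 in \<open>le_add_power_divide\<close> bounds the norm by 1 plus its
  p-th power, and a bounded interval has finite measure.\<close>

lemma Lp_imp_absolutely_integrable:
  fixes g :: "real \<Rightarrow> 'b::euclidean_space"
  assumes "g \<in> borel_measurable lebesgue" "0 < p"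
    "(\<integral>\<^sup>+t\<in>{a..b}. ennreal (norm (g t) ^ p) \<partial>lebesgue) < \<infinity>"
  shows "g absolutely_integrable_on {a..b}"
proof (rule absolutely_integrable_nnI)
  have "(\<integral>\<^sup>+t\<in>{a..b}. ennreal (norm (g t)) \<partial>lebesgue)
      \<le> (\<integral>\<^sup>+t\<in>{a..b}. (ennreal 1 + ennreal (norm (g t) ^ p)) \<partial>lebesgue)"
  proof (intro set_nn_integral_mono_AE AE_I2 impI)
    fix t
    have "norm (g t) \<le> 1 + norm (g t) ^ p" using le_add_power_divide[of "norm (g t)" 1 p] \<open>0 < p\<close> by simp
    then have "ennreal (norm (g t)) \<le> ennreal (1 + norm (g t) ^ p)" by (rule ennreal_leI)
    then show "ennreal (norm (g t)) \<le> ennreal 1 + ennreal (norm (g t) ^ p)" by (simp add: ennreal_plus)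
  qed
  also have "\<dots> = (\<integral>\<^sup>+t. ennreal 1 * indicator {a..b} t \<partial>lebesgue) + (\<integral>\<^sup>+t\<in>{a..b}. ennreal (norm (g t) ^ p) \<partial>lebesgue)"
    by (rule nn_set_integral_add) (use assms(1) in \<open>measurable, simp_all\<close>)
  also have "\<dots> < \<infinity>" using assms by (auto simp: nn_integral_cmult_indicator emeasure_lborel_Icc_eq)
  finally show "(\<integral>\<^sup>+t\<in>{a..b}. ennreal (norm (g t)) \<partial>lebesgue) < \<infinity>" .
qed (use assms in auto)

text \<open>Local membership gives measurability on compact intervals only; the whole line is
  reached as the pointwise limit of truncations.\<close>

lemma Lp_locD:
  assumes "m \<in> Lp_loc p"
  shows "m \<in> borel_measurable lebesgue" "(\<integral>\<^sup>+t\<in>{a..b}. ennreal (norm (m t) ^ p) \<partial>lebesgue) < \<infinity>"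
proof -
  have "m \<in> borel_measurable (lebesgue_on {-real n..real n})" for n
    using assms by (auto simp: Lp_loc_def Lp_def)
  then have "(\<lambda>t. if t \<in> {-real n..real n} then m t else 0) \<in> borel_measurable lebesgue" for n
    using borel_measurable_if[of "{-real n..real n}" m] by auto
  moreover have "(\<lambda>n. if t \<in> {-real n..real n} then m t else 0) \<longlonglongrightarrow> m t" for t
  proof (rule tendsto_eventually)
    obtain N where N: "\<bar>t\<bar> \<le> real N" using real_arch_simple by blast
    show "\<forall>\<^sub>F n in sequentially. (if t \<in> {- real n..real n} then m t else 0) = m t"
      using eventually_ge_at_top[of N] by eventually_elim (use N in auto)
  qed
  ultimately show m: "m \<in> borel_measurable lebesgue"
    by (rule borel_measurable_LIMSEQ_metric)
  show "(\<integral>\<^sup>+t\<in>{a..b}. ennreal (norm (m t) ^ p) \<partial>lebesgue) < \<infinity>"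
    using assms Lp_lebesgue_iff[OF m, of "{a..b}" p] by (auto simp: Lp_loc_def)
qed

text \<open>A crude substitute for Minkowski's inequality, in p-th powers and with factor 2^p, so
  that no roots are taken.\<close>

lemma Lp_nn_add:
  fixes g h :: "real \<Rightarrow> 'b::euclidean_space"
  assumes "g \<in> borel_measurable lebesgue" "h \<in> borel_measurable lebesgue" "S \<in> sets lebesgue"
    "AE t in lebesgue. t \<in> S \<longrightarrow> norm (u t) \<le> norm (g t) + norm (h t)"
  shows "(\<integral>\<^sup>+t\<in>S. ennreal (norm (u t) ^ p) \<partial>lebesgue)
    \<le> ennreal (2 ^ p) * ((\<integral>\<^sup>+t\<in>S. ennreal (norm (g t) ^ p) \<partial>lebesgue) + (\<integral>\<^sup>+t\<in>S. ennreal (norm (h t) ^ p) \<partial>lebesgue))"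
proof -
  have "(\<integral>\<^sup>+t\<in>S. ennreal (norm (u t) ^ p) \<partial>lebesgue)
    \<le> (\<integral>\<^sup>+t\<in>S. (ennreal (2 ^ p) * (ennreal (norm (g t) ^ p) + ennreal (norm (h t) ^ p))) \<partial>lebesgue)"
  proof (rule set_nn_integral_mono_AE)
    have "ennreal (norm (u t) ^ p) \<le> ennreal (2 ^ p) * (ennreal (norm (g t) ^ p) + ennreal (norm (h t) ^ p))"
      if "norm (u t) \<le> norm (g t) + norm (h t)" for t
    proof -
      have "norm (u t) ^ p \<le> 2 ^ p * (norm (g t) ^ p + norm (h t) ^ p)"
        using order_trans[OF power_mono[OF that] add_power_le] by auto
      then have "ennreal (norm (u t) ^ p) \<le> ennreal (2 ^ p * (norm (g t) ^ p + norm (h t) ^ p))"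
        by (rule ennreal_leI)
      then show ?thesis by (simp add: ennreal_mult)
    qed
    then show "AE t in lebesgue. t \<in> S \<longrightarrow> ennreal (norm (u t) ^ p) \<le> ennreal (2 ^ p) * (ennreal (norm (g t) ^ p) + ennreal (norm (h t) ^ p))"
      using assms(4) by (auto elim!: AE_mp)
  qed
  also have "\<dots> = ennreal (2 ^ p) * (\<integral>\<^sup>+t. (ennreal (norm (g t) ^ p) + ennreal (norm (h t) ^ p)) * indicator S t \<partial>lebesgue)"
    unfolding mult.assoc using assms by (intro nn_integral_cmult) auto
  also have "\<dots> = ennreal (2 ^ p) * ((\<integral>\<^sup>+t\<in>S. ennreal (norm (g t) ^ p) \<partial>lebesgue) + (\<integral>\<^sup>+t\<in>S. ennreal (norm (h t) ^ p) \<partial>lebesgue))"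
    unfolding distrib_right using assms by (subst nn_integral_add) auto
  finally show ?thesis .
qed

section \<open>Bounds on balls and compositions with continuous curves\<close>

text \<open>One function serves at once as magnitude bound and as Lipschitz bound on the ball of
  radius \<open>R\<close>. It is nonnegative everywhere, so exceptional null sets occur in the last
  clause only.\<close>

definition LC_bound :: "nat \<Rightarrow> ('n::finite) rhs \<Rightarrow> real \<Rightarrow> (real \<Rightarrow> real) \<Rightarrow> bool" where
  "LC_bound p f R k \<longleftrightarrow> k \<in> borel_measurable lebesgue \<and> (\<forall>t. 0 \<le> k t) \<and>
    (\<forall>a b. (\<integral>\<^sup>+t\<in>{a..b}. ennreal (k t ^ p) \<partial>lebesgue) < \<infinity>) \<and>
    (\<forall>a b. k absolutely_integrable_on {a..b}) \<and>
    (AE t in lebesgue. (\<forall>z\<in>cball 0 R. norm (f (t, z)) \<le> k t) \<and>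
        (\<forall>z1\<in>cball 0 R. \<forall>z2\<in>cball 0 R. norm (f (t, z1) - f (t, z2)) \<le> k t * norm (z1 - z2)))"

lemma LC_boundD:
  assumes "LC_bound p f R k"
  shows "k \<in> borel_measurable lebesgue" "0 \<le> k t"
    "(\<integral>\<^sup>+t\<in>{a..b}. ennreal (k t ^ p) \<partial>lebesgue) < \<infinity>"
    "k absolutely_integrable_on {a..b}"
    "AE t in lebesgue. (\<forall>z\<in>cball 0 R. norm (f (t, z)) \<le> k t) \<and>
        (\<forall>z1\<in>cball 0 R. \<forall>z2\<in>cball 0 R. norm (f (t, z1) - f (t, z2)) \<le> k t * norm (z1 - z2))"
  using assms unfolding LC_bound_def by blast+

lemma ex_LC_bound:
  assumes "f \<in> LC p" "0 < p"
  shows "\<exists>k. LC_bound p f R k"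
proof -
  from assms(1) obtain m l where ml: "m \<in> Lp_loc p" "l \<in> Lp_loc p"
    and ae: "AE t in lebesgue. (\<forall>z\<in>cball 0 R. norm (f (t, z)) \<le> m t) \<and>
        (\<forall>z1\<in>cball 0 R. \<forall>z2\<in>cball 0 R. norm (f (t, z1) - f (t, z2)) \<le> l t * norm (z1 - z2))"
    unfolding LC_def by (auto dest!: spec[of _ "cball 0 R"])
  \<comment> \<open>The absolute values make the sum nonnegative at every time, also on the null set
    where the inequalities may fail.\<close>
  define k where "k t = \<bar>m t\<bar> + \<bar>l t\<bar>" for t
  have mk: "k \<in> borel_measurable lebesgue"
    unfolding k_def using Lp_locD(1)[OF ml(1)] Lp_locD(1)[OF ml(2)] by measurable
  have k0: "0 \<le> k t" for t by (simp add: k_def)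
  have kp: "(\<integral>\<^sup>+t\<in>{a..b}. ennreal (k t ^ p) \<partial>lebesgue) < \<infinity>" for a b
  proof -
    have "(\<integral>\<^sup>+t\<in>{a..b}. ennreal (norm (k t) ^ p) \<partial>lebesgue) \<le> ennreal (2 ^ p) *
        ((\<integral>\<^sup>+t\<in>{a..b}. ennreal (norm (m t) ^ p) \<partial>lebesgue) + (\<integral>\<^sup>+t\<in>{a..b}. ennreal (norm (l t) ^ p) \<partial>lebesgue))"
      using Lp_locD(1)[OF ml(1)] Lp_locD(1)[OF ml(2)] by (intro Lp_nn_add) (auto simp: k_def)
    also have "\<dots> < \<infinity>"
      using Lp_locD(2)[OF ml(1)] Lp_locD(2)[OF ml(2)] by (auto simp: ennreal_mult_less_top)
    finally show ?thesis using k0 by simp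
  qed
  have ki: "k absolutely_integrable_on {a..b}" for a b
    using Lp_imp_absolutely_integrable[OF mk \<open>0 < p\<close>] kp k0 by auto
  have "AE t in lebesgue. (\<forall>z\<in>cball 0 R. norm (f (t, z)) \<le> k t) \<and>
        (\<forall>z1\<in>cball 0 R. \<forall>z2\<in>cball 0 R. norm (f (t, z1) - f (t, z2)) \<le> k t * norm (z1 - z2))"
    using ae
  proof eventually_elim
    case (elim t)
    have "norm (f (t, z)) \<le> k t" if "z \<in> cball 0 R" for z
      using elim that by (fastforce simp: k_def)
    moreover have "norm (f (t, z1) - f (t, z2)) \<le> k t * norm (z1 - z2)" if "z1 \<in> cball 0 R" "z2 \<in> cball 0 R" for z1 z2
    proof -
      have "norm (f (t, z1) - f (t, z2)) \<le> l t * norm (z1 - z2)" using elim that by blast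
      also have "\<dots> \<le> k t * norm (z1 - z2)" by (intro mult_right_mono) (auto simp: k_def)
      finally show ?thesis .
    qed
    ultimately show ?case by blast
  qed
  then show ?thesis unfolding LC_bound_def using mk k0 kp ki by blast
qed

text \<open>The seminorms are evaluated at differences, so these must lie in the same space for the
  L^p estimates along continuous curves to apply. A compact set is enclosed in a ball and the two
  ball bounds are added.\<close>

lemma LC_diff:
  assumes "f \<in> LC p" "g \<in> LC p" "0 < p"
  shows "f - g \<in> LC p"
  unfolding LC_def
proof (intro CollectI conjI allI impI)
  show "f - g \<in> borel_measurable borel"
  proof -
    have "f \<in> borel_measurable borel" "g \<in> borel_measurable borel" using assms by (simp_all add: LC_def)
    then show ?thesis unfolding fun_diff_def by (rule borel_measurable_diff)
  qed
  fix K :: "((real, 'a) vec \<times> (real, 'a) vec) set" assume "compact K"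
  then obtain R where R: "K \<subseteq> cball 0 R" using compact_imp_bounded bounded_subset_ballD[of K 0] ball_subset_cball[of 0] by blast
  obtain k1 k2 where k: "LC_bound p f R k1" "LC_bound p g R k2"
    using assms ex_LC_bound by blast
  note k1 = LC_boundD[OF k(1)] and k2 = LC_boundD[OF k(2)]
  let ?k = "\<lambda>t. k1 t + k2 t"
  have mk: "?k \<in> borel_measurable lebesgue" using k1 k2 by measurable
  have "?k \<in> Lp_loc p"
  proof -
    have "(\<integral>\<^sup>+t\<in>{a..b}. ennreal (norm (?k t) ^ p) \<partial>lebesgue) \<le> ennreal (2 ^ p) *
        ((\<integral>\<^sup>+t\<in>{a..b}. ennreal (norm (k1 t) ^ p) \<partial>lebesgue) + (\<integral>\<^sup>+t\<in>{a..b}. ennreal (norm (k2 t) ^ p) \<partial>lebesgue))" for a b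
      using k1 k2 by (intro Lp_nn_add) auto
    moreover have "\<dots> a b < \<infinity>" for a b
      using k1(2,3) k2(2,3) by (auto simp: ennreal_mult_less_top)
    ultimately have "(\<integral>\<^sup>+t\<in>{a..b}. ennreal (norm (?k t) ^ p) \<partial>lebesgue) < \<infinity>" for a b
      by (rule le_less_trans)
    then show ?thesis using Lp_lebesgue_iff[OF mk] by (simp add: Lp_loc_def)
  qed
  moreover have "AE t in lebesgue. (\<forall>z\<in>K. norm ((f - g) (t, z)) \<le> ?k t) \<and>
        (\<forall>z1\<in>K. \<forall>z2\<in>K. norm ((f - g) (t, z1) - (f - g) (t, z2)) \<le> ?k t * norm (z1 - z2))"
    using k1(5) k2(5)
  proof eventually_elim
    case (elim t)
    have "norm ((f - g) (t, z)) \<le> ?k t" if "z \<in> K" for z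
    proof -
      have "norm (f (t, z)) \<le> k1 t" "norm (g (t, z)) \<le> k2 t" using elim that R by blast+
      then show ?thesis using norm_triangle_ineq4[of "f (t, z)" "g (t, z)"] by simp
    qed
    moreover have "norm ((f - g) (t, z1) - (f - g) (t, z2)) \<le> ?k t * norm (z1 - z2)" if "z1 \<in> K" "z2 \<in> K" for z1 z2
    proof -
      have "norm (f (t, z1) - f (t, z2)) \<le> k1 t * norm (z1 - z2)" "norm (g (t, z1) - g (t, z2)) \<le> k2 t * norm (z1 - z2)"
        using elim that R by blast+
      then show ?thesis
        using norm_triangle_ineq4[of "f (t, z1) - f (t, z2)" "g (t, z1) - g (t, z2)"]
        by (simp add: algebra_simps)
    qed
    ultimately show ?case by blast
  qed
  ultimately show "\<exists>m\<in>Lp_loc p. \<exists>l\<in>Lp_loc p. AE t in lebesgue.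
        (\<forall>z\<in>K. norm ((f - g) (t, z)) \<le> m t) \<and>
        (\<forall>z1\<in>K. \<forall>z2\<in>K. norm ((f - g) (t, z1) - (f - g) (t, z2)) \<le> l t * norm (z1 - z2))"
    by (intro bexI[of _ ?k])
qed

text \<open>Here Borel measurability of \<open>f\<close> in all variables enters: the graph map of
  \<open>w\<close> is continuous, and compositions of Borel functions are Borel.\<close>

lemma LC_comp_measurable:
  assumes "f \<in> LC p" "continuous_on UNIV w"
  shows "(\<lambda>t. f (t, w t)) \<in> borel_measurable lebesgue"
proof -
  have "(\<lambda>t. (t, w t)) \<in> borel_measurable borel"
    using assms(2) by (intro borel_measurable_continuous_onI continuous_intros)
  then have "(\<lambda>t. f (t, w t)) \<in> borel_measurable borel"
    using assms(1) measurable_compose[of "\<lambda>t. (t, w t)" borel borel f borel] by (auto simp: LC_def)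
  then show ?thesis by (auto intro: borel_measurable_subalgebra[of borel lebesgue])
qed

section \<open>Singular functions and the modulus \<open>\<tau>\<close>\<close>

text \<open>The Cantor function, obtained as the fixed point of its self-similarity equation. The
  map is a contraction on the closed set of bounded continuous functions with values in [0,1] that
  are 0 up to 0 and 1 from 1 on.\<close>

lemma ex_devils_staircase:
  obtains F :: "real \<Rightarrow> real" where "continuous_on UNIV F" "\<And>x. 0 \<le> F x" "\<And>x. F x \<le> 1"
    "F 0 = 0" "F 1 = 1" "\<And>x. F x = (F (3 * x) + F (3 * x - 2)) / 2"
    "\<And>x. x \<le> 0 \<Longrightarrow> F x = 0" "\<And>x. 1 \<le> x \<Longrightarrow> F x = 1"
proof -
  define S :: "(real \<Rightarrow>\<^sub>C real) set" where
    "S = PiC UNIV (\<lambda>x. if x \<le> 0 then {0} else if 1 \<le> x then {1} else {0..1})"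
  have S_iff: "g \<in> S \<longleftrightarrow> (\<forall>x. 0 \<le> apply_bcontfun g x \<and> apply_bcontfun g x \<le> 1) \<and>
      (\<forall>x\<le>0. apply_bcontfun g x = 0) \<and> (\<forall>x\<ge>1. apply_bcontfun g x = 1)" for g
  proof
    assume "g \<in> S"
    then have A: "g x \<in> (if x \<le> 0 then {0} else if 1 \<le> x then {1} else {0..1})" for x
      unfolding S_def mem_PiC_iff by (elim Pi_mem) simp
    have "0 \<le> g x \<and> g x \<le> 1 \<and> (x \<le> 0 \<longrightarrow> g x = 0) \<and> (1 \<le> x \<longrightarrow> g x = 1)" for x
      using A[of x] by (auto split: if_splits)
    then show "(\<forall>x. 0 \<le> g x \<and> g x \<le> 1) \<and> (\<forall>x\<le>0. g x = 0) \<and> (\<forall>x\<ge>1. g x = 1)" by blast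
  qed (auto simp: S_def mem_PiC_iff)
  define \<Phi> :: "(real \<Rightarrow>\<^sub>C real) \<Rightarrow> (real \<Rightarrow>\<^sub>C real)" where
    "\<Phi> g = Bcontfun (\<lambda>x. (g (3 * x) + g (3 * x - 2)) / 2)" for g
  have \<Phi>: "\<Phi> g x = (g (3 * x) + g (3 * x - 2)) / 2" for g x
  proof -
    have c: "continuous_on UNIV (apply_bcontfun g)" by simp
    obtain B where B: "\<And>x. norm (g x) \<le> B"
      using bounded_apply_bcontfun[of g] unfolding bounded_iff by auto
    have "norm ((g (3 * x) + g (3 * x - 2)) / 2) \<le> B" for x
      using B[of "3 * x"] B[of "3 * x - 2"] by (simp add: abs_le_iff)
    then have "bounded (range (\<lambda>x. (g (3 * x) + g (3 * x - 2)) / 2))"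
      unfolding bounded_iff by auto
    moreover have "continuous_on UNIV (\<lambda>x. (g (3 * x) + g (3 * x - 2)) / 2)"
      by (intro continuous_intros continuous_on_compose2[OF c]) auto
    ultimately have "(\<lambda>x. (g (3 * x) + g (3 * x - 2)) / 2) \<in> bcontfun" by (simp add: bcontfun_def)
    then show ?thesis by (simp add: \<Phi>_def Bcontfun_inverse)
  qed
  have "\<exists>!g\<in>S. \<Phi> g = g"
  proof (rule Banach_fix[of _ "1/2"])
    have "closed S" unfolding S_def by (rule closed_PiC) auto
    then show "complete S" by (simp add: complete_eq_closed)
    have "(\<lambda>x::real. max 0 (min 1 x)) \<in> bcontfun"
      unfolding bcontfun_def bounded_iff by (auto intro!: continuous_intros exI[of _ 1])
    then have "Bcontfun (\<lambda>x::real. max 0 (min 1 x)) \<in> S"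
      by (simp add: S_iff Bcontfun_inverse)
    then show "S \<noteq> {}" by blast
    show "\<Phi> ` S \<subseteq> S"
    proof (safe)
      fix g assume g: "g \<in> S"
      have "0 \<le> \<Phi> g x \<and> \<Phi> g x \<le> 1" for x
      proof -
        have "0 \<le> g (3 * x)" "g (3 * x) \<le> 1" "0 \<le> g (3 * x - 2)" "g (3 * x - 2) \<le> 1"
          using g unfolding S_iff by blast+
        then show ?thesis by (simp add: \<Phi>)
      qed
      moreover have "\<Phi> g x = 0" if "x \<le> 0" for x using g that by (auto simp: \<Phi> S_iff)
      moreover have "\<Phi> g x = 1" if "x \<ge> 1" for x using g that by (auto simp: \<Phi> S_iff)
      ultimately show "\<Phi> g \<in> S" by (simp add: S_iff)
    qed
    show "dist (\<Phi> g) (\<Phi> h) \<le> 1 / 2 * dist g h" if "g \<in> S" "h \<in> S" for g h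
    proof (rule dist_bound)
      fix x :: real
      have d: "\<bar>g y - h y\<bar> \<le> dist g h" for y using dist_bounded[of g y h] by (simp add: dist_real_def)
      have z: "g y = h y" if "y \<le> 0 \<or> 1 \<le> y" for y using \<open>g \<in> S\<close> \<open>h \<in> S\<close> that by (auto simp: S_iff)
      show "dist (\<Phi> g x) (\<Phi> h x) \<le> 1 / 2 * dist g h"
      \<comment> \<open>At most one of the arguments 3x and 3x - 2 lies strictly between 0 and 1; at
        the other one all members of \<open>S\<close> agree. So only one of the two halves
        contributes, which gives the factor 1/2.\<close>
      proof (cases "3 * x \<le> 2")
        case True
        then show ?thesis using z[of "3 * x - 2"] d[of "3 * x"]
          by (simp add: \<Phi> dist_real_def flip: diff_divide_distrib)
      next
        case False
        then show ?thesis using z[of "3 * x"] d[of "3 * x - 2"]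
          by (simp add: \<Phi> dist_real_def flip: diff_divide_distrib)
      qed
    qed
  qed auto
  then obtain g where g: "g \<in> S" "\<Phi> g = g" by blast
  show thesis
  proof (rule that[of "apply_bcontfun g"])
    show "g x = (g (3 * x) + g (3 * x - 2)) / 2" for x using \<Phi>[of g x] g(2) by simp
  qed (use g(1) in \<open>auto simp: S_iff\<close>)
qed

text \<open>Let \<open>U\<close> be the open set of points near which the Cantor function is
  constant. By self-similarity its complement is covered by two copies of itself shrunk by 1/3, so
  its measure is at most 2/3 of itself and hence 0.\<close>

lemma ex_singular_function:
  obtains F :: "real \<Rightarrow> real" where "continuous_on UNIV F" "\<And>x. 0 \<le> F x" "\<And>x. F x \<le> 1"
    "F 0 = 0" "F 1 = 1" "AE x in lebesgue. (F has_real_derivative 0) (at x)"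
proof -
  obtain F :: "real \<Rightarrow> real" where F: "continuous_on UNIV F" "\<And>x. 0 \<le> F x" "\<And>x. F x \<le> 1"
    "F 0 = 0" "F 1 = 1" and Feq: "\<And>x. F x = (F (3 * x) + F (3 * x - 2)) / 2"
    and F0: "\<And>x. x \<le> 0 \<Longrightarrow> F x = 0" and F1: "\<And>x. 1 \<le> x \<Longrightarrow> F x = 1"
    using ex_devils_staircase by blast
  define U where "U = {x. \<exists>e>0. \<forall>y. \<bar>y - x\<bar> < e \<longrightarrow> F y = F x}"
  have "open U"
    unfolding open_dist
  proof (intro ballI)
    fix x assume "x \<in> U"
    then obtain e where e: "e > 0" "\<forall>y. \<bar>y - x\<bar> < e \<longrightarrow> F y = F x" unfolding U_def by blast
    have "y \<in> U" if "dist y x < e/2" for y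
    proof -
      have "F z = F y" if "\<bar>z - y\<bar> < e/2" for z
      proof -
        have "\<bar>z - x\<bar> < e" "\<bar>y - x\<bar> < e" using that \<open>dist y x < e/2\<close> unfolding dist_real_def by linarith+
        then show ?thesis using e(2) by metis
      qed
      moreover have "0 < e/2" using e(1) by simp
      ultimately show ?thesis unfolding U_def by blast
    qed
    then show "\<exists>e>0. \<forall>y. dist y x < e \<longrightarrow> y \<in> U" using e(1) by (intro exI[of _ "e/2"]) simp
  qed
  have out: "x \<in> U" if "x < 0 \<or> 1 < x" for x
    using that
  proof
    assume "x < 0"
    then show ?thesis unfolding U_def by (auto intro!: exI[of _ "-x"] simp: F0)
  next
    assume "1 < x"
    then show ?thesis unfolding U_def by (auto intro!: exI[of _ "x - 1"] simp: F1)
  qed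
  have sub: "- U \<subseteq> {0..1}" 
  proof
    fix x assume "x \<in> - U"
    then have "\<not> (x < 0 \<or> 1 < x)" using out by blast
    then show "x \<in> {0..1}" by (simp add: not_less)
  qed
  have "compact (- U)"
    using \<open>open U\<close> bounded_subset[OF bounded_closed_interval sub]
    by (simp add: compact_eq_bounded_closed closed_Compl)
  then have lm: "- U \<in> lmeasurable" by (simp add: lmeasurable_compact)
  have step: "x \<in> U" if "3 * x \<in> U" "3 * x - 2 \<in> U" for x
  proof -
    obtain e1 where e1: "e1 > 0" "\<forall>y. \<bar>y - 3 * x\<bar> < e1 \<longrightarrow> F y = F (3 * x)"
      using \<open>3 * x \<in> U\<close> unfolding U_def by blast
    obtain e2 where e2: "e2 > 0" "\<forall>y. \<bar>y - (3 * x - 2)\<bar> < e2 \<longrightarrow> F y = F (3 * x - 2)"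
      using \<open>3 * x - 2 \<in> U\<close> unfolding U_def by blast
    have "F y = F x" if "\<bar>y - x\<bar> < min e1 e2 / 3" for y
    proof -
      have "\<bar>3 * y - 3 * x\<bar> = 3 * \<bar>y - x\<bar>" by (simp add: abs_if)
      then have "\<bar>3 * y - 3 * x\<bar> < min e1 e2" using that by linarith
      then have "F (3 * y) = F (3 * x)" "F (3 * y - 2) = F (3 * x - 2)"
        using e1(2)[rule_format, of "3 * y"] e2(2)[rule_format, of "3 * y - 2"] by auto
      then show ?thesis using Feq[of x] Feq[of y] by simp
    qed
    moreover have "0 < min e1 e2 / 3" using e1(1) e2(1) by simp
    ultimately show ?thesis unfolding U_def by blast
  qed
  let ?A = "\<lambda>d. (\<lambda>x. (1/3) *\<^sub>R x + d) ` (- U)"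
  have cover: "- U \<subseteq> ?A 0 \<union> ?A (2/3)"
  proof
    fix x assume "x \<in> - U"
    then have "3 * x \<in> - U \<or> 3 * x - 2 \<in> - U" using step by blast
    then show "x \<in> ?A 0 \<union> ?A (2/3)"
    proof
      assume "3 * x \<in> - U"
      then show ?thesis by (intro UnI1 image_eqI[of _ _ "3 * x"]) simp_all
    next
      assume "3 * x - 2 \<in> - U"
      then show ?thesis by (intro UnI2 image_eqI[of _ _ "3 * x - 2"]) (simp_all add: field_simps)
    qed
  qed
  have A: "?A d \<in> lmeasurable" for d
    using \<open>compact (- U)\<close> by (intro lmeasurable_compact compact_continuous_image continuous_intros)
  have mA: "measure lebesgue (?A d) = measure lebesgue (- U) / 3" for d
    using measure_lebesgue_affine[of "1/3" d "- U"] by simp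
  \<comment> \<open>The complement is compact, so its measure is finite; only then does being at
    most 2/3 of itself force a null set.\<close>
  have "measure lebesgue (- U) \<le> measure lebesgue (?A 0 \<union> ?A (2/3))"
    using fmeasurableD[OF lm] A[of 0] A[of "2/3"]
    by (intro measure_mono_fmeasurable[OF cover] fmeasurable.Un)
  also have "\<dots> \<le> measure lebesgue (?A 0) + measure lebesgue (?A (2/3))"
    using fmeasurableD[OF A] by (intro measure_Un_le)
  finally have "measure lebesgue (- U) \<le> 0" unfolding mA by simp
  then have "measure lebesgue (- U) = 0" by (simp add: measure_le_0_iff)
  then have "- U \<in> null_sets lebesgue"
    using lm by (simp add: negligible_iff_null_sets[symmetric] negligible_iff_measure)
  then have "AE x in lebesgue. x \<notin> - U" by (rule AE_not_in)
  then have "AE x in lebesgue. x \<in> U" by (simp only: Compl_iff not_not)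
  moreover have "(F has_real_derivative 0) (at x)" if "x \<in> U" for x
  proof -
    obtain e where e: "e > 0" "\<forall>y. \<bar>y - x\<bar> < e \<longrightarrow> F y = F x" using \<open>x \<in> U\<close> unfolding U_def by blast
    have "((\<lambda>_. F x) has_real_derivative 0) (at x)" by simp
    then show ?thesis
      by (rule has_field_derivative_transform_within[of _ _ _ _ e]) (use e in \<open>metis dist_real_def UNIV_I\<close>)+
  qed
  ultimately have "AE x in lebesgue. (F has_real_derivative 0) (at x)" by (rule eventually_mono)
  then show thesis by (rule that[OF F])
qed


lemma has_vector_derivative_imp_deriv_on:
  assumes "(x has_vector_derivative d) (at t within {a..b})" "a < b" "t \<in> {a..b}"
  shows "deriv_on {a..b} x t = d"
  unfolding deriv_on_def using assms by (intro vector_derivative_within_closed_interval)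

lemma Lp_zero: "(\<lambda>_. 0) \<in> Lp p S" if "0 < p" 
  using that by (auto simp: Lp_def zero_power)

text \<open>Since absolute continuity is not required in \<^const>\<open>C1p\<close>, singular functions of arbitrarily steep
  growth have small norm there, so \<open>\<tau>\<close> is as large as it can be away from 0.\<close>

lemma tau_ge:
  assumes "0 < h" "0 < p"
  shows "2 * real j \<le> tau TYPE('n::finite) p j h"
proof -
  obtain F :: "real \<Rightarrow> real" where F: "continuous_on UNIV F" "\<And>x. 0 \<le> F x" "\<And>x. F x \<le> 1"
    "F 0 = 0" "F 1 = 1" "AE x in lebesgue. (F has_real_derivative 0) (at x)"
    using ex_singular_function by blast
  \<comment> \<open>The whole rise is squeezed into [-1, d - 1]. Halving keeps its length strictly
    below \<open>min h 1\<close>, as the definition of \<open>tau\<close> demands, and inside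
    [-1,0].\<close>
  define d where "d = min h 1 / 2"
  have d: "0 < d" "d < min h 1" "d < 1" using assms by (auto simp: d_def min_def)
  define e :: "real^'n" where "e = axis undefined 1"
  have e: "norm e = 1" by (simp add: e_def norm_axis_1)
  \<comment> \<open>It runs from -j to j along a unit vector, so the supremum norm is at most
    \<open>j\<close> while the increment is 2j. As the derivative vanishes almost everywhere, the
    C1p norm is at most \<open>j\<close> as well.\<close>
  define \<phi> where "\<phi> t = (2 * real j * F ((t + 1) / d) - real j) *\<^sub>R e" for t
  have n: "norm (\<phi> t) \<le> real j" for t
  proof -
    have "0 \<le> real j * F ((t + 1) / d)" using F(2) by simp
    moreover have "real j * F ((t + 1) / d) \<le> real j * 1" using F(3) by (intro mult_left_mono) auto
    ultimately show ?thesis by (simp add: \<phi>_def e abs_le_iff)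
  qed
  have c: "continuous_on A \<phi>" for A
    unfolding \<phi>_def using d(1) by (intro continuous_intros continuous_on_compose2[OF F(1)]) auto
  obtain N where N: "N \<in> null_sets lebesgue" "\<And>x. x \<notin> N \<Longrightarrow> (F has_real_derivative 0) (at x)"
    using F(6) by (elim AE_E3) auto
  let ?N = "(\<lambda>x. d *\<^sub>R x + (- 1)) ` N"
  have "negligible ?N"
    using N(1) unfolding negligible_iff_null_sets[symmetric]
    by (intro negligible_differentiable_image_negligible) (auto intro!: derivative_intros)
  then have ae: "AE t in lebesgue. t \<notin> ?N"
    unfolding negligible_iff_null_sets by (rule AE_not_in)
  have der: "(\<phi> has_vector_derivative 0) (at t)" if "t \<notin> ?N" for t
  proof -
    have "(t + 1) / d \<notin> N" using that d(1) by (force simp: image_iff)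
    then have "(F has_real_derivative 0) (at ((t + 1) / d))" by (rule N(2))
    then have "((\<lambda>t. F ((t + 1) / d)) has_real_derivative 0 * (1 / d)) (at t)"
      by (rule DERIV_chain2) (use d(1) in \<open>auto intro!: derivative_eq_intros\<close>)
    then have "((\<lambda>t. 2 * real j * F ((t + 1) / d) - real j) has_real_derivative 2 * real j * (0 * (1 / d)) - 0) (at t)"
      by (intro DERIV_diff DERIV_cmult DERIV_const)
    then have "((\<lambda>t. 2 * real j * F ((t + 1) / d) - real j) has_real_derivative 0) (at t)" by simp
    then show ?thesis
      unfolding \<phi>_def by (rule has_vector_derivative_scaleR[OF _ has_vector_derivative_const, THEN has_vector_derivative_eq_rhs]) simp
  qed
  have dz: "AE t in lebesgue. t \<in> {-1..0} \<longrightarrow> 0 = deriv_on {-1..0} \<phi> t"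
    using ae
  proof eventually_elim
    case (elim t)
    then show ?case
      using has_vector_derivative_imp_deriv_on[OF has_vector_derivative_at_within[OF der[OF elim]], of "-1" 0] by simp
  qed
  have L: "deriv_on {-1..0} \<phi> \<in> Lp p {-1..0}"
    by (rule Lp_cong_AE[OF _ Lp_zero[OF \<open>0 < p\<close>] dz]) auto
  have L0: "Lp_norm p {-1..0} (deriv_on {-1..0} \<phi>) = 0"
  proof -
    have "(LINT t|lebesgue_on {-1..0}. norm (deriv_on {-1..0} \<phi> t) ^ p) = (LINT t|lebesgue_on {-1..0::real}. 0)"
    proof (rule integral_cong_AE)
      show "AE t in lebesgue_on {-1..0}. norm (deriv_on {-1..0} \<phi> t) ^ p = 0"
      proof -
        have "AE t in lebesgue. t \<in> {-1..0} \<longrightarrow> norm (deriv_on {-1..0} \<phi> t) ^ p = 0"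
          using dz \<open>0 < p\<close> by (auto elim!: eventually_mono simp: zero_power)
        then show ?thesis by (subst AE_restrict_space_iff) simp_all
      qed
    qed (use L in \<open>auto simp: Lp_def\<close>)
    then show ?thesis by (simp add: Lp_norm_def)
  qed
  have mem: "\<phi> \<in> C1p p {-1..0}"
  proof -
    have "AE t in lebesgue. t \<in> {-1..0} \<longrightarrow> \<phi> differentiable (at t within {-1..0})"
      using ae
    proof eventually_elim
      case (elim t)
      show ?case using differentiable_at_withinI[OF differentiableI_vector[OF der[OF elim]]] by simp
    qed
    then show ?thesis using c L by (simp add: C1p_def AE_restrict_space_iff)
  qed
  have "(SUP t\<in>{-1..0}. norm (\<phi> t)) \<le> real j" by (rule cSUP_least) (auto simp: n)
  then have nrm: "C1p_norm p {-1..0} \<phi> \<le> real j" by (simp add: C1p_norm_def L0)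
  let ?S = "{norm (\<phi> t - \<phi> s) | (\<phi> :: real \<Rightarrow> real^'n) t s.
            t \<in> {-1..0} \<and> s \<in> {-1..0} \<and> \<bar>t - s\<bar> < min h 1 \<and>
            \<phi> \<in> C1p p {-1..0} \<and> C1p_norm p {-1..0} \<phi> \<le> real j}"
  have "norm (\<phi> (d - 1) - \<phi> (-1)) \<le> Sup ?S"
  proof (rule cSup_upper)
    show "norm (\<phi> (d - 1) - \<phi> (-1)) \<in> ?S"
      using d mem nrm by (intro CollectI exI[of _ \<phi>] exI[of _ "d - 1"] exI[of _ "-1"]) auto
    \<comment> \<open>\<open>Sup\<close> on the reals is an upper bound only for sets that are
      bounded above.\<close>
    have "norm (\<psi> t - \<psi> s) \<le> real j + real j"
      if "t \<in> {-1..0}" "s \<in> {-1..0}" "\<psi> \<in> C1p p {-1..0}" "C1p_norm p {-1..0} \<psi> \<le> real j" for \<psi> :: "real \<Rightarrow> real^'n" and t s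
    proof -
      have "continuous_on {-1..0} \<psi>" using that by (simp add: C1p_def)
      then have b: "bdd_above ((\<lambda>t. norm (\<psi> t)) ` {-1..0})"
        by (intro compact_imp_bounded[THEN bounded_imp_bdd_above] compact_continuous_image continuous_intros) auto
      have "norm (\<psi> r) \<le> real j" if "r \<in> {-1..0}" for r
        using cSUP_upper[OF that b] \<open>C1p_norm p {-1..0} \<psi> \<le> real j\<close>
          Lp_norm_nonneg[of p "{-1..0}" "deriv_on {-1..0} \<psi>"]
        unfolding C1p_norm_def by linarith
      then show ?thesis using that norm_triangle_ineq4[of "\<psi> t" "\<psi> s"] by (meson add_mono order_trans)
    qed
    then show "bdd_above ?S" by (intro bdd_aboveI[of _ "real j + real j"]) blast
  qed
  moreover have "norm (\<phi> (d - 1) - \<phi> (-1)) = 2 * real j"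
    using d(1) F(4,5) by (simp add: \<phi>_def e flip: scaleR_diff_left scaleR_add_left)
  ultimately show ?thesis using assms by (simp add: tau_def)
qed

text \<open>Two points of the ball of radius \<open>j\<close> are at distance at most 2j, which
  \<open>tau_ge\<close> places below the modulus at every positive distance; at distance 0 both
  sides are compared with 0.\<close>

lemma Kset_theta_hat:
  fixes u :: "real \<Rightarrow> real^'n::finite" and E :: "'n rhs set"
  assumes "continuous_on {a..b} u" "\<And>t. t \<in> {a..b} \<Longrightarrow> norm (u t) \<le> real j" "0 < p"
  shows "u \<in> Kset (theta_hat p E) a b j"
proof -
  have "norm (u t - u s) \<le> theta_hat p E a b j \<bar>t - s\<bar>" if "t \<in> {a..b}" "s \<in> {a..b}" for t s
  proof (cases "t = s")
    case True
    then show ?thesis by (simp add: theta_hat_def tau_def)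
  next
    case False
    have "norm (u t - u s) \<le> real j + real j"
      using assms(2)[OF that(1)] assms(2)[OF that(2)] norm_triangle_ineq4[of "u t" "u s"] by linarith
    also have "\<dots> \<le> tau TYPE('n) p j \<bar>t - s\<bar>" using tau_ge[of "\<bar>t - s\<bar>" p j] False assms(3) by simp
    finally show ?thesis by (simp add: theta_hat_def)
  qed
  then show ?thesis using assms by (auto simp: Kset_def)
qed

section \<open>Solutions on compact intervals\<close>

text \<open>The compact-interval form of a solution, written with the gauge integral so that
  additivity over intervals and continuity of indefinite integrals apply directly.\<close>

definition dde_upto ::
  "('n::finite) rhs \<Rightarrow> (real \<Rightarrow> real^'n) \<Rightarrow> real \<Rightarrow> (real \<Rightarrow> real^'n) \<Rightarrow> bool" where
  "dde_upto f \<phi> T x \<longleftrightarrow> continuous_on {-1..T} x \<and> (\<forall>t\<in>{-1..0}. x t = \<phi> t) \<and>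
     (\<forall>t\<in>{0..T}. (\<lambda>s. f (s, x s, x (s - 1))) absolutely_integrable_on {0..t} \<and>
        x t = \<phi> 0 + integral {0..t} (\<lambda>s. f (s, x s, x (s - 1))))"

text \<open>Freezing a function at the ends of [-1,T] makes it continuous on the whole line.
  Compositions become measurable there, and a solution on a short interval becomes a candidate for
  the sets K over longer rational intervals.\<close>

definition clip :: "real \<Rightarrow> (real \<Rightarrow> 'b) \<Rightarrow> real \<Rightarrow> 'b" where
  "clip T x t = x (max (-1) (min t T))"

lemma clip_eq [simp]: "-1 \<le> t \<Longrightarrow> t \<le> T \<Longrightarrow> clip T x t = x t"
  by (simp add: clip_def)

lemma continuous_on_clip:
  fixes x :: "real \<Rightarrow> 'b::topological_space"
  assumes "continuous_on {-1..T} x" "-1 \<le> T"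
  shows "continuous_on A (clip T x)"
  unfolding clip_def
  by (rule continuous_on_compose2[OF assms(1)]) (use assms(2) in \<open>auto intro!: continuous_intros\<close>)

lemma norm_clip_le:
  assumes "\<And>t. t \<in> {-1..T} \<Longrightarrow> norm (x t) \<le> R" "-1 \<le> T"
  shows "norm (clip T x t) \<le> R"
  using assms(2) by (auto simp: clip_def intro!: assms(1))

text \<open>The Euclidean norm of a pair is at most the sum of the norms; this is where the radius
  \<open>2 * R\<close> for pairs of present and delayed state comes from.\<close>

lemma pair_mem_cball:
  fixes x u :: "'a::real_normed_vector"
  assumes "norm x \<le> R" "norm u \<le> S" "R + S \<le> Q"
  shows "(x, u) \<in> cball 0 Q"
  using norm_Pair_le[of x u] assms by (simp only: mem_cball_0)

lemma continuous_on_norm_bound: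
  fixes x :: "real \<Rightarrow> 'b::real_normed_vector"
  assumes "continuous_on {a..b} x"
  obtains R where "0 \<le> R" "\<And>t. t \<in> {a..b} \<Longrightarrow> norm (x t) \<le> R"
proof -
  have "bounded (x ` {a..b})" using assms by (simp add: compact_imp_bounded compact_continuous_image)
  then obtain R where R: "\<forall>y\<in>x ` {a..b}. norm y \<le> R" unfolding bounded_iff by blast
  have "norm (x t) \<le> max R 0" if "t \<in> {a..b}" for t using R that by (intro max.coboundedI1) blast
  then show thesis using that[of "max R 0"] by simp
qed

lemma dde_integrand_clip:
  fixes f :: "('n::finite) rhs"
  assumes "f \<in> LC p" "continuous_on {-1..T} x" "-1 \<le> T"
  shows "(\<lambda>s. f (s, clip T x s, clip T x (s - 1))) \<in> borel_measurable lebesgue"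
  by (rule LC_comp_measurable[OF assms(1)])
     (intro continuous_on_Pair continuous_on_clip[OF assms(2,3)]
        continuous_on_compose2[OF continuous_on_clip[OF assms(2,3), of UNIV]] continuous_intros; simp)+

text \<open>Continuity of \<open>x\<close> suffices, so for a constructed solution only the integral
  equation remains to be checked.\<close>

lemma absolutely_integrable_dde:
  fixes f :: "('n::finite) rhs"
  assumes "f \<in> LC p" "0 < p" "continuous_on {-1..T} x" "t \<le> T"
  shows "(\<lambda>s. f (s, x s, x (s - 1))) absolutely_integrable_on {0..t}"
proof (cases "0 \<le> t")
  case False
  then show ?thesis by (simp add: set_integrable_def)
next
  case True
  have T: "-1 \<le> T" using True assms(4) by simp
  obtain R where R: "0 \<le> R" "\<And>t. t \<in> {-1..T} \<Longrightarrow> norm (x t) \<le> R"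
    using continuous_on_norm_bound[OF assms(3)] by blast
  obtain k where k: "LC_bound p f (2 * R) k" using ex_LC_bound assms by blast
  let ?F = "\<lambda>s. f (s, clip T x s, clip T x (s - 1))"
  have "?F absolutely_integrable_on {0..t}"
  proof (rule absolutely_integrable_AE_bound[OF dde_integrand_clip[OF assms(1,3) T] _ LC_boundD(4)[OF k]])
    show "AE s in lebesgue. s \<in> {0..t} \<longrightarrow> norm (?F s) \<le> k s"
      using LC_boundD(5)[OF k]
    proof eventually_elim
      case (elim s)
      have "(clip T x s, clip T x (s - 1)) \<in> cball 0 (2 * R)"
        by (rule pair_mem_cball[of _ R _ R]) (use norm_clip_le[OF R(2) T] in auto)
      then show ?case using elim by blast
    qed
  qed auto
  then show ?thesis
    by (rule set_integrable_cong[THEN iffD1, rotated -1]) (use assms(4) in auto)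
qed

lemma dde_upto_mono:
  assumes "dde_upto f \<phi> T x" "T' \<le> T"
  shows "dde_upto f \<phi> T' x"
  using assms unfolding dde_upto_def by (auto intro: continuous_on_subset)

lemma dde_upto_cong:
  assumes "dde_upto f \<phi> T x" "\<And>t. t \<in> {-1..T} \<Longrightarrow> x t = y t" "0 \<le> T"
  shows "dde_upto f \<phi> T y"
proof -
  have eq: "f (s, x s, x (s - 1)) = f (s, y s, y (s - 1))" if "s \<in> {0..t}" "t \<le> T" for s t
    using assms(2)[of s] assms(2)[of "s - 1"] that by auto
  have "(\<lambda>s. f (s, y s, y (s - 1))) absolutely_integrable_on {0..t} \<and>
      y t = \<phi> 0 + integral {0..t} (\<lambda>s. f (s, y s, y (s - 1)))" if "t \<in> {0..T}" for t
  proof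
    have x: "(\<lambda>s. f (s, x s, x (s - 1))) absolutely_integrable_on {0..t}"
      "x t = \<phi> 0 + integral {0..t} (\<lambda>s. f (s, x s, x (s - 1)))"
      using assms(1) that unfolding dde_upto_def by blast+
    show "(\<lambda>s. f (s, y s, y (s - 1))) absolutely_integrable_on {0..t}"
      using x(1) by (rule set_integrable_cong[THEN iffD1, rotated -1]) (use eq that in auto)
    have "integral {0..t} (\<lambda>s. f (s, x s, x (s - 1))) = integral {0..t} (\<lambda>s. f (s, y s, y (s - 1)))"
      by (rule integral_cong) (use eq that in auto)
    then show "y t = \<phi> 0 + integral {0..t} (\<lambda>s. f (s, y s, y (s - 1)))"
      using x(2) assms(2)[of t] that by auto
  qed
  moreover have "continuous_on {-1..T} y"
    using assms(1,2) continuous_on_cong[OF refl, of "{-1..T}" x y] by (auto simp: dde_upto_def)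
  moreover have "\<forall>t\<in>{-1..0}. y t = \<phi> t"
    using assms by (auto simp: dde_upto_def)
  ultimately show ?thesis by (simp add: dde_upto_def)
qed

lemma dde_upto_diff:
  assumes "dde_upto f \<phi> T x" "0 \<le> s" "s \<le> t" "t \<le> T"
  shows "x t - x s = integral {s..t} (\<lambda>s. f (s, x s, x (s - 1)))"
    "(\<lambda>s. f (s, x s, x (s - 1))) absolutely_integrable_on {s..t}"
proof -
  let ?F = "\<lambda>s. f (s, x s, x (s - 1))"
  have i: "?F absolutely_integrable_on {0..t}" "x t = \<phi> 0 + integral {0..t} ?F" "x s = \<phi> 0 + integral {0..s} ?F"
    using assms unfolding dde_upto_def by auto
  have "?F integrable_on {0..t}" using i(1) by (simp add: set_lebesgue_integral_eq_integral)
  then have "integral {0..s} ?F + integral {s..t} ?F = integral {0..t} ?F"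
    using assms by (intro Henstock_Kurzweil_Integration.integral_combine)
  then have "integral {s..t} ?F = integral {0..t} ?F - integral {0..s} ?F" by (simp add: eq_diff_eq add.commute)
  then show "x t - x s = integral {s..t} ?F" using i(2,3) by (simp only: add_diff_cancel_left)
  show "?F absolutely_integrable_on {s..t}"
    by (rule set_integrable_subset[OF i(1)]) (use assms in auto)
qed

text \<open>Continuity is local and the integral equation concerns one time at a time, so a
  half-open interval may be exhausted by compact ones. All later work is done with
  \<open>dde_upto\<close>.\<close>

lemma dde_solution_iff_upto:
  "dde_solution f \<phi> b x \<longleftrightarrow> 0 < b \<and> (\<forall>T\<ge>0. ereal T < b \<longrightarrow> dde_upto f \<phi> T x)"
proof
  assume sol: "dde_solution f \<phi> b x"
  have "dde_upto f \<phi> T x" if "0 \<le> T" "ereal T < b" for T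
  proof -
    have sub: "{-1..T} \<subseteq> dde_dom b" using that by (auto simp: dde_dom_def intro: le_less_trans[of _ "ereal T"])
    have "set_integrable lebesgue {0..t} (\<lambda>s. f (s, x s, x (s - 1))) \<and>
        x t = \<phi> 0 + integral {0..t} (\<lambda>s. f (s, x s, x (s - 1)))" if "t \<in> {0..T}" for t
    proof -
      have "ereal t < b" using that \<open>ereal T < b\<close> by (auto intro: le_less_trans[of _ "ereal T"])
      then show ?thesis
        using sol that unfolding dde_solution_def
        by (auto simp: set_lebesgue_integral_eq_integral(2))
    qed
    then show ?thesis
      using sol continuous_on_subset[OF _ sub] unfolding dde_solution_def dde_upto_def by blast
  qed
  then show "0 < b \<and> (\<forall>T\<ge>0. ereal T < b \<longrightarrow> dde_upto f \<phi> T x)"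
    using sol by (auto simp: dde_solution_def)
next
  assume R: "0 < b \<and> (\<forall>T\<ge>0. ereal T < b \<longrightarrow> dde_upto f \<phi> T x)"
  have "continuous_on (dde_dom b) x"
    unfolding continuous_on_eq_continuous_within
  proof
    fix t assume "t \<in> dde_dom b"
    then have t: "-1 \<le> t" "ereal t < b" by (auto simp: dde_dom_def)
    \<comment> \<open>An end point strictly beyond \<open>t\<close> is needed: the half-line below
      it is then a neighbourhood of \<open>t\<close> on which the compact interval and the domain
      agree.\<close>
    then have "max (ereal t) 0 < b" using R by simp
    then obtain T where T: "max (ereal t) 0 < ereal T" "ereal T < b"
      using ereal_dense2 by blast
    then have "t < T" "0 < T" by auto
    then have "continuous_on {-1..T} x" using R T(2) by (auto simp: dde_upto_def)
    then have "continuous (at t within {-1..T}) x"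
      using t \<open>t < T\<close> by (auto simp: continuous_on_eq_continuous_within)
    moreover have "at t within {-1..T} = at t within dde_dom b"
    proof (rule at_within_nhd[of _ "{..<T}"])
      have "s \<in> dde_dom b" if "-1 \<le> s" "s < T" for s
        using that T(2) by (auto simp: dde_dom_def intro: less_trans[of _ "ereal T"])
      then show "{-1..T} \<inter> {..<T} - {t} = dde_dom b \<inter> {..<T} - {t}"
        by (auto simp: dde_dom_def)
    qed (use \<open>t < T\<close> in auto)
    ultimately show "continuous (at t within dde_dom b) x" by simp
  qed
  moreover have "set_integrable lebesgue {0..t} (\<lambda>s. f (s, x s, x (s - 1))) \<and>
        x t = \<phi> 0 + (LINT s:{0..t}|lebesgue. f (s, x s, x (s - 1)))" if "0 \<le> t" "ereal t < b" for t
    using R that by (auto simp: dde_upto_def set_lebesgue_integral_eq_integral(2))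
  moreover have "\<forall>t\<in>{-1..0}. x t = \<phi> t"
  proof -
    obtain T where "0 < ereal T" "ereal T < b" using R ereal_dense2 by blast
    then have "dde_upto f \<phi> T x" using R by simp
    then show ?thesis by (simp add: dde_upto_def)
  qed
  ultimately show "dde_solution f \<phi> b x"
    using R by (auto simp: dde_solution_def)
qed

section \<open>Gronwall's inequality and uniqueness\<close>

text \<open>A discrete Gronwall argument. Time is cut so that the accumulated weight \<Lambda> grows
  by at most 1/2 per piece; on a piece the last term is at most half of \<open>U t\<close> and is
  absorbed, leaving U t \<le> 2 a + 2 U s. The induction runs over the number \<open>m\<close> of
  pieces.\<close>

lemma gronwall_doubling:
  fixes U \<Lambda> :: "real \<Rightarrow> real"
  assumes cont: "continuous_on {0..T} \<Lambda>" and "\<Lambda> 0 = 0" "0 \<le> a"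
    and U: "\<And>s t. 0 \<le> s \<Longrightarrow> s \<le> t \<Longrightarrow> t \<le> T \<Longrightarrow> U t \<le> a + U s + U t * (\<Lambda> t - \<Lambda> s)"
    and U0: "U 0 \<le> a" "\<And>t. t \<in> {0..T} \<Longrightarrow> 0 \<le> U t"
  shows "t \<in> {0..T} \<Longrightarrow> \<Lambda> t \<le> real m / 2 \<Longrightarrow> U t \<le> 2 * 4 ^ m * a"
proof (induction m arbitrary: t)
  case 0
  have "U t * \<Lambda> t \<le> 0" using 0 U0(2)[OF 0(1)] by (auto intro: mult_nonneg_nonpos)
  then show ?case using U[of 0 t] U0 0 \<open>\<Lambda> 0 = 0\<close> by simp
next
  case (Suc m)
  \<comment> \<open>The last cut is placed by the intermediate value theorem where \<Lambda> equals
    m/2, unless \<Lambda> has not yet exceeded that value at \<open>t\<close>.\<close>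
  obtain s where s: "0 \<le> s" "s \<le> t" "\<Lambda> s \<le> real m / 2" "\<Lambda> t - \<Lambda> s \<le> 1/2"
  proof (cases "\<Lambda> t \<le> real m / 2")
    case True
    then show ?thesis using that[of t] Suc.prems by simp
  next
    case False
    have "continuous_on {0..t} \<Lambda>" using Suc.prems by (auto intro: continuous_on_subset[OF cont])
    then obtain s where "0 \<le> s" "s \<le> t" "\<Lambda> s = real m / 2"
      using IVT'[of \<Lambda> 0 "real m / 2" t] False Suc.prems \<open>\<Lambda> 0 = 0\<close> by auto
    then show ?thesis using that[of s] Suc.prems by (simp add: field_simps)
  qed
  have "U s \<le> 2 * 4 ^ m * a" using s Suc.prems by (intro Suc.IH) auto
  moreover have "U t * (\<Lambda> t - \<Lambda> s) \<le> U t * (1/2)" using U0(2)[of t] s Suc.prems by (intro mult_left_mono) auto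
  ultimately have "U t \<le> 2 * a + 2 * (2 * 4 ^ m * a)"
    using U[of s t] s Suc.prems by auto
  \<comment> \<open>The factor 4 per piece leaves room for the additive term: 2 + 4 times 4^m is at
    most 6 times 4^m, hence below 2 times 4^(m+1).\<close>
  moreover have "a \<le> 4 ^ m * a" using \<open>0 \<le> a\<close> by (simp add: mult_le_cancel_right1)
  ultimately show ?case using \<open>0 \<le> a\<close> by simp
qed

text \<open>With \<open>U t\<close> the supremum of the distance over [-1,t], the delayed distance
  is bounded by \<open>U t\<close> too, so the delay equation is handled like an ordinary one with
  doubled weight.\<close>

lemma dde_upto_compare:
  fixes x y :: "real \<Rightarrow> real^'n::finite"
  assumes x: "dde_upto f \<phi> T x" and y: "dde_upto g \<psi> T y" and "0 \<le> T"
    and L: "L absolutely_integrable_on {0..T}" "\<And>t. 0 \<le> L t"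
    and r: "r absolutely_integrable_on {0..T}" "\<And>t. 0 \<le> r t"
    and ae: "AE t in lebesgue. t \<in> {0..T} \<longrightarrow> norm (f (t, x t, x (t - 1)) - g (t, y t, y (t - 1)))
        \<le> L t * (norm (x t - y t) + norm (x (t - 1) - y (t - 1))) + r t"
    and d: "\<And>t. t \<in> {-1..0} \<Longrightarrow> norm (\<phi> t - \<psi> t) \<le> d"
    and m: "integral {0..T} L \<le> real m / 4" and d': "integral {0..T} r \<le> d'"
    and "t \<in> {-1..T}"
  shows "norm (x t - y t) \<le> 2 * 4 ^ m * (d + d')"
proof -
  define U where "U t = (SUP s\<in>{-1..t}. norm (x s - y s))" for t
  \<comment> \<open>The 2 counts the present and the delayed distance; it turns the hypothesis with
    m/4 into the m/2 of the Gronwall lemma.\<close>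
  define \<Lambda> where "\<Lambda> t = integral {0..t} (\<lambda>s. 2 * L s)" for t
  let ?F = "\<lambda>t. f (t, x t, x (t - 1)) - g (t, y t, y (t - 1))"
  have cx: "continuous_on {-1..T} (\<lambda>s. norm (x s - y s))"
    using x y unfolding dde_upto_def by (intro continuous_intros) auto
  have bdd: "bdd_above ((\<lambda>s. norm (x s - y s)) ` {-1..t})" if "t \<le> T" for t
    using that by (intro bounded_imp_bdd_above compact_imp_bounded compact_continuous_image
        continuous_on_subset[OF cx]) auto
  have le_U: "norm (x s - y s) \<le> U t" if "-1 \<le> s" "s \<le> t" "t \<le> T" for s t
    unfolding U_def by (rule cSUP_upper[OF _ bdd]) (use that in auto)
  have U_nonneg: "0 \<le> U t" if "-1 \<le> t" "t \<le> T" for t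
    using order_trans[OF norm_ge_zero le_U[of t t]] that by simp
  have "0 \<le> d" using order_trans[OF norm_ge_zero d[of 0]] by simp
  have "0 \<le> integral {0..T} r" by (rule integral_nonneg) (use r in \<open>auto simp: set_lebesgue_integral_eq_integral\<close>)
  then have "0 \<le> d'" using d' by simp
  have iL: "(\<lambda>s. 2 * L s) integrable_on {0..T}" "r integrable_on {0..T}"
    using L r by (auto simp: set_lebesgue_integral_eq_integral)
  have cont: "continuous_on {0..T} \<Lambda>" unfolding \<Lambda>_def by (rule indefinite_integral_continuous_1[OF iL(1)])
  have \<Lambda>_mono: "\<Lambda> s \<le> \<Lambda> t" and \<Lambda>_diff: "integral {s..t} (\<lambda>s. 2 * L s) = \<Lambda> t - \<Lambda> s"
    if "0 \<le> s" "s \<le> t" "t \<le> T" for s t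
  proof -
    have i: "(\<lambda>s. 2 * L s) integrable_on {0..t}"
      using iL(1) that by (auto intro: integrable_on_subinterval)
    show *: "integral {s..t} (\<lambda>s. 2 * L s) = \<Lambda> t - \<Lambda> s"
      using Henstock_Kurzweil_Integration.integral_combine[OF that(1,2) i] by (simp add: \<Lambda>_def)
    have "0 \<le> integral {s..t} (\<lambda>s. 2 * L s)"
      by (rule integral_nonneg) (use L that i in \<open>auto intro: integrable_on_subinterval\<close>)
    then show "\<Lambda> s \<le> \<Lambda> t" using * by simp
  qed
  have step: "U t \<le> (d + d') + U s + U t * (\<Lambda> t - \<Lambda> s)" if st: "0 \<le> s" "s \<le> t" "t \<le> T" for s t
    unfolding U_def[of t]
  proof (rule cSUP_least)
    show "{-1..t} \<noteq> {}" using st by auto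
    fix \<tau> assume \<tau>: "\<tau> \<in> {-1..t}"
    have nn: "0 \<le> U t * (\<Lambda> t - \<Lambda> s)"
      using U_nonneg[of t] \<Lambda>_mono[OF st] st by auto
    have "norm (x \<tau> - y \<tau>) \<le> (d + d') + U s + U t * (\<Lambda> t - \<Lambda> s)"
    \<comment> \<open>Up to \<open>s\<close> the supremum \<open>U s\<close> already bounds the
      distance; beyond \<open>s\<close> only the increments from \<open>s\<close> onwards are
      integrated.\<close>
    proof (cases "\<tau> \<le> s")
      case True
      then show ?thesis using le_U[of \<tau> s] \<tau> st nn \<open>0 \<le> d\<close> \<open>0 \<le> d'\<close> by auto
    next
      case False
      have sub: "{s..\<tau>} \<subseteq> {0..T}" using st \<tau> by auto
      have Fi: "?F absolutely_integrable_on {s..\<tau>}"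
        using dde_upto_diff(2)[OF x, of s \<tau>] dde_upto_diff(2)[OF y, of s \<tau>] False st \<tau> by auto
      have ki: "(\<lambda>\<sigma>. U t * (2 * L \<sigma>) + r \<sigma>) absolutely_integrable_on {s..\<tau>}"
        using set_integrable_subset[OF L(1) _ sub] set_integrable_subset[OF r(1) _ sub] by auto
      have "(x \<tau> - x s) - (y \<tau> - y s) = integral {s..\<tau>} ?F"
        using dde_upto_diff[OF x, of s \<tau>] dde_upto_diff[OF y, of s \<tau>] False st \<tau>
        by (simp add: Henstock_Kurzweil_Integration.integral_diff set_lebesgue_integral_eq_integral(1))
      moreover have "norm (integral {s..\<tau>} ?F) \<le> integral {s..\<tau>} (\<lambda>\<sigma>. U t * (2 * L \<sigma>) + r \<sigma>)"
      proof (rule norm_integral_le_AE[OF Fi ki])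
        show "AE \<sigma> in lebesgue. \<sigma> \<in> {s..\<tau>} \<longrightarrow> norm (?F \<sigma>) \<le> U t * (2 * L \<sigma>) + r \<sigma>"
          using ae
        proof eventually_elim
          case (elim \<sigma>)
          show ?case
          proof
            assume \<sigma>: "\<sigma> \<in> {s..\<tau>}"
            have "norm (?F \<sigma>) \<le> L \<sigma> * (norm (x \<sigma> - y \<sigma>) + norm (x (\<sigma> - 1) - y (\<sigma> - 1))) + r \<sigma>"
              using elim sub \<sigma> by blast
            also have "\<dots> \<le> L \<sigma> * (U t + U t) + r \<sigma>"
              using \<sigma> st \<tau> L(2)[of \<sigma>] by (intro add_right_mono mult_left_mono add_mono le_U) auto
            finally show "norm (?F \<sigma>) \<le> U t * (2 * L \<sigma>) + r \<sigma>" by (simp add: algebra_simps)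
          qed
        qed
      qed
      also have "integral {s..\<tau>} (\<lambda>\<sigma>. U t * (2 * L \<sigma>) + r \<sigma>)
          = U t * (\<Lambda> \<tau> - \<Lambda> s) + integral {s..\<tau>} r"
      proof -
        have i2: "(\<lambda>\<sigma>. 2 * L \<sigma>) integrable_on {s..\<tau>}" "r integrable_on {s..\<tau>}"
          by (rule integrable_on_subinterval[OF _ sub], rule iL)+
        have "(\<lambda>\<sigma>. U t * (2 * L \<sigma>)) integrable_on {s..\<tau>}"
          using i2(1) by (rule integrable_on_mult_right)
        then have "integral {s..\<tau>} (\<lambda>\<sigma>. U t * (2 * L \<sigma>) + r \<sigma>)
            = U t * integral {s..\<tau>} (\<lambda>\<sigma>. 2 * L \<sigma>) + integral {s..\<tau>} r"
          using i2(2) by (subst Henstock_Kurzweil_Integration.integral_add) (simp_all only: integral_mult_right)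
        moreover have "integral {s..\<tau>} (\<lambda>\<sigma>. 2 * L \<sigma>) = \<Lambda> \<tau> - \<Lambda> s"
          using False st \<tau> by (intro \<Lambda>_diff) auto
        ultimately show ?thesis by simp
      qed
      also have "\<dots> \<le> U t * (\<Lambda> t - \<Lambda> s) + d'"
      proof (rule add_mono)
        show "U t * (\<Lambda> \<tau> - \<Lambda> s) \<le> U t * (\<Lambda> t - \<Lambda> s)"
          using \<Lambda>_mono[of \<tau> t] False st \<tau> U_nonneg[of t] by (intro mult_left_mono) auto
        have "integral {s..\<tau>} r \<le> integral {0..T} r"
          by (rule integral_subset_le[OF sub]) (use r iL integrable_on_subinterval[OF _ sub] in auto)
        then show "integral {s..\<tau>} r \<le> d'" using d' by simp
      qed
      finally have "norm ((x \<tau> - x s) - (y \<tau> - y s)) \<le> U t * (\<Lambda> t - \<Lambda> s) + d'" by simp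
      moreover have "norm (x s - y s) \<le> U s" using st by (intro le_U) auto
      moreover have "norm (x \<tau> - y \<tau>) \<le> norm ((x \<tau> - x s) - (y \<tau> - y s)) + norm (x s - y s)"
        using norm_triangle_ineq[of "(x \<tau> - x s) - (y \<tau> - y s)" "x s - y s"] by (simp add: algebra_simps)
      ultimately show ?thesis using \<open>0 \<le> d\<close> by linarith
    qed
    then show "norm (x \<tau> - y \<tau>) \<le> (d + d') + U s + (SUP s\<in>{-1..t}. norm (x s - y s)) * (\<Lambda> t - \<Lambda> s)"
      by (simp add: U_def)
  qed
  have init: "norm (x s - y s) \<le> d" if "s \<in> {-1..0}" for s
    using x y d[OF that] that by (simp add: dde_upto_def)
  have "U 0 \<le> d" unfolding U_def by (rule cSUP_least) (use init in auto)
  then have U0: "U 0 \<le> d + d'" using \<open>0 \<le> d'\<close> by simp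
  have "\<Lambda> T \<le> real m / 2" using m by (simp add: \<Lambda>_def)
  then have "U T \<le> 2 * 4 ^ m * (d + d')"
    using \<open>0 \<le> d\<close> \<open>0 \<le> d'\<close> \<open>0 \<le> T\<close> U0 U_nonneg step
    by (intro gronwall_doubling[OF cont, of "d + d'" U T m]) (auto simp: \<Lambda>_def)
  moreover have "norm (x t - y t) \<le> U T" using le_U[of t T] \<open>t \<in> {-1..T}\<close> by simp
  ultimately show ?thesis by simp
qed

text \<open>The comparison with equal data and zero remainder, whose bound is a multiple of 0; the
  weight is a Lipschitz bound on a ball containing both trajectories.\<close>

lemma dde_upto_unique:
  fixes f :: "('n::finite) rhs"
  assumes "f \<in> LC p" "0 < p" and x: "dde_upto f \<phi> T x" and y: "dde_upto f \<phi> T y" and "t \<in> {-1..T}"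
  shows "x t = y t"
proof (cases "0 \<le> T")
  case False
  then show ?thesis using assms by (auto simp: dde_upto_def)
next
  case True
  have "continuous_on {-1..T} x" "continuous_on {-1..T} y" using x y by (auto simp: dde_upto_def)
  note c = this
  obtain R1 where R1: "\<And>t. t \<in> {-1..T} \<Longrightarrow> norm (x t) \<le> R1" using continuous_on_norm_bound[OF c(1)] by blast
  obtain R2 where R2: "\<And>t. t \<in> {-1..T} \<Longrightarrow> norm (y t) \<le> R2" using continuous_on_norm_bound[OF c(2)] by blast
  define R where "R = max R1 R2"
  have R: "norm (x t) \<le> R" "norm (y t) \<le> R" if "t \<in> {-1..T}" for t
    using R1[OF that] R2[OF that] by (auto simp: R_def)
  obtain k where k: "LC_bound p f (2 * R) k" using ex_LC_bound assms by blast
  obtain m where m: "4 * integral {0..T} k \<le> real m" using real_arch_simple by blast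
  have "norm (x t - y t) \<le> 2 * 4 ^ m * (0 + 0)"
  proof (rule dde_upto_compare[OF x y True, where L = k and r = "\<lambda>_. 0"])
    show "AE t in lebesgue. t \<in> {0..T} \<longrightarrow> norm (f (t, x t, x (t - 1)) - f (t, y t, y (t - 1)))
        \<le> k t * (norm (x t - y t) + norm (x (t - 1) - y (t - 1))) + 0"
      using LC_boundD(5)[OF k]
    proof eventually_elim
      case (elim t)
      show ?case
      proof
        assume t: "t \<in> {0..T}"
        have "(x t, x (t - 1)) \<in> cball 0 (2 * R)" "(y t, y (t - 1)) \<in> cball 0 (2 * R)"
          by (rule pair_mem_cball[of _ R _ R]; use R t in auto)+
        then have "norm (f (t, x t, x (t - 1)) - f (t, y t, y (t - 1)))
            \<le> k t * norm ((x t, x (t - 1)) - (y t, y (t - 1)))" using elim by blast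
        also have "\<dots> \<le> k t * (norm (x t - y t) + norm (x (t - 1) - y (t - 1)))"
          using LC_boundD(2)[OF k] norm_Pair_le[of "x t - y t" "x (t - 1) - y (t - 1)"]
          by (intro mult_left_mono) auto
        finally show "norm (f (t, x t, x (t - 1)) - f (t, y t, y (t - 1)))
            \<le> k t * (norm (x t - y t) + norm (x (t - 1) - y (t - 1))) + 0" by simp
      qed
    qed
  qed (use m LC_boundD(2,4)[OF k] \<open>t \<in> {-1..T}\<close> in auto)
  then show ?thesis by simp
qed

section \<open>Local existence and maximal solutions\<close>

lemma absolutely_integrable_imp_integrable_on:
  fixes g :: "real \<Rightarrow> 'b::euclidean_space"
  shows "g absolutely_integrable_on S \<Longrightarrow> g integrable_on S"
  by (rule set_lebesgue_integral_eq_integral(1))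

text \<open>The step \<open>h\<close> depends only on a bound for the solution, so a bounded solution can be continued
  past any finite time.\<close>

lemma dde_local_existence:
  fixes f :: "('n::finite) rhs"
  assumes f: "f \<in> LC p" "0 < p" and "0 \<le> R" "0 \<le> B"
  obtains h where "0 < h" "\<And>\<phi> x t0. 0 \<le> t0 \<Longrightarrow> t0 \<le> B \<Longrightarrow> dde_upto f \<phi> t0 x \<Longrightarrow>
      (\<And>t. t \<in> {-1..t0} \<Longrightarrow> norm (x t) \<le> R) \<Longrightarrow> \<exists>x'. dde_upto f \<phi> (t0 + h) x' \<and> (\<forall>t\<in>{-1..t0}. x' t = x t)"
proof -
  \<comment> \<open>The new piece stays within distance 1 of its starting value, so the present
    state is bounded by R + 1 and the delayed one by R.\<close>
  obtain k where k: "LC_bound p f (2 * R + 1) k" using ex_LC_bound f by blast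
  note ki = LC_boundD(4)[OF k, THEN absolutely_integrable_imp_integrable_on]
  \<comment> \<open>Uniform continuity is what makes the step independent of the starting time in
    [0,B].\<close>
  have "uniformly_continuous_on {0..B + 1} (\<lambda>t. integral {0..t} k)"
    by (intro compact_uniformly_continuous indefinite_integral_continuous_1 ki compact_Icc)
  then obtain \<delta> where \<delta>: "0 < \<delta>" "\<forall>s\<in>{0..B+1}. \<forall>t\<in>{0..B+1}. dist t s < \<delta> \<longrightarrow>
      dist (integral {0..t} k) (integral {0..s} k) < 1/2"
    unfolding uniformly_continuous_on_def by (metis half_gt_zero zero_less_one)
  \<comment> \<open>Below \<delta> for the smallness of the integral of \<open>k\<close>; at most 1
    so that the delayed argument never passes \<open>t0\<close>.\<close>
  define h where "h = min (\<delta> / 2) 1"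
  have h: "0 < h" "h \<le> 1" "h < \<delta>" using \<delta>(1) by (auto simp: h_def min_def)
  have small: "integral {t0..t} k \<le> 1/2" if "0 \<le> t0" "t0 \<le> B" "t0 \<le> t" "t \<le> t0 + h" for t0 t
  proof -
    have "integral {t0..t} k = integral {0..t} k - integral {0..t0} k"
      using Henstock_Kurzweil_Integration.integral_combine[OF that(1,3) ki] by (simp add: eq_diff_eq add.commute)
    moreover have "dist (integral {0..t} k) (integral {0..t0} k) < 1/2"
      using \<delta>(2) that h by (auto simp: dist_real_def)
    ultimately show ?thesis unfolding dist_real_def by linarith
  qed
  have "\<exists>x'. dde_upto f \<phi> (t0 + h) x' \<and> (\<forall>t\<in>{-1..t0}. x' t = x t)"
    if t0: "0 \<le> t0" "t0 \<le> B" and x: "dde_upto f \<phi> t0 x" and xR: "\<And>t. t \<in> {-1..t0} \<Longrightarrow> norm (x t) \<le> R"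
    for \<phi> x t0
  proof -
    \<comment> \<open>Clamping the upper limit of integration lets the fixed point problem live on
      bounded continuous functions on the whole line, a complete space.\<close>
    define cl where "cl t = max t0 (min t (t0 + h))" for t
    have cl: "t0 \<le> cl t" "cl t \<le> t0 + h" for t using h(1) by (auto simp: cl_def)
    \<comment> \<open>Method of steps: on the new interval the delayed state is already known, so
      the unknown enters \<open>f\<close> in the first argument only.\<close>
    define v where "v s = clip t0 x (s - 1)" for s
    have cx: "continuous_on {-1..t0} x" using x by (simp add: dde_upto_def)
    have cv: "continuous_on A v" for A
      unfolding v_def using t0
      by (intro continuous_on_compose2[OF continuous_on_clip[OF cx, of UNIV]] continuous_intros) auto
    have vR: "norm (v s) \<le> R" for s unfolding v_def using t0 by (intro norm_clip_le xR) auto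
    have x0R: "norm (x t0) \<le> R" using xR t0 by auto
    define S :: "(real \<Rightarrow>\<^sub>C (real^'n)) set" where "S = PiC UNIV (\<lambda>_. cball (x t0) 1)"
    have S_iff: "g \<in> S \<longleftrightarrow> (\<forall>t. norm (apply_bcontfun g t - x t0) \<le> 1)" for g
      by (auto simp: S_def mem_PiC_iff Pi_iff dist_norm norm_minus_commute)
    define G where "G g s = f (s, apply_bcontfun g s, v s)" for g s
    define \<Phi> where "\<Phi> g = Bcontfun (\<lambda>t. x t0 + integral {t0..cl t} (G g))" for g
    have gR: "norm (apply_bcontfun g t) \<le> R + 1" if "g \<in> S" for g t
    proof -
      have "norm (apply_bcontfun g t - x t0) \<le> 1" using that unfolding S_iff by blast
      then show ?thesis using x0R norm_triangle_sub[of "apply_bcontfun g t" "x t0"] by linarith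
    qed
    have mem: "(apply_bcontfun g t, v t) \<in> cball 0 (2 * R + 1)" if "g \<in> S" for g t
      by (rule pair_mem_cball[OF gR[OF that] vR]) simp
    have aeG: "AE s in lebesgue. s \<in> A \<longrightarrow> norm (G g s) \<le> k s" if "g \<in> S" for g A
      using LC_boundD(5)[OF k]
    proof eventually_elim
      case (elim s)
      then show ?case using mem[OF that] unfolding G_def by blast
    qed
    have Gi: "G g absolutely_integrable_on {a..b}" if "g \<in> S" for g a b
    proof (rule absolutely_integrable_AE_bound[OF _ _ LC_boundD(4)[OF k] aeG[OF that]])
      show "G g \<in> borel_measurable lebesgue"
        unfolding G_def by (rule LC_comp_measurable[OF f(1)]) (intro continuous_on_Pair cv, simp)
    qed auto
    have le: "norm (integral {t0..cl t} (G g)) \<le> 1/2" if "g \<in> S" for g t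
      using norm_integral_le_AE[OF Gi[OF that] LC_boundD(4)[OF k] aeG[OF that], of t0 "cl t"]
        small[OF t0 cl, of t] by linarith
    have \<Phi>: "apply_bcontfun (\<Phi> g) t = x t0 + integral {t0..cl t} (G g)" if "g \<in> S" for g t
    proof -
      have "continuous_on UNIV (\<lambda>t. x t0 + integral {t0..cl t} (G g))"
        using cl unfolding cl_def
        by (intro continuous_intros continuous_on_compose2[OF
              indefinite_integral_continuous_1[OF absolutely_integrable_imp_integrable_on[OF Gi[OF that, of t0 "t0 + h"]]]]) auto
      then have "(\<lambda>t. x t0 + integral {t0..cl t} (G g)) \<in> bcontfun"
      proof (rule bcontfun_normI)
        show "norm (x t0 + integral {t0..cl t} (G g)) \<le> R + 1/2" for t
          using norm_triangle_ineq[of "x t0" "integral {t0..cl t} (G g)"] le[OF that, of t] x0R by linarith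
      qed
      then show ?thesis by (simp add: \<Phi>_def Bcontfun_inverse)
    qed
    have "\<exists>!g\<in>S. \<Phi> g = g"
    proof (rule Banach_fix[of _ "1/2"])
      have "closed S" unfolding S_def by (rule closed_PiC) auto
      then show "complete S" by (simp add: complete_eq_closed)
      have "const_bcontfun (x t0) \<in> S" by (simp add: S_iff)
      then show "S \<noteq> {}" by blast
      show "\<Phi> ` S \<subseteq> S"
      proof safe
        fix g assume g: "g \<in> S"
        have "norm (apply_bcontfun (\<Phi> g) t - x t0) \<le> 1" for t
          using le[OF g, of t] by (simp add: \<Phi>[OF g])
        then show "\<Phi> g \<in> S" unfolding S_iff by blast
      qed
      \<comment> \<open>The delayed arguments coincide, so the Lipschitz bound sees only the
        difference of the two candidates, and the integral of \<open>k\<close> over the step, at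
        most 1/2, is the contraction constant.\<close>
      show "dist (\<Phi> g) (\<Phi> g') \<le> 1/2 * dist g g'" if g: "g \<in> S" "g' \<in> S" for g g'
      proof (rule dist_bound)
        fix t
        have "apply_bcontfun (\<Phi> g) t - apply_bcontfun (\<Phi> g') t = integral {t0..cl t} (\<lambda>s. G g s - G g' s)"
          using Gi[OF g(1)] Gi[OF g(2)]
          by (simp add: \<Phi> g Henstock_Kurzweil_Integration.integral_diff absolutely_integrable_imp_integrable_on)
        moreover have "norm (integral {t0..cl t} (\<lambda>s. G g s - G g' s)) \<le> integral {t0..cl t} (\<lambda>s. dist g g' * k s)"
        proof (rule norm_integral_le_AE)
          show "(\<lambda>s. G g s - G g' s) absolutely_integrable_on {t0..cl t}" using Gi g by auto
          show "(\<lambda>s. dist g g' * k s) absolutely_integrable_on {t0..cl t}" using LC_boundD(4)[OF k] by auto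
          show "AE s in lebesgue. s \<in> {t0..cl t} \<longrightarrow> norm (G g s - G g' s) \<le> dist g g' * k s"
            using LC_boundD(5)[OF k]
          proof eventually_elim
            case (elim s)
            have "norm (G g s - G g' s) \<le> k s * norm ((apply_bcontfun g s, v s) - (apply_bcontfun g' s, v s))"
              using elim mem[OF g(1), of s] mem[OF g(2), of s] unfolding G_def by blast
            also have "\<dots> = k s * dist (apply_bcontfun g s) (apply_bcontfun g' s)"
              by (simp add: norm_Pair dist_norm)
            also have "\<dots> \<le> k s * dist g g'" by (intro mult_left_mono dist_bounded LC_boundD(2)[OF k])
            finally show ?case by (simp add: mult.commute)
          qed
        qed
        moreover have "integral {t0..cl t} (\<lambda>s. dist g g' * k s) = dist g g' * integral {t0..cl t} k"
          by (rule integral_mult_right)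
        moreover have "dist g g' * integral {t0..cl t} k \<le> dist g g' * (1/2)"
          using small[OF t0 cl, of t] by (intro mult_left_mono) auto
        ultimately show "dist (apply_bcontfun (\<Phi> g) t) (apply_bcontfun (\<Phi> g') t) \<le> 1/2 * dist g g'"
          by (simp add: dist_norm)
      qed
    qed auto
    then obtain g where g: "g \<in> S" "\<Phi> g = g" by blast
    have geq: "apply_bcontfun g t = x t0 + integral {t0..cl t} (G g)" for t using \<Phi>[OF g(1), of t] g(2) by simp
    have g0: "apply_bcontfun g t0 = x t0" using geq[of t0] h(1) by (simp add: cl_def)
    define x' where "x' t = (if t \<le> t0 then x t else apply_bcontfun g t)" for t
    have "continuous_on ({-1..t0} \<union> {t0..t0 + h}) x'"
      unfolding x'_def
      by (rule continuous_on_If) (use cx g0 in \<open>auto intro: continuous_on_subset\<close>)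
    moreover have "{-1..t0} \<union> {t0..t0 + h} = {-1..t0 + h}" using t0 h by auto
    ultimately have c': "continuous_on {-1..t0 + h} x'" by simp
    have int': "(\<lambda>s. f (s, x' s, x' (s - 1))) absolutely_integrable_on {0..t}" if "t \<le> t0 + h" for t
      by (rule absolutely_integrable_dde[OF f c' that])
    have eq1: "integral {0..t} (\<lambda>s. f (s, x' s, x' (s - 1))) = integral {0..t} (\<lambda>s. f (s, x s, x (s - 1)))" if "t \<le> t0" for t
      by (rule integral_cong) (use that in \<open>auto simp: x'_def\<close>)
    have eq2: "integral {t0..t} (\<lambda>s. f (s, x' s, x' (s - 1))) = integral {t0..t} (G g)" if "t \<le> t0 + h" for t
    proof (rule integral_cong)
      fix s assume s: "s \<in> {t0..t}"
      have "x' s = apply_bcontfun g s" using s g0 by (cases "s = t0") (auto simp: x'_def)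
      moreover have "x' (s - 1) = v s" using s that h t0 by (auto simp: x'_def v_def)
      ultimately show "f (s, x' s, x' (s - 1)) = G g s" by (simp add: G_def)
    qed
    have "x' t = \<phi> 0 + integral {0..t} (\<lambda>s. f (s, x' s, x' (s - 1)))" if t: "t \<in> {0..t0 + h}" for t
    proof (cases "t \<le> t0")
      case True
      then have "x t = \<phi> 0 + integral {0..t} (\<lambda>s. f (s, x s, x (s - 1)))" using x t by (simp add: dde_upto_def)
      moreover have "x' t = x t" using True by (simp add: x'_def)
      ultimately show ?thesis using eq1[OF True] by (simp only:)
    next
      case False
      have "integral {0..t} (\<lambda>s. f (s, x' s, x' (s - 1))) = integral {0..t0} (\<lambda>s. f (s, x' s, x' (s - 1)))
          + integral {t0..t} (\<lambda>s. f (s, x' s, x' (s - 1)))"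
        using t0 False t int'[of t]
        by (subst Henstock_Kurzweil_Integration.integral_combine) (auto intro: absolutely_integrable_imp_integrable_on)
      also have "\<dots> = integral {0..t0} (\<lambda>s. f (s, x s, x (s - 1))) + integral {t0..t} (G g)"
        using eq1[of t0] eq2[of t] t by simp
      finally have "\<phi> 0 + integral {0..t} (\<lambda>s. f (s, x' s, x' (s - 1))) = x t0 + integral {t0..t} (G g)"
        using x t0 by (simp add: dde_upto_def)
      moreover have "cl t = t" using False t by (auto simp: cl_def)
      ultimately show ?thesis using geq[of t] False by (simp add: x'_def)
    qed
    moreover have "\<forall>t\<in>{-1..0}. x' t = \<phi> t" using x t0 by (auto simp: x'_def dde_upto_def)
    ultimately have "dde_upto f \<phi> (t0 + h) x'" using c' int' by (simp add: dde_upto_def)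
    then show ?thesis by (intro exI[of _ x']) (simp add: x'_def)
  qed
  with h(1) show thesis using that by blast
qed

section \<open>Maximal solutions and the continuation criterion\<close>

lemma dde_solution_upto:
  "dde_solution f \<phi> b x \<Longrightarrow> 0 \<le> T \<Longrightarrow> ereal T < b \<Longrightarrow> dde_upto f \<phi> T x"
  by (simp add: dde_solution_iff_upto)

lemma dde_upto_solution:
  "dde_upto f \<phi> T x \<Longrightarrow> 0 < T \<Longrightarrow> dde_solution f \<phi> (ereal T) x"
  by (auto simp: dde_solution_iff_upto intro: dde_upto_mono)

lemma dde_solution_unique:
  fixes f :: "('n::finite) rhs"
  assumes f: "f \<in> LC p" "0 < p" and x: "dde_solution f \<phi> b x" and y: "dde_solution f \<phi> c y"
    and t: "t \<in> dde_dom b" "t \<in> dde_dom c"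
  shows "x t = y t"
proof -
  have "max (ereal t) 0 < min b c" using x y t by (auto simp: dde_dom_def dde_solution_def)
  then obtain T where T: "max (ereal t) 0 < ereal T" "ereal T < min b c" using ereal_dense2 by blast
  then have "0 \<le> T" "t \<in> {-1..T}" using t by (auto simp: dde_dom_def)
  then show ?thesis
    using T(2) by (intro dde_upto_unique[OF f dde_solution_upto[OF x] dde_solution_upto[OF y]]) auto
qed

text \<open>The maximal solution is the union of all solutions, which agree on common domains by
  uniqueness; its end is the supremum of their ends. Local existence from time 0 shows that this
  supremum is positive.\<close>

lemma ex_dde_maximal_solution:
  fixes f :: "('n::finite) rhs"
  assumes f: "f \<in> LC p" "0 < p" and \<phi>: "continuous_on {-1..0} \<phi>"
  shows "\<exists>b x. dde_maximal_solution f \<phi> b x"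
proof -
  define C where "C = {c. \<exists>x. dde_solution f \<phi> c x}"
  define b where "b = Sup C"
  have "dde_upto f \<phi> 0 \<phi>"
    using \<phi> absolutely_integrable_on_null[of "0::real" 0] by (auto simp: dde_upto_def)
  moreover obtain R where "0 \<le> R" "\<And>t. t \<in> {-1..0} \<Longrightarrow> norm (\<phi> t) \<le> R"
    using continuous_on_norm_bound[OF \<phi>] by blast
  moreover obtain h where "0 < h" "\<And>\<psi> x t0. 0 \<le> t0 \<Longrightarrow> t0 \<le> 0 \<Longrightarrow> dde_upto f \<psi> t0 x \<Longrightarrow>
      (\<And>t. t \<in> {-1..t0} \<Longrightarrow> norm (x t) \<le> R) \<Longrightarrow> \<exists>x'. dde_upto f \<psi> (t0 + h) x' \<and> (\<forall>t\<in>{-1..t0}. x' t = x t)"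
    using dde_local_existence[OF f \<open>0 \<le> R\<close> order_refl] by blast
  ultimately obtain x' where "dde_upto f \<phi> h x'" by force
  then have "ereal h \<in> C" using \<open>0 < h\<close> by (auto simp: C_def intro: dde_upto_solution)
  then have "0 < b" using \<open>0 < h\<close> unfolding b_def less_Sup_iff by (intro bexI[of _ "ereal h"]) auto
  define X where "X c = (SOME x. dde_solution f \<phi> c x)" for c
  have X: "dde_solution f \<phi> c (X c)" if "c \<in> C" for c
    using that unfolding X_def C_def mem_Collect_eq by (rule someI_ex)
  \<comment> \<open>At each time any solution living beyond it may be consulted; uniqueness makes
    the choice irrelevant. The value \<open>undefined\<close> elsewhere is what
    \<open>extensional\<close> demands.\<close>
  define x where "x t = (if t \<in> dde_dom b then X (SOME c. c \<in> C \<and> ereal t < c) t else undefined)" for t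
  have x_eq: "x t = y t" if y: "dde_solution f \<phi> c y" and t: "t \<in> dde_dom c" for c y t
  proof -
    have "c \<in> C" using y by (auto simp: C_def)
    then have "ereal t < b" using t by (auto simp: b_def dde_dom_def less_Sup_iff)
    then have tb: "t \<in> dde_dom b" using t by (simp add: dde_dom_def)
    let ?c = "SOME c. c \<in> C \<and> ereal t < c"
    have "?c \<in> C \<and> ereal t < ?c" by (rule someI[of _ c]) (use \<open>c \<in> C\<close> t in \<open>simp add: dde_dom_def\<close>)
    then show ?thesis
      using dde_solution_unique[OF f X[of ?c] y _ t] tb t by (simp add: x_def dde_dom_def)
  qed
  have sol: "dde_solution f \<phi> b x"
    unfolding dde_solution_iff_upto
  proof (intro conjI allI impI)
    fix T :: real assume "0 \<le> T" "ereal T < b"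
    then obtain c where c: "c \<in> C" "ereal T < c" by (auto simp: b_def less_Sup_iff)
    show "dde_upto f \<phi> T x"
    proof (rule dde_upto_cong[OF dde_solution_upto[OF X[OF c(1)] \<open>0 \<le> T\<close> c(2)] _ \<open>0 \<le> T\<close>])
      fix t assume "t \<in> {-1..T}"
      then have "t \<in> dde_dom c" using c(2) by (auto simp: dde_dom_def intro: le_less_trans[of _ "ereal T"])
      then show "X c t = x t" using x_eq[OF X[OF c(1)]] by simp
    qed
  qed fact
  have "c = b" if "dde_solution f \<phi> c y" "b \<le> c" for c y
    using that by (auto simp: b_def C_def intro!: antisym Sup_upper)
  then have "dde_maximal_solution f \<phi> b x"
    using sol unfolding dde_maximal_solution_def by (auto simp: x_def extensional_def)
  then show ?thesis by blast
qed

text \<open>Of two maximal solutions, the one with the later end extends the other, so maximality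
  forces equal ends.\<close>

lemma dde_maximal_solution_unique:
  fixes f :: "('n::finite) rhs"
  assumes f: "f \<in> LC p" "0 < p" and x: "dde_maximal_solution f \<phi> b x" and y: "dde_maximal_solution f \<phi> c y"
  shows "b = c" "x = y"
proof -
  have eq: "b = c" if le: "b \<le> c" and x: "dde_maximal_solution f \<phi> b x" and y: "dde_maximal_solution f \<phi> c y" for b c x y
  proof -
    have "y t = x t" if "t \<in> dde_dom b" for t
    proof (rule dde_solution_unique[OF f])
      show "t \<in> dde_dom c" using that le by (auto simp: dde_dom_def)
    qed (use x y that in \<open>auto simp: dde_maximal_solution_def\<close>)
    then show ?thesis using x y le unfolding dde_maximal_solution_def by blast
  qed
  show "b = c" using eq[OF _ x y] eq[OF _ y x] by (cases rule: le_cases[of b c]) auto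
  then have "x t = y t" if "t \<in> dde_dom b" for t
    using dde_solution_unique[OF f, of \<phi> b x c y t] x y that by (simp add: dde_maximal_solution_def)
  then show "x = y"
    using x y \<open>b = c\<close> unfolding dde_maximal_solution_def by (auto intro: extensionalityI[of _ "dde_dom b"])
qed

text \<open>Existence and uniqueness give the two definite descriptions their meaning; every
  property of \<open>dde_sol\<close> and \<open>dde_end\<close> derives from this.\<close>

lemma dde_sol_maximal:
  fixes f :: "('n::finite) rhs"
  assumes f: "f \<in> LC p" "0 < p" and \<phi>: "continuous_on {-1..0} \<phi>"
  shows "dde_maximal_solution f \<phi> (dde_end f \<phi>) (dde_sol f \<phi>)"
proof -
  obtain b x where bx: "dde_maximal_solution f \<phi> b x" using ex_dde_maximal_solution[OF assms] by blast
  have b: "dde_end f \<phi> = b"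
    unfolding dde_end_def using bx dde_maximal_solution_unique(1)[OF f] by (intro the_equality) blast+
  have "dde_sol f \<phi> = x"
    unfolding dde_sol_def b using bx dde_maximal_solution_unique(2)[OF f] by (intro the_equality) blast+
  then show ?thesis using bx b by simp
qed

lemma dde_sol_upto:
  fixes f :: "('n::finite) rhs"
  assumes "f \<in> LC p" "0 < p" "continuous_on {-1..0} \<phi>" "0 \<le> T" "ereal T < dde_end f \<phi>"
  shows "dde_upto f \<phi> T (dde_sol f \<phi>)"
  using dde_sol_maximal[OF assms(1-3)] assms(4,5)
  by (auto simp: dde_maximal_solution_def intro: dde_solution_upto)

lemma dde_end_pos:
  fixes f :: "('n::finite) rhs"
  assumes "f \<in> LC p" "0 < p" "continuous_on {-1..0} \<phi>"
  shows "0 < dde_end f \<phi>"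
  using dde_sol_maximal[OF assms] by (simp add: dde_maximal_solution_def dde_solution_def)

lemma dde_sol_initial:
  fixes f :: "('n::finite) rhs"
  assumes "f \<in> LC p" "0 < p" "continuous_on {-1..0} \<phi>" "t \<in> {-1..0}"
  shows "dde_sol f \<phi> t = \<phi> t"
  using dde_sol_maximal[OF assms(1-3)] assms(4) by (simp add: dde_maximal_solution_def dde_solution_def)

text \<open>The bound is required only while the solution exists. If it ended at \<beta> \<le> T,
  the uniform local step applied shortly before \<beta> would continue it past \<beta>.\<close>

lemma less_dde_end:
  fixes f :: "('n::finite) rhs"
  assumes f: "f \<in> LC p" "0 < p" and \<phi>: "continuous_on {-1..0} \<phi>" and "0 \<le> T" "0 \<le> R"
    and bound: "\<And>s t. 0 \<le> s \<Longrightarrow> s \<le> T \<Longrightarrow> ereal s < dde_end f \<phi> \<Longrightarrow> t \<in> {-1..s} \<Longrightarrow> norm (dde_sol f \<phi> t) \<le> R"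
  shows "ereal T < dde_end f \<phi>"
proof (rule ccontr)
  assume "\<not> ereal T < dde_end f \<phi>"
  moreover have pos: "0 < dde_end f \<phi>" using dde_end_pos[OF f \<phi>] .
  ultimately obtain \<beta> where \<beta>: "dde_end f \<phi> = ereal \<beta>" "0 < \<beta>" "\<beta> \<le> T" by (cases "dde_end f \<phi>") auto
  obtain h where h: "0 < h" "\<And>\<psi> x t0. 0 \<le> t0 \<Longrightarrow> t0 \<le> T \<Longrightarrow> dde_upto f \<psi> t0 x \<Longrightarrow>
      (\<And>t. t \<in> {-1..t0} \<Longrightarrow> norm (x t) \<le> R) \<Longrightarrow> \<exists>x'. dde_upto f \<psi> (t0 + h) x' \<and> (\<forall>t\<in>{-1..t0}. x' t = x t)"
    using dde_local_existence[OF f \<open>0 \<le> R\<close> \<open>0 \<le> T\<close>] by blast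
  \<comment> \<open>Strictly before \<beta>, where the solution is defined, and less than
    \<open>h\<close> away from it; the maximum keeps the starting time nonnegative.\<close>
  define t0 where "t0 = max 0 (\<beta> - h / 2)"
  have t0: "0 \<le> t0" "t0 < \<beta>" "\<beta> < t0 + h" using \<beta> h(1) by (auto simp: t0_def)
  have "dde_upto f \<phi> t0 (dde_sol f \<phi>)" using t0 \<beta> by (intro dde_sol_upto[OF f \<phi>]) auto
  then obtain x' where x': "dde_upto f \<phi> (t0 + h) x'"
    using h(2)[of t0 \<phi> "dde_sol f \<phi>"] bound[of t0] t0 \<beta> by auto
  have sol: "dde_solution f \<phi> (ereal (t0 + h)) x'" using x' t0 \<beta>(2) by (intro dde_upto_solution) auto
  have max: "dde_maximal_solution f \<phi> (ereal \<beta>) (dde_sol f \<phi>)" using dde_sol_maximal[OF f \<phi>] \<beta>(1) by simp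
  have "x' t = dde_sol f \<phi> t" if "t \<in> dde_dom (ereal \<beta>)" for t
  proof (rule dde_solution_unique[OF f sol _ _ that])
    show "t \<in> dde_dom (ereal (t0 + h))" using that t0 by (auto simp: dde_dom_def)
  qed (use max in \<open>simp add: dde_maximal_solution_def\<close>)
  moreover have "ereal \<beta> \<le> ereal (t0 + h)" using t0 by simp
  ultimately have "ereal (t0 + h) = ereal \<beta>"
    using max sol unfolding dde_maximal_solution_def by blast
  then show False using t0 by simp
qed

section \<open>Derivatives of solutions\<close>

lemma AE_not_eq: "AE t in lebesgue. t \<noteq> (a::real)"
proof -
  have "{a} \<in> null_sets lebesgue" by (simp flip: negligible_iff_null_sets)
  then have "AE t in lebesgue. t \<notin> {a}" by (rule AE_not_in)
  then show ?thesis by simp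
qed

lemma AE_open_closed_ivl:
  assumes "AE t in lebesgue. t \<in> {a<..<b} \<longrightarrow> P t"
  shows "AE t in lebesgue. t \<in> {a..b::real} \<longrightarrow> P t"
  using assms AE_not_eq[of a] AE_not_eq[of b] by eventually_elim auto

text \<open>Lebesgue differentiation: the two-sided derivative is assembled from right and left
  averages, each of which converges off a null set. Extension by zero makes the integrand integrable
  over every interval.\<close>

lemma indefinite_integral_has_derivative_AE:
  fixes g :: "real \<Rightarrow> 'b::euclidean_space"
  assumes g: "g integrable_on {a..b}"
  shows "AE t in lebesgue. t \<in> {a<..<b} \<longrightarrow> ((\<lambda>t. integral {a..t} g) has_vector_derivative g t) (at t)"
proof -
  define g0 where "g0 t = (if t \<in> {a..b} then g t else 0)" for t
  have "g0 integrable_on UNIV" unfolding g0_def using g by (simp only: integrable_restrict_UNIV)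
  then have i0: "g0 integrable_on {c..d}" for c d by (rule integrable_on_subinterval) simp
  \<comment> \<open>The averages supplied run over [t, t + h]; those over [t - h, t] are obtained
    from the reflected function at -t.\<close>
  have i0r: "(\<lambda>t. g0 (- t)) integrable_on {c..d}" for c d
    using i0[of "-d" "-c"] Henstock_Kurzweil_Integration.integrable_reflect_real[where a = "-d" and b = "-c" and f = g0]
    by (simp only: minus_minus)
  obtain N1 where N1: "negligible N1" "\<And>x e. x \<notin> N1 \<Longrightarrow> 0 < e \<Longrightarrow>
      \<exists>d>0. \<forall>h. 0 < h \<and> h < d \<longrightarrow> norm (integral (cbox x (x + h *\<^sub>R One)) g0 /\<^sub>R h ^ DIM(real) - g0 x) < e"
    using integrable_ccontinuous_explicit[of g0] i0 by (metis box_real(2))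
  obtain N2 where N2: "negligible N2" "\<And>x e. x \<notin> N2 \<Longrightarrow> 0 < e \<Longrightarrow>
      \<exists>d>0. \<forall>h. 0 < h \<and> h < d \<longrightarrow>
        norm (integral (cbox x (x + h *\<^sub>R One)) (\<lambda>t. g0 (- t)) /\<^sub>R h ^ DIM(real) - g0 (- x)) < e"
    using integrable_ccontinuous_explicit[of "\<lambda>t. g0 (- t)"] i0r by (metis box_real(2))
  have "negligible (uminus ` N2)" 
    using N2(1) by (intro negligible_differentiable_image_negligible) (auto intro!: derivative_intros)
  then have "N1 \<union> uminus ` N2 \<in> null_sets lebesgue"
    using N1(1) by (simp add: negligible_iff_null_sets[symmetric] negligible_Un)
  then have "AE t in lebesgue. t \<notin> N1 \<union> uminus ` N2" by (rule AE_not_in)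
  then show ?thesis
  proof eventually_elim
    case (elim t)
    have "- t \<notin> N2"
    proof
      assume "- t \<in> N2"
      then have "- (- t) \<in> uminus ` N2" by (rule imageI)
      then show False using elim by simp
    qed
    show ?case
    proof
      assume t: "t \<in> {a<..<b}"
      then have gt: "g0 t = g t" by (simp add: g0_def)
      have eqI: "integral {c..d} g0 = integral {c..d} g" if "a \<le> c" "d \<le> b" for c d
        by (rule integral_cong) (use that in \<open>auto simp: g0_def\<close>)
      have comb: "integral {a..d} g - integral {a..c} g = integral {c..d} g" if "a \<le> c" "c \<le> d" "d \<le> b" for c d
        using Henstock_Kurzweil_Integration.integral_combine[OF that(1,2), of g] integrable_on_subinterval[OF g, of a d] that
        by (auto simp: diff_eq_eq add.commute)
      have "\<exists>d>0. \<forall>y. norm (y - t) < d \<longrightarrow>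
          norm (integral {a..y} g - integral {a..t} g - (y - t) *\<^sub>R g t) \<le> e * norm (y - t)" if "e > 0" for e
      proof -
        obtain d1 where d1: "d1 > 0" "\<And>h. 0 < h \<Longrightarrow> h < d1 \<Longrightarrow> norm (integral {t..t + h} g0 /\<^sub>R h - g0 t) < e"
          using N1(2)[of t e] elim \<open>e > 0\<close> by auto
        obtain d2 where d2: "d2 > 0" "\<And>h. 0 < h \<Longrightarrow> h < d2 \<Longrightarrow> norm (integral {- t..- t + h} (\<lambda>t. g0 (- t)) /\<^sub>R h - g0 t) < e"
          using N2(2)[OF \<open>- t \<notin> N2\<close> \<open>e > 0\<close>] by auto
        \<comment> \<open>Small enough for both kinds of averages, and such that all intervals used
          stay inside [a,b], where \<open>g0\<close> is \<open>g\<close>.\<close>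
        define d where "d = Min {d1, d2, t - a, b - t}"
        have d: "d > 0" "d \<le> d1" "d \<le> d2" "d \<le> t - a" "d \<le> b - t" using d1 d2 t by (auto simp: d_def)
        have scal: "norm (I - h *\<^sub>R g t) \<le> e * h" if "norm (I /\<^sub>R h - g t) < e" "0 < h" for I and h :: real
        proof -
          have "I - h *\<^sub>R g t = h *\<^sub>R (I /\<^sub>R h - g t)" using that(2) by (simp add: algebra_simps)
          then have "norm (I - h *\<^sub>R g t) = h * norm (I /\<^sub>R h - g t)" using that(2) by simp
          also have "\<dots> \<le> h * e" using that by (intro mult_left_mono) auto
          finally show ?thesis by (simp add: mult.commute)
        qed
        have "norm (integral {a..y} g - integral {a..t} g - (y - t) *\<^sub>R g t) \<le> e * norm (y - t)"
          if y: "norm (y - t) < d" for y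
        proof (cases y t rule: linorder_cases)
          case less
          define h where "h = t - y"
          have h: "0 < h" "h < d2" "a \<le> y" using less y d by (auto simp: h_def)
          have "integral {- t..- t + h} (\<lambda>s. g0 (- s)) = integral {y..t} g0"
            using Henstock_Kurzweil_Integration.integral_reflect_real[of y t g0] by (simp add: h_def)
          then have "norm (integral {y..t} g /\<^sub>R h - g t) < e" using d2(2)[OF h(1,2)] eqI[of y t] h t gt by simp
          then have "norm (integral {y..t} g - h *\<^sub>R g t) \<le> e * h" using h(1) by (rule scal)
          moreover have "integral {a..y} g - integral {a..t} g - (y - t) *\<^sub>R g t = - (integral {y..t} g - h *\<^sub>R g t)"
            using comb[of y t] h t less by (simp add: h_def algebra_simps)
          ultimately show ?thesis using less by (simp add: h_def norm_minus_commute)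
        next
          case greater
          define h where "h = y - t"
          have h: "0 < h" "h < d1" "y \<le> b" using greater y d by (auto simp: h_def)
          have "norm (integral {t..y} g /\<^sub>R h - g t) < e" using d1(2)[OF h(1,2)] eqI[of t y] h t gt by (simp add: h_def)
          then have "norm (integral {t..y} g - h *\<^sub>R g t) \<le> e * h" using h(1) by (rule scal)
          moreover have "integral {a..y} g - integral {a..t} g - (y - t) *\<^sub>R g t = integral {t..y} g - h *\<^sub>R g t"
            using comb[of t y] h t greater by (simp add: h_def)
          ultimately show ?thesis using greater by (simp add: h_def)
        qed simp
        then show ?thesis using d(1) by blast
      qed
      then show "((\<lambda>t. integral {a..t} g) has_vector_derivative g t) (at t)"
        unfolding has_vector_derivative_def has_derivative_at_alt
        by (auto intro: bounded_linear_scaleR_left)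
    qed
  qed
qed

lemma C1p_has_derivative_AE:
  assumes "x \<in> C1p p {a..b}"
  shows "AE t in lebesgue. t \<in> {a<..<b} \<longrightarrow> (x has_vector_derivative deriv_on {a..b} x t) (at t)"
proof -
  have "AE t in lebesgue. t \<in> {a..b} \<longrightarrow> x differentiable (at t within {a..b})"
    using assms by (simp add: C1p_def AE_restrict_space_iff)
  then show ?thesis
  proof eventually_elim
    case (elim t)
    show ?case
    proof
      assume t: "t \<in> {a<..<b}"
      then have "x differentiable (at t within {a..b})" using elim by auto
      then have "(x has_vector_derivative deriv_on {a..b} x t) (at t within {a..b})"
        unfolding deriv_on_def by (simp add: vector_derivative_works)
      then show "(x has_vector_derivative deriv_on {a..b} x t) (at t)"
        using t by (simp add: at_within_Icc_at)
    qed
  qed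
qed

lemma deriv_on_AE:
  assumes "AE t in lebesgue. t \<in> {a<..<b} \<longrightarrow> (x has_vector_derivative D t) (at t)"
  shows "AE t in lebesgue. t \<in> {a..b} \<longrightarrow> deriv_on {a..b} x t = D t"
proof (rule AE_open_closed_ivl)
  show "AE t in lebesgue. t \<in> {a<..<b} \<longrightarrow> deriv_on {a..b} x t = D t"
    using assms
    by eventually_elim (auto intro!: has_vector_derivative_imp_deriv_on intro: has_vector_derivative_at_within)
qed

lemma C1pI:
  assumes c: "continuous_on {a..b} x"
    and ae: "AE t in lebesgue. t \<in> {a<..<b} \<longrightarrow> (x has_vector_derivative D t) (at t)"
    and D: "D \<in> Lp p {a..b}"
  shows "x \<in> C1p p {a..b}"
proof -
  have "AE t in lebesgue. t \<in> {a..b} \<longrightarrow> D t = deriv_on {a..b} x t"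
    using deriv_on_AE[OF ae] by eventually_elim simp
  then have "deriv_on {a..b} x \<in> Lp p {a..b}" by (rule Lp_cong_AE[OF _ D, rotated]) simp
  moreover have "AE t in lebesgue. t \<in> {a..b} \<longrightarrow> x differentiable (at t within {a..b})"
  proof (rule AE_open_closed_ivl)
    show "AE t in lebesgue. t \<in> {a<..<b} \<longrightarrow> x differentiable (at t within {a..b})"
      using ae by eventually_elim (auto intro: differentiable_at_withinI differentiableI_vector)
  qed
  ultimately show ?thesis using c by (simp add: C1p_def AE_restrict_space_iff)
qed

lemma LC_comp_nn_le:
  assumes k: "LC_bound p f R k" and w: "\<And>t. t \<in> {a..b} \<Longrightarrow> norm (w t) \<le> R"
  shows "(\<integral>\<^sup>+t\<in>{a..b}. ennreal (norm (f (t, w t)) ^ p) \<partial>lebesgue) \<le> (\<integral>\<^sup>+t\<in>{a..b}. ennreal (k t ^ p) \<partial>lebesgue)"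
proof (rule set_nn_integral_mono_AE)
  show "AE t in lebesgue. t \<in> {a..b} \<longrightarrow> ennreal (norm (f (t, w t)) ^ p) \<le> ennreal (k t ^ p)"
    using LC_boundD(5)[OF k]
  proof eventually_elim
    case (elim t)
    then show ?case using w[of t] by (auto simp: mem_cball_0 intro!: ennreal_leI power_mono simp del: mem_cball)
  qed
qed

lemma LC_comp_Lp:
  assumes f: "f \<in> LC p" "0 < p" and w: "continuous_on UNIV w"
  shows "(\<lambda>t. f (t, w t)) \<in> Lp p {a..b}"
proof -
  obtain R where R: "\<And>t. t \<in> {a..b} \<Longrightarrow> norm (w t) \<le> R"
    using continuous_on_norm_bound[OF continuous_on_subset[OF w]] by (metis top_greatest)
  obtain k where k: "LC_bound p f R k" using ex_LC_bound f by blast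
  show ?thesis
    using Lp_lebesgue_iff[OF LC_comp_measurable[OF f(1) w], of "{a..b}" p]
      le_less_trans[OF LC_comp_nn_le[OF k R] LC_boundD(3)[OF k]] by simp
qed

text \<open>An explicit representative of the almost everywhere derivative of a solution; it turns
  estimates of derivatives after 0 into estimates of right-hand sides.\<close>

definition dde_deriv :: "('n::finite) rhs \<Rightarrow> (real \<Rightarrow> real^'n) \<Rightarrow> (real \<Rightarrow> real^'n) \<Rightarrow> real \<Rightarrow> real^'n" where
  "dde_deriv f \<phi> x t = (if t < 0 then deriv_on {-1..0} \<phi> t else f (t, x t, x (t - 1)))"

lemma dde_sol_has_derivative_AE:
  fixes f :: "('n::finite) rhs"
  assumes f: "f \<in> LC p" "0 < p" and \<phi>: "\<phi> \<in> C1p p {-1..0}" and T: "ereal T < dde_end f \<phi>"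
  shows "AE t in lebesgue. t \<in> {-1<..<T} \<longrightarrow> (dde_sol f \<phi> has_vector_derivative dde_deriv f \<phi> (dde_sol f \<phi>) t) (at t)"
proof -
  let ?x = "dde_sol f \<phi>"
  let ?F = "\<lambda>s. f (s, ?x s, ?x (s - 1))"
  have c\<phi>: "continuous_on {-1..0} \<phi>" using \<phi> by (simp add: C1p_def)
  have pos: "AE t in lebesgue. t \<in> {0<..<T} \<longrightarrow> (?x has_vector_derivative ?F t) (at t)"
  proof (cases "0 \<le> T")
    case True
    have x: "dde_upto f \<phi> T ?x" using dde_sol_upto[OF f c\<phi> True T] .
    have "?F integrable_on {0..T}" using x True by (auto simp: dde_upto_def intro: absolutely_integrable_imp_integrable_on)
    from indefinite_integral_has_derivative_AE[OF this] show ?thesis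
    proof eventually_elim
      case (elim t)
      show ?case
      proof
        assume t: "t \<in> {0<..<T}"
        then have "((\<lambda>t. integral {0..t} ?F) has_vector_derivative ?F t) (at t)" using elim by blast
        then have "((\<lambda>t. \<phi> 0 + integral {0..t} ?F) has_vector_derivative 0 + ?F t) (at t)"
          by (intro derivative_intros)
        then have "((\<lambda>t. \<phi> 0 + integral {0..t} ?F) has_vector_derivative ?F t) (at t)" by simp
        then show "(?x has_vector_derivative ?F t) (at t)"
          by (rule has_vector_derivative_transform_within_open[of _ _ _ "{0<..<T}"])
             (use x t in \<open>auto simp: dde_upto_def\<close>)
      qed
    qed
  qed simp
  \<comment> \<open>At time 0 the initial function and the equation may give different one-sided
    derivatives, so that point is excluded.\<close>
  show ?thesis
    using pos C1p_has_derivative_AE[OF \<phi>] AE_not_eq[of 0]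
  proof eventually_elim
    case (elim t)
    show ?case
    proof
      assume t: "t \<in> {-1<..<T}"
      show "(?x has_vector_derivative dde_deriv f \<phi> ?x t) (at t)"
      proof (cases "t < 0")
        case True
        then have "(\<phi> has_vector_derivative deriv_on {-1..0} \<phi> t) (at t)" using elim t by simp
        then have "(?x has_vector_derivative deriv_on {-1..0} \<phi> t) (at t)"
          by (rule has_vector_derivative_transform_within_open[of _ _ _ "{-1<..<0}"])
             (use dde_sol_initial[OF f c\<phi>] t True in auto)
        then show ?thesis using True by (simp add: dde_deriv_def)
      next
        case False
        then show ?thesis using elim t by (simp add: dde_deriv_def)
      qed
    qed
  qed
qed

lemma dde_sol_continuous:
  fixes f :: "('n::finite) rhs"
  assumes f: "f \<in> LC p" "0 < p" and \<phi>: "continuous_on {-1..0} \<phi>" and T: "ereal T < dde_end f \<phi>"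
  shows "continuous_on {-1..T} (dde_sol f \<phi>)"
proof (cases "0 \<le> T")
  case True
  then show ?thesis using dde_sol_upto[OF f \<phi> True T] by (simp add: dde_upto_def)
next
  case False
  then have "continuous_on {-1..T} \<phi>" by (intro continuous_on_subset[OF \<phi>]) auto
  then show ?thesis
    by (rule continuous_on_eq) (use False dde_sol_initial[OF f \<phi>] in auto)
qed

lemma dde_deriv_Lp:
  fixes f :: "('n::finite) rhs"
  assumes f: "f \<in> LC p" "0 < p" and \<phi>: "\<phi> \<in> C1p p {-1..0}" and T: "ereal T < dde_end f \<phi>" "-1 \<le> T"
  shows "dde_deriv f \<phi> (dde_sol f \<phi>) \<in> Lp p {-1..T}"
proof -
  let ?x = "dde_sol f \<phi>"
  let ?F = "\<lambda>t. f (t, clip T ?x t, clip T ?x (t - 1))"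
  define g1 where "g1 t = (if t \<in> {-1..0} then deriv_on {-1..0} \<phi> t else 0)" for t
  \<comment> \<open>The sign makes the derivative a difference, so that \<open>Lp_diff\<close>
    applies.\<close>
  define g2 where "g2 t = (if t \<in> {0..T} then - ?F t else 0)" for t
  have c\<phi>: "continuous_on {-1..0} \<phi>" and L\<phi>: "deriv_on {-1..0} \<phi> \<in> Lp p {-1..0}" using \<phi> by (auto simp: C1p_def)
  have cx: "continuous_on {-1..T} ?x" by (rule dde_sol_continuous[OF f c\<phi> T(1)])
  have cw: "continuous_on UNIV (\<lambda>t. (clip T ?x t, clip T ?x (t - 1)))"
    by (intro continuous_on_Pair continuous_on_clip[OF cx T(2)]
        continuous_on_compose2[OF continuous_on_clip[OF cx T(2), of UNIV]] continuous_intros; simp)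
  have m1: "g1 \<in> borel_measurable lebesgue"
    unfolding g1_def using L\<phi> borel_measurable_if[of "{-1..0}" "deriv_on {-1..0} \<phi>"] by (auto simp: Lp_def)
  have "?F \<in> borel_measurable lebesgue" using LC_comp_measurable[OF f(1) cw] .
  then have m2: "g2 \<in> borel_measurable lebesgue"
    unfolding g2_def by (intro measurable_If) auto
  have "(\<integral>\<^sup>+t\<in>{-1..T}. ennreal (norm (g1 t) ^ p) \<partial>lebesgue)
      \<le> (\<integral>\<^sup>+t\<in>{-1..0}. ennreal (norm (deriv_on {-1..0} \<phi> t) ^ p) \<partial>lebesgue)"
    by (rule nn_integral_mono) (use f(2) in \<open>auto simp: g1_def split: split_indicator\<close>)
  also have "\<dots> < \<infinity>" using nn_integral_Lp[OF L\<phi> _ f(2)] by simp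
  finally have L1: "g1 \<in> Lp p {-1..T}" using Lp_lebesgue_iff[OF m1] by simp
  have "(\<integral>\<^sup>+t\<in>{-1..T}. ennreal (norm (g2 t) ^ p) \<partial>lebesgue)
      \<le> (\<integral>\<^sup>+t\<in>{0..T}. ennreal (norm (?F t) ^ p) \<partial>lebesgue)"
    by (rule nn_integral_mono) (use f(2) in \<open>auto simp: g2_def split: split_indicator\<close>)
  also have "\<dots> < \<infinity>" using nn_integral_Lp[OF LC_comp_Lp[OF f cw] _ f(2)] by simp
  finally have L2: "g2 \<in> Lp p {-1..T}" using Lp_lebesgue_iff[OF m2] by simp
  have "AE t in lebesgue. t \<in> {-1..T} \<longrightarrow> g1 t - g2 t = dde_deriv f \<phi> ?x t"
    using AE_not_eq[of 0] by eventually_elim (auto simp: g1_def g2_def dde_deriv_def)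
  then show ?thesis by (rule Lp_cong_AE[OF _ Lp_diff[OF L1 L2], rotated]) simp
qed

lemma dde_sol_C1p:
  fixes f :: "('n::finite) rhs"
  assumes f: "f \<in> LC p" "0 < p" and \<phi>: "\<phi> \<in> C1p p {-1..0}" and T: "ereal T < dde_end f \<phi>" "-1 \<le> T"
  shows "dde_sol f \<phi> \<in> C1p p {-1..T}"
proof (rule C1pI[OF _ dde_sol_has_derivative_AE[OF f \<phi> T(1)] dde_deriv_Lp[OF assms]])
  show "continuous_on {-1..T} (dde_sol f \<phi>)"
    using \<phi> by (intro dde_sol_continuous[OF f _ T(1)]) (simp add: C1p_def)
qed

section \<open>Stability under perturbations\<close>

text \<open>The constant bounds the p-th power of the L^p norm, not the norm itself.\<close>

definition Lp_le :: "nat \<Rightarrow> real \<Rightarrow> real \<Rightarrow> (real \<Rightarrow> real) \<Rightarrow> bool" where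
  "Lp_le p T C L \<longleftrightarrow> L \<in> borel_measurable lebesgue \<and> (\<forall>t. 0 \<le> L t) \<and>
     (\<integral>\<^sup>+t\<in>{0..T}. ennreal (L t ^ p) \<partial>lebesgue) \<le> ennreal C"

lemma Lp_leD:
  assumes "Lp_le p T C L"
  shows "L \<in> borel_measurable lebesgue" "0 \<le> L t"
    "(\<integral>\<^sup>+t\<in>{0..T}. ennreal (L t ^ p) \<partial>lebesgue) \<le> ennreal C"
  using assms by (simp_all add: Lp_le_def)

lemma Lp_le_mono: "Lp_le p T C L \<Longrightarrow> C \<le> C' \<Longrightarrow> Lp_le p T C' L"
  unfolding Lp_le_def using order_trans[OF _ ennreal_leI] by blast

text \<open>\<open>le_add_power_divide\<close> integrated. With \<eta> = 1 it bounds the Lipschitz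
  weight by b + c; with \<eta> small, and then \<open>c\<close> small compared with \<eta>^(p-1), it
  makes the remainder small in L^1.\<close>

lemma Lp_le_integral:
  assumes L: "Lp_le p b c r" and "0 < p" "0 < \<eta>" "0 \<le> b" "0 \<le> c"
  shows "r absolutely_integrable_on {0..b}" "integral {0..b} r \<le> \<eta> * b + c / \<eta> ^ (p - 1)"
proof -
  note r = Lp_leD(1,2)[OF L] and c = Lp_leD(3)[OF L]
  have "(\<integral>\<^sup>+t\<in>{0..b}. ennreal (norm (r t) ^ p) \<partial>lebesgue) \<le> ennreal c"
    using c r(2) by simp
  then have fin: "(\<integral>\<^sup>+t\<in>{0..b}. ennreal (norm (r t) ^ p) \<partial>lebesgue) < \<infinity>"
    by (rule le_less_trans) simp
  show i: "r absolutely_integrable_on {0..b}"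
    by (rule Lp_imp_absolutely_integrable[OF r(1) \<open>0 < p\<close> fin])
  have "ennreal (integral {0..b} r) = (\<integral>\<^sup>+t\<in>{0..b}. ennreal (r t) \<partial>lebesgue)"
    using nn_integral_absolutely_integrable[OF i] r(2) by simp
  also have "\<dots> \<le> (\<integral>\<^sup>+t\<in>{0..b}. (ennreal \<eta> + ennreal (1 / \<eta> ^ (p - 1)) * ennreal (r t ^ p)) \<partial>lebesgue)"
  proof (intro set_nn_integral_mono_AE AE_I2 impI)
    fix t
    have "ennreal (r t) \<le> ennreal (\<eta> + 1 / \<eta> ^ (p - 1) * r t ^ p)"
      using le_add_power_divide[OF r(2) \<open>0 < \<eta>\<close> \<open>0 < p\<close>] by (intro ennreal_leI) simp
    also have "\<dots> = ennreal \<eta> + ennreal (1 / \<eta> ^ (p - 1)) * ennreal (r t ^ p)"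
      using \<open>0 < \<eta>\<close> r(2) by (simp add: ennreal_mult flip: ennreal_mult')
    finally show "ennreal (r t) \<le> ennreal \<eta> + ennreal (1 / \<eta> ^ (p - 1)) * ennreal (r t ^ p)" .
  qed
  also have "\<dots> = (\<integral>\<^sup>+t\<in>{0..b}. ennreal \<eta> \<partial>lebesgue)
      + (\<integral>\<^sup>+t\<in>{0..b}. ennreal (1 / \<eta> ^ (p - 1)) * ennreal (r t ^ p) \<partial>lebesgue)"
    using r(1)
    by (intro nn_set_integral_add borel_measurable_times_ennreal borel_measurable_const
        measurable_compose[OF _ measurable_ennreal] borel_measurable_power) simp_all
  also have "(\<integral>\<^sup>+t\<in>{0..b}. ennreal \<eta> \<partial>lebesgue) = ennreal (\<eta> * b)"
    using \<open>0 \<le> b\<close> \<open>0 < \<eta>\<close> by (simp add: nn_integral_cmult_indicator ennreal_mult)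
  finally have le: "ennreal (integral {0..b} r)
      \<le> ennreal (\<eta> * b) + (\<integral>\<^sup>+t\<in>{0..b}. ennreal (1 / \<eta> ^ (p - 1)) * ennreal (r t ^ p) \<partial>lebesgue)" .
  have "(\<integral>\<^sup>+t\<in>{0..b}. ennreal (1 / \<eta> ^ (p - 1)) * ennreal (r t ^ p) \<partial>lebesgue)
      = ennreal (1 / \<eta> ^ (p - 1)) * (\<integral>\<^sup>+t\<in>{0..b}. ennreal (r t ^ p) \<partial>lebesgue)"
  proof -
    have "{0..b} \<in> sets lebesgue" by simp
    then have "(\<lambda>t. ennreal (r t ^ p) * indicator {0..b} t) \<in> borel_measurable lebesgue"
      using r(1) by (intro borel_measurable_times_ennreal borel_measurable_indicator) measurable
    then show ?thesis unfolding mult.assoc by (rule nn_integral_cmult)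
  qed
  also have "\<dots> \<le> ennreal (1 / \<eta> ^ (p - 1)) * ennreal c"
    using c by (rule mult_left_mono) simp
  also have "\<dots> = ennreal (c / \<eta> ^ (p - 1))"
    using \<open>0 < \<eta>\<close> by (simp flip: ennreal_mult')
  finally have "ennreal (integral {0..b} r) \<le> ennreal (\<eta> * b) + ennreal (c / \<eta> ^ (p - 1))"
    by (rule order_trans[OF le add_left_mono])
  also have "\<dots> = ennreal (\<eta> * b + c / \<eta> ^ (p - 1))"
    using assms by (intro ennreal_plus[symmetric]) auto
  finally show "integral {0..b} r \<le> \<eta> * b + c / \<eta> ^ (p - 1)"
    using assms by (subst (asm) ennreal_le_iff) auto
qed

text \<open>The inequality is asked on [0,S] only, but weight and remainder are measured on all of
  [0,T]; the constants therefore do not depend on how long the solution is known to exist.\<close>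

definition gronwall_bound ::
  "nat \<Rightarrow> real \<Rightarrow> real \<Rightarrow> real \<Rightarrow> real \<Rightarrow> ('n::finite) rhs \<Rightarrow> (real \<Rightarrow> real^'n) \<Rightarrow> 'n rhs \<Rightarrow> (real \<Rightarrow> real^'n) \<Rightarrow> bool" where
  "gronwall_bound p T C \<eta> S f x g y \<longleftrightarrow> (\<exists>L r. Lp_le p T C L \<and> Lp_le p T \<eta> r \<and>
     (AE t in lebesgue. t \<in> {0..S} \<longrightarrow> norm (f (t, x t, x (t - 1)) - g (t, y t, y (t - 1)))
        \<le> L t * (norm (x t - y t) + norm (x (t - 1) - y (t - 1))) + r t))"

definition bounded_solution ::
  "real \<Rightarrow> real \<Rightarrow> ('n::finite) rhs \<Rightarrow> (real \<Rightarrow> real^'n) \<Rightarrow> real \<Rightarrow> (real \<Rightarrow> real^'n) \<Rightarrow> bool" where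
  "bounded_solution T R f \<phi> S x \<longleftrightarrow> 0 \<le> S \<and> S \<le> T \<and> dde_upto f \<phi> S x \<and> (\<forall>t\<in>{-1..S}. norm (x t) \<le> R)"

text \<open>The order of quantifiers matters: \<open>C\<close>, and with it the Gronwall factor, is
  fixed before \<eta>, and one threshold for \<open>n\<close> serves all bounded solutions on all
  intervals [-1,S].\<close>

definition perturbation ::
  "nat \<Rightarrow> real \<Rightarrow> real \<Rightarrow> (nat \<Rightarrow> ('n::finite) rhs) \<Rightarrow> (nat \<Rightarrow> real \<Rightarrow> real^'n) \<Rightarrow> 'n rhs \<Rightarrow> (real \<Rightarrow> real^'n) \<Rightarrow> bool" where
  "perturbation p T R fs \<phi>s f y \<longleftrightarrow> (\<exists>C\<ge>0. \<forall>\<eta>>0. \<forall>\<^sub>F n in sequentially. \<forall>S x.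
     bounded_solution T R (fs n) (\<phi>s n) S x \<longrightarrow> gronwall_bound p T C \<eta> S (fs n) x f y)"

section \<open>The continuation argument\<close>

lemma continuous_le_at_right_end:
  fixes q :: "real \<Rightarrow> real"
  assumes "continuous_on {a..b} q" "a < b" "\<And>t. t \<in> {a..<b} \<Longrightarrow> q t \<le> c"
  shows "q b \<le> c"
proof -
  have "closure {a..<b} = {a..b}" using assms(2) by simp
  then show ?thesis using continuous_le_on_closure[of "{a..<b}" q b c] assms by simp
qed

text \<open>The threshold is distance 1: below it the solution lies in the ball of radius
  \<open>R\<close>, where the Gronwall estimate improves the distance to \<epsilon> \<le> 1/2, so
  continuity excludes a first time at distance 1. The integral bound is linear in \<epsilon> with
  \<open>C\<close> chosen once, so that \<epsilon> may tend to 0.\<close>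

lemma dde_close:
  fixes f :: "('n::finite) rhs"
  assumes p: "0 < p" and fs: "\<And>n. fs n \<in> LC p" and f: "f \<in> LC p"
    and \<phi>s: "\<And>n. continuous_on {-1..0} (\<phi>s n)" and \<phi>: "continuous_on {-1..0} \<phi>"
    and lim: "uniform_limit {-1..0} \<phi>s \<phi> sequentially"
    and T: "0 \<le> T" "ereal T < dde_end f \<phi>"
    and R: "0 \<le> R" "\<And>t. t \<in> {-1..T} \<Longrightarrow> norm (dde_sol f \<phi> t) + 1 \<le> R"
    and pert: "perturbation p T R fs \<phi>s f (dde_sol f \<phi>)"
  shows "\<exists>C\<ge>0. \<forall>\<epsilon>. 0 < \<epsilon> \<and> \<epsilon> \<le> 1/2 \<longrightarrow> (\<forall>\<^sub>F n in sequentially.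
      ereal T < dde_end (fs n) (\<phi>s n) \<and> (\<forall>t\<in>{-1..T}. norm (dde_sol (fs n) (\<phi>s n) t - dde_sol f \<phi> t) \<le> \<epsilon>) \<and>
      (\<integral>\<^sup>+t\<in>{0..T}. ennreal (norm (dde_deriv (fs n) (\<phi>s n) (dde_sol (fs n) (\<phi>s n)) t
          - dde_deriv f \<phi> (dde_sol f \<phi>) t) ^ p) \<partial>lebesgue) \<le> ennreal (C * \<epsilon>))"
proof -
  let ?y = "dde_sol f \<phi>" and ?x = "\<lambda>n. dde_sol (fs n) (\<phi>s n)"
  have y: "dde_upto f \<phi> T ?y" by (rule dde_sol_upto[OF f p \<phi> T])
  obtain C where C: "0 \<le> C" and ev: "\<And>\<eta>. 0 < \<eta> \<Longrightarrow> \<forall>\<^sub>F n in sequentially. \<forall>S x.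
     bounded_solution T R (fs n) (\<phi>s n) S x \<longrightarrow> gronwall_bound p T C \<eta> S (fs n) x f ?y"
    using pert unfolding perturbation_def by blast
  \<comment> \<open>The weight has integral at most T + C, by \<open>Lp_le_integral\<close> with
    parameter 1, so \<open>m\<close> depends neither on the accuracy nor on
    \<open>n\<close>.\<close>
  obtain m where m: "4 * (T + C) \<le> real m" using real_arch_simple by blast
  define K :: real where "K = 2 * 4 ^ m"
  have K: "1 \<le> K" unfolding K_def using one_le_power[of "4::real" m] by linarith
  have main: "\<forall>\<^sub>F n in sequentially.
      ereal T < dde_end (fs n) (\<phi>s n) \<and> (\<forall>t\<in>{-1..T}. norm (?x n t - ?y t) \<le> \<epsilon>) \<and>
      (\<integral>\<^sup>+t\<in>{0..T}. ennreal (norm (dde_deriv (fs n) (\<phi>s n) (?x n) t - dde_deriv f \<phi> ?y t) ^ p) \<partial>lebesgue)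
        \<le> ennreal ((2 ^ p * (2 ^ p * C + 1)) * \<epsilon>)"
    if \<epsilon>: "0 < \<epsilon>" "\<epsilon> \<le> 1/2" for \<epsilon>
  proof -
    \<comment> \<open>\<open>K\<close> is the Gronwall factor; one \<epsilon>' is spent on the
      initial data and one on the integral of the remainder.\<close>
    define \<epsilon>' where "\<epsilon>' = \<epsilon> / (2 * K)"
    have \<epsilon>': "0 < \<epsilon>'" "\<epsilon>' \<le> \<epsilon>" "K * (\<epsilon>' + \<epsilon>') = \<epsilon>"
      using \<epsilon> K by (auto simp: \<epsilon>'_def field_simps)
    \<comment> \<open>The parameter in the passage from L^p to L^1. It is fixed before \<eta>, and
      each of the two resulting terms is at most \<epsilon>'/2; T + 1 avoids a division by
      0.\<close>
    define \<eta>1 where "\<eta>1 = \<epsilon>' / (2 * (T + 1))"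
    have \<eta>1: "0 < \<eta>1" "\<eta>1 * T \<le> \<epsilon>' / 2" using \<epsilon>'(1) T(1) by (auto simp: \<eta>1_def field_simps)
    \<comment> \<open>The cap at \<epsilon> serves the derivatives, where the p-th power of the
      remainder enters without passing through L^1.\<close>
    define \<eta> where "\<eta> = min \<epsilon> (\<epsilon>' / 2 * \<eta>1 ^ (p - 1))"
    have \<eta>: "0 < \<eta>" "\<eta> / \<eta>1 ^ (p - 1) \<le> \<epsilon>' / 2" "\<eta> \<le> \<epsilon>"
      using \<epsilon> \<epsilon>' \<eta>1 by (auto simp: \<eta>_def pos_divide_le_eq)
    have "\<forall>\<^sub>F n in sequentially. \<forall>t\<in>{-1..0}. dist (\<phi>s n t) (\<phi> t) < \<epsilon>'"
      using lim \<epsilon>'(1) by (rule uniform_limitD)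
    with ev[OF \<eta>(1)] show ?thesis
    proof eventually_elim
      case (elim n)
      have xs: "dde_upto (fs n) (\<phi>s n) S (?x n)" if "0 \<le> S" "ereal S < dde_end (fs n) (\<phi>s n)" for S
        by (rule dde_sol_upto[OF fs p \<phi>s that])
      have dn: "norm (\<phi>s n t - \<phi> t) \<le> \<epsilon>'" if "t \<in> {-1..0}" for t
        using elim(2) that by (force simp: dist_norm)
      have close: "(\<forall>t\<in>{-1..S}. norm (?x n t - ?y t) \<le> \<epsilon>) \<and> gronwall_bound p T C \<eta> S (fs n) (?x n) f ?y"
        if S: "0 \<le> S" "S \<le> T" "ereal S < dde_end (fs n) (\<phi>s n)"
          and b: "\<And>t. t \<in> {-1..S} \<Longrightarrow> norm (?x n t) \<le> R" for S
      proof -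
        have gb: "gronwall_bound p T C \<eta> S (fs n) (?x n) f ?y"
          using elim(1) xs[OF S(1,3)] S b unfolding bounded_solution_def by blast
        then obtain L r where L: "Lp_le p T C L" and r: "Lp_le p T \<eta> r"
          and ae: "AE t in lebesgue. t \<in> {0..S} \<longrightarrow> norm (fs n (t, ?x n t, ?x n (t - 1)) - f (t, ?y t, ?y (t - 1)))
              \<le> L t * (norm (?x n t - ?y t) + norm (?x n (t - 1) - ?y (t - 1))) + r t"
          unfolding gronwall_bound_def by blast
        have sub: "{0..S} \<subseteq> {0..T}" using S by auto
        note Li = Lp_le_integral[OF L p zero_less_one T(1) C]
        note ri = Lp_le_integral[OF r p \<eta>1(1) T(1) less_imp_le[OF \<eta>(1)]]
        have Li': "L absolutely_integrable_on {0..S}" "r absolutely_integrable_on {0..S}"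
          using set_integrable_subset[OF Li(1) _ sub] set_integrable_subset[OF ri(1) _ sub] by auto
        have sub_le: "integral {0..S} L \<le> integral {0..T} L" "integral {0..S} r \<le> integral {0..T} r"
          using Lp_leD(2)[OF L] Lp_leD(2)[OF r] Li(1) ri(1) Li' by (auto intro!: integral_subset_le[OF sub] absolutely_integrable_imp_integrable_on)
        have "integral {0..T} L \<le> T + C" using Li(2) by simp
        also have "\<dots> \<le> real m / 4" using m by simp
        finally have bound_L: "integral {0..S} L \<le> real m / 4" using sub_le(1) by (rule order_trans[rotated])
        have "integral {0..T} r \<le> \<eta>1 * T + \<eta> / \<eta>1 ^ (p - 1)" using ri(2) by simp
        also have "\<dots> \<le> \<epsilon>' / 2 + \<epsilon>' / 2" by (intro add_mono \<eta>1(2) \<eta>(2))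
        also have "\<dots> = \<epsilon>'" by simp
        finally have bound_r: "integral {0..S} r \<le> \<epsilon>'" using sub_le(2) by (rule order_trans[rotated])
        have "norm (?x n t - ?y t) \<le> \<epsilon>" if "t \<in> {-1..S}" for t
        proof -
          have "norm (?x n t - ?y t) \<le> 2 * 4 ^ m * (\<epsilon>' + \<epsilon>')"
            by (rule dde_upto_compare[OF xs[OF S(1,3)] dde_upto_mono[OF y S(2)] S(1) Li'(1) _ Li'(2) _ ae dn bound_L bound_r that])
               (use Lp_leD(2)[OF L] Lp_leD(2)[OF r] in auto)
          then show ?thesis using \<epsilon>'(3) by (simp add: K_def)
        qed
        then show ?thesis using gb by blast
      qed
      have bd: "norm (?x n t) \<le> R" if "norm (?x n t - ?y t) \<le> 1" "t \<in> {-1..T}" for t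
        using R(2)[OF that(2)] that(1) norm_triangle_sub[of "?x n t" "?y t"] by linarith
      have boot: "\<forall>t\<in>{-1..S}. norm (?x n t) \<le> R" if S: "0 \<le> S" "S \<le> T" "ereal S < dde_end (fs n) (\<phi>s n)" for S
      proof (rule ccontr)
        assume "\<not> (\<forall>t\<in>{-1..S}. norm (?x n t) \<le> R)"
        then obtain t1 where t1: "t1 \<in> {-1..S}" "\<not> norm (?x n t1) \<le> R" by blast
        define q where "q t = norm (?x n t - ?y t)" for t
        have cq: "continuous_on {-1..S} q"
          unfolding q_def using xs[OF S(1,3)] dde_upto_mono[OF y S(2)]
          by (intro continuous_intros) (auto simp: dde_upto_def)
        \<comment> \<open>Where the bound \<open>R\<close> fails, the distance to the limit exceeds
          1, so \<open>A\<close> is nonempty; being closed, it contains its infimum, the first time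
          at distance at least 1.\<close>
        define A where "A = {t \<in> {-1..S}. 1 \<le> q t}"
        have "A = {-1..S} \<inter> q -` {1..}" by (auto simp: A_def)
        then have "closed A" using continuous_closed_preimage[OF cq, of "{1..}"] by simp
        moreover have "t1 \<in> A" using t1 bd[of t1] S by (force simp: A_def q_def)
        moreover have bA: "bdd_below A" by (rule bdd_belowI[of _ "-1"]) (auto simp: A_def)
        ultimately have sA: "Inf A \<in> A" using closed_contains_Inf[of A] by blast
        define s where "s = Inf A"
        have s: "s \<in> {-1..S}" "1 \<le> q s" using sA by (auto simp: A_def s_def)
        have before: "q t < 1" if "t \<in> {-1..<s}" for t
        proof (rule ccontr)
          assume "\<not> q t < 1"
          then have "t \<in> A" using that s by (auto simp: A_def)
          then have "s \<le> t" unfolding s_def using bA by (rule cInf_lower)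
          then show False using that by simp
        qed
        have "0 < s"
        proof (rule ccontr)
          assume "\<not> 0 < s"
          then have "s \<in> {-1..0}" using s by simp
          then have "q s \<le> \<epsilon>'"
            using dn[of s] dde_sol_initial[OF fs p \<phi>s, of s] dde_sol_initial[OF f p \<phi>, of s] by (simp add: q_def)
          then show False using s(2) \<epsilon>' \<epsilon> by linarith
        qed
        have "q t \<le> \<epsilon>" if "t \<in> {0..<s}" for t
        proof -
          have "norm (?x n \<tau>) \<le> R" if "\<tau> \<in> {-1..t}" for \<tau>
            using before[of \<tau>] that \<open>t \<in> {0..<s}\<close> s S by (intro bd) (auto simp: q_def)
          moreover have "ereal t < dde_end (fs n) (\<phi>s n)"
            using that s S(3) by (auto intro: le_less_trans[of _ "ereal S"])
          ultimately show ?thesis using close[of t] that s S by (auto simp: q_def)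
        qed
        then have "q s \<le> \<epsilon>"
          by (intro continuous_le_at_right_end[of 0 s q] continuous_on_subset[OF cq] \<open>0 < s\<close>) (use s in auto)
        then show False using s(2) \<epsilon> by linarith
      qed
      have end': "ereal T < dde_end (fs n) (\<phi>s n)"
        by (rule less_dde_end[OF fs p \<phi>s T(1) R(1)]) (use boot in blast)
      obtain L r where Lr: "Lp_le p T C L" "Lp_le p T \<eta> r"
          and ae: "AE t in lebesgue. t \<in> {0..T} \<longrightarrow> norm (fs n (t, ?x n t, ?x n (t - 1)) - f (t, ?y t, ?y (t - 1)))
              \<le> L t * (norm (?x n t - ?y t) + norm (?x n (t - 1) - ?y (t - 1))) + r t"
          and cl: "\<forall>t\<in>{-1..T}. norm (?x n t - ?y t) \<le> \<epsilon>"
        using close[OF T(1) order_refl end'] boot[OF T(1) order_refl end'] unfolding gronwall_bound_def by blast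
      note L = Lp_leD[OF Lr(1)] and r = Lp_leD[OF Lr(2)]
      \<comment> \<open>Present and delayed distances are now at most \<epsilon> each, so the
        difference of the right-hand sides is at most 2 \<epsilon> L + r.\<close>
      have "(\<integral>\<^sup>+t\<in>{0..T}. ennreal (norm (dde_deriv (fs n) (\<phi>s n) (?x n) t - dde_deriv f \<phi> ?y t) ^ p) \<partial>lebesgue)
          \<le> ennreal (2 ^ p) * ((\<integral>\<^sup>+t\<in>{0..T}. ennreal (norm (2 * \<epsilon> * L t) ^ p) \<partial>lebesgue)
             + (\<integral>\<^sup>+t\<in>{0..T}. ennreal (norm (r t) ^ p) \<partial>lebesgue))"
      proof (rule Lp_nn_add)
        show "AE t in lebesgue. t \<in> {0..T} \<longrightarrow>
            norm (dde_deriv (fs n) (\<phi>s n) (?x n) t - dde_deriv f \<phi> ?y t) \<le> norm (2 * \<epsilon> * L t) + norm (r t)"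
          using ae
        proof eventually_elim
          case (elim t)
          show ?case
          proof
            assume t: "t \<in> {0..T}"
            have "L t * (norm (?x n t - ?y t) + norm (?x n (t - 1) - ?y (t - 1))) \<le> L t * (\<epsilon> + \<epsilon>)"
              using cl t L(2) by (intro mult_left_mono add_mono) auto
            then have "norm (fs n (t, ?x n t, ?x n (t - 1)) - f (t, ?y t, ?y (t - 1))) \<le> 2 * \<epsilon> * L t + r t"
              using elim t by (auto simp: algebra_simps)
            then show "norm (dde_deriv (fs n) (\<phi>s n) (?x n) t - dde_deriv f \<phi> ?y t) \<le> norm (2 * \<epsilon> * L t) + norm (r t)"
              using t L(2) r(2) \<epsilon>(1) by (simp add: dde_deriv_def)
          qed
        qed
      qed (use L(1) r(1) in auto)
      also have "(\<integral>\<^sup>+t\<in>{0..T}. ennreal (norm (2 * \<epsilon> * L t) ^ p) \<partial>lebesgue)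
          = (\<integral>\<^sup>+t. ennreal ((2 * \<epsilon>) ^ p) * (ennreal (L t ^ p) * indicator {0..T} t) \<partial>lebesgue)"
        using L(2) \<epsilon>(1) by (intro nn_integral_cong) (auto simp: power_mult_distrib ennreal_mult split: split_indicator)
      also have "\<dots> = ennreal ((2 * \<epsilon>) ^ p) * (\<integral>\<^sup>+t\<in>{0..T}. ennreal (L t ^ p) \<partial>lebesgue)"
      proof (rule nn_integral_cmult)
        have "{0..T} \<in> sets lebesgue" by simp
        then show "(\<lambda>t. ennreal (L t ^ p) * indicator {0..T} t) \<in> borel_measurable lebesgue"
          using L(1) by (intro borel_measurable_times_ennreal borel_measurable_indicator) measurable
      qed
      also have "ennreal (2 ^ p) * (ennreal ((2 * \<epsilon>) ^ p) * (\<integral>\<^sup>+t\<in>{0..T}. ennreal (L t ^ p) \<partial>lebesgue)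
             + (\<integral>\<^sup>+t\<in>{0..T}. ennreal (norm (r t) ^ p) \<partial>lebesgue))
          \<le> ennreal (2 ^ p) * (ennreal ((2 * \<epsilon>) ^ p) * ennreal C + ennreal \<eta>)"
        using L(3) r(2,3) by (intro mult_left_mono add_mono) auto
      also have "\<dots> = ennreal (2 ^ p * ((2 * \<epsilon>) ^ p * C + \<eta>))"
        using C \<epsilon>(1) \<eta>(1) by (simp add: ennreal_mult)
      also have "\<dots> \<le> ennreal (2 ^ p * (2 ^ p * C + 1) * \<epsilon>)"
      proof (rule ennreal_leI)
        \<comment> \<open>As \<epsilon> is below 1, its p-th power may be traded for \<epsilon>,
          which gives the linear form of the bound.\<close>
        have "\<epsilon> ^ p \<le> \<epsilon>" using power_decreasing[of 1 p \<epsilon>] p \<epsilon> by simp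
        then have "(2 * \<epsilon>) ^ p * C \<le> 2 ^ p * \<epsilon> * C"
          unfolding power_mult_distrib using C by (intro mult_right_mono mult_left_mono) auto
        then have "2 ^ p * ((2 * \<epsilon>) ^ p * C + \<eta>) \<le> 2 ^ p * (2 ^ p * \<epsilon> * C + \<epsilon>)"
          using \<eta>(3) by (intro mult_left_mono add_mono) auto
        also have "\<dots> = 2 ^ p * (2 ^ p * C + 1) * \<epsilon>" by (simp add: algebra_simps)
        finally show "2 ^ p * ((2 * \<epsilon>) ^ p * C + \<eta>) \<le> 2 ^ p * (2 ^ p * C + 1) * \<epsilon>" .
      qed
      finally show ?case using end' cl by blast
    qed
  qed
  show ?thesis
    by (rule exI[of _ "2 ^ p * (2 ^ p * C + 1)"]) (use C main in auto)
qed

section \<open>Convergence of solutions and of their derivatives\<close>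

lemma Lp_subset:
  fixes g :: "real \<Rightarrow> 'b::euclidean_space"
  assumes "g \<in> Lp p A" "B \<subseteq> A" "A \<in> sets lebesgue" "B \<in> sets lebesgue"
  shows "g \<in> Lp p B"
proof -
  have "g \<in> borel_measurable (lebesgue_on B)"
  proof (rule measurable_restrict_mono)
    show "g \<in> borel_measurable (lebesgue_on A)" using assms(1) by (simp add: Lp_def)
  qed fact
  moreover have "set_integrable lebesgue B (\<lambda>t. norm (g t) ^ p)"
  proof (rule set_integrable_subset[OF _ assms(4,2)])
    have "integrable (lebesgue_on A) (\<lambda>t. norm (g t) ^ p)" using assms(1) by (simp add: Lp_def)
    then show "set_integrable lebesgue A (\<lambda>t. norm (g t) ^ p)"
      using assms(3) by (simp add: set_integrable_def integrable_restrict_space)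
  qed
  ultimately show ?thesis using assms(4) by (simp add: Lp_def set_integrable_def integrable_restrict_space)
qed

lemma Lp_nn_measurable:
  fixes g :: "real \<Rightarrow> 'b::euclidean_space"
  assumes "g \<in> Lp p S" "S \<in> sets lebesgue"
  shows "(\<lambda>t. ennreal (norm (g t) ^ p) * indicator S t) \<in> borel_measurable lebesgue"
proof -
  have "(\<lambda>t. ennreal (norm (g t) ^ p)) \<in> borel_measurable (lebesgue_on S)"
    using assms(1) by (auto simp: Lp_def)
  then show ?thesis using assms(2) by (subst (asm) borel_measurable_restrict_space_iff_ennreal) auto
qed

lemma tendsto_0_of_linear_bound:
  fixes F :: "nat \<Rightarrow> ennreal"
  assumes "0 \<le> C" "\<And>\<epsilon>. 0 < \<epsilon> \<Longrightarrow> \<epsilon> \<le> 1/2 \<Longrightarrow> \<forall>\<^sub>F n in sequentially. F n \<le> ennreal (C * \<epsilon>)"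
  shows "F \<longlonglongrightarrow> 0"
proof (rule order_tendstoI)
  fix a :: ennreal assume "0 < a"
  then obtain e where e: "0 < e" "ennreal e < a"
  proof (cases a)
    case (real r)
    then show thesis using that[of "r / 2"] \<open>0 < a\<close> by (simp add: ennreal_less_iff)
  next
    case top
    then show thesis using that[of 1] by simp
  qed
  define \<epsilon> where "\<epsilon> = min (1/2) (e / (C + 1))"
  have \<epsilon>: "0 < \<epsilon>" "\<epsilon> \<le> 1/2" using e(1) assms(1) unfolding \<epsilon>_def by (simp, intro min.cobounded1)
  have "C * \<epsilon> \<le> C * (e / (C + 1))" using assms(1) by (intro mult_left_mono) (auto simp: \<epsilon>_def)
  also have "\<dots> \<le> e" using assms(1) e(1) by (simp add: field_simps)
  finally have "ennreal (C * \<epsilon>) < a" using e(2) by (meson ennreal_leI le_less_trans)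
  from assms(2)[OF \<epsilon>] show "\<forall>\<^sub>F n in sequentially. F n < a"
  proof eventually_elim
    case (elim n)
    then show ?case using \<open>ennreal (C * \<epsilon>) < a\<close> by (rule le_less_trans)
  qed
qed simp

text \<open>After 0 the derivatives are right-hand sides and converge by \<open>dde_close\<close>;
  before 0 they are the derivatives of the initial data, and only there does convergence of the data
  in C1p enter.\<close>

lemma solutions_converge_of_perturbation:
  fixes f :: "('n::finite) rhs"
  assumes p: "0 < p" and fs: "\<And>n. fs n \<in> LC p" and f: "f \<in> LC p"
    and \<phi>s: "\<And>n. \<phi>s n \<in> C1p p {-1..0}" and \<phi>: "\<phi> \<in> C1p p {-1..0}"
    and lim: "uniform_limit {-1..0} \<phi>s \<phi> sequentially"
    and T: "-1 \<le> T" "ereal T < dde_end f \<phi>"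
    and pert: "\<And>R. 0 \<le> T \<Longrightarrow> (\<And>t. t \<in> {-1..T} \<Longrightarrow> norm (dde_sol f \<phi> t) \<le> R) \<Longrightarrow>
        perturbation p T R fs \<phi>s f (dde_sol f \<phi>)"
  shows "solutions_converge p T fs \<phi>s f \<phi> \<and>
    ((\<lambda>n. C1p_norm p {-1..0} (\<lambda>t. \<phi>s n t - \<phi> t)) \<longlonglongrightarrow> 0 \<longrightarrow> solutions_converge_C1p p T fs \<phi>s f \<phi>)"
proof -
  let ?y = "dde_sol f \<phi>" and ?x = "\<lambda>n. dde_sol (fs n) (\<phi>s n)"
  let ?dd = "\<lambda>n t. dde_deriv (fs n) (\<phi>s n) (?x n) t - dde_deriv f \<phi> ?y t"
  have c\<phi>s: "continuous_on {-1..0} (\<phi>s n)" for n using \<phi>s by (simp add: C1p_def)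
  have c\<phi>: "continuous_on {-1..0} \<phi>" using \<phi> by (simp add: C1p_def)
  have cy: "continuous_on {-1..T} ?y" by (rule dde_sol_continuous[OF f p c\<phi> T(2)])
  have "\<exists>C\<ge>0. \<forall>\<epsilon>. 0 < \<epsilon> \<and> \<epsilon> \<le> 1/2 \<longrightarrow> (\<forall>\<^sub>F n in sequentially.
      ereal T < dde_end (fs n) (\<phi>s n) \<and> (\<forall>t\<in>{-1..T}. norm (?x n t - ?y t) \<le> \<epsilon>) \<and>
      (\<integral>\<^sup>+t\<in>{0..T}. ennreal (norm (?dd n t) ^ p) \<partial>lebesgue) \<le> ennreal (C * \<epsilon>))"
  \<comment> \<open>For negative \<open>T\<close> the solutions on [-1,T] are the initial data, and
    the integral over {0..T} is empty.\<close>
  proof (cases "0 \<le> T")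
    case True
    obtain R where R: "0 \<le> R" "\<And>t. t \<in> {-1..T} \<Longrightarrow> norm (?y t) \<le> R"
      using continuous_on_norm_bound[OF cy] by blast
    show ?thesis
    proof (rule dde_close[OF p fs f c\<phi>s c\<phi> lim True T(2)])
      show "0 \<le> R + 1" using R(1) by simp
      show "norm (?y t) + 1 \<le> R + 1" if "t \<in> {-1..T}" for t using R(2)[OF that] by simp
      show "perturbation p T (R + 1) fs \<phi>s f ?y"
      proof (rule pert[OF True])
        show "norm (?y t) \<le> R + 1" if "t \<in> {-1..T}" for t using R(2)[OF that] by simp
      qed
    qed
  next
    case False
    have "\<forall>\<^sub>F n in sequentially. ereal T < dde_end (fs n) (\<phi>s n) \<and> (\<forall>t\<in>{-1..T}. norm (?x n t - ?y t) \<le> \<epsilon>) \<and>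
      (\<integral>\<^sup>+t\<in>{0..T}. ennreal (norm (?dd n t) ^ p) \<partial>lebesgue) \<le> ennreal (0 * \<epsilon>)" if "0 < \<epsilon>" for \<epsilon>
      using uniform_limitD[OF lim that]
    proof eventually_elim
      case (elim n)
      have "ereal T < 0" using False by simp
      then have "ereal T < dde_end (fs n) (\<phi>s n)" using dde_end_pos[OF fs p c\<phi>s] by (rule less_trans)
      moreover have "norm (?x n t - ?y t) \<le> \<epsilon>" if "t \<in> {-1..T}" for t
      proof -
        have t: "t \<in> {-1..0}" using that False by simp
        then show ?thesis
          using elim dde_sol_initial[OF fs p c\<phi>s t, of n n] dde_sol_initial[OF f p c\<phi> t] by (force simp: dist_norm)
      qed
      ultimately show ?case using False by simp
    qed
    then show ?thesis by (intro exI[of _ 0]) simp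
  qed
  then obtain C where C: "0 \<le> C" and ev: "\<And>\<epsilon>. 0 < \<epsilon> \<Longrightarrow> \<epsilon> \<le> 1/2 \<Longrightarrow> \<forall>\<^sub>F n in sequentially.
      ereal T < dde_end (fs n) (\<phi>s n) \<and> (\<forall>t\<in>{-1..T}. norm (?x n t - ?y t) \<le> \<epsilon>) \<and>
      (\<integral>\<^sup>+t\<in>{0..T}. ennreal (norm (?dd n t) ^ p) \<partial>lebesgue) \<le> ennreal (C * \<epsilon>)" by blast
  have end': "\<forall>\<^sub>F n in sequentially. ereal T < dde_end (fs n) (\<phi>s n)"
    using ev[of "1/2"] by (simp, elim eventually_mono) blast
  have yC: "?y \<in> C1p p {-1..T}" by (rule dde_sol_C1p[OF f p \<phi> T(2,1)])
  have xC: "\<forall>\<^sub>F n in sequentially. ereal T < dde_end (fs n) (\<phi>s n) \<and> ?x n \<in> C1p p {-1..T}"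
    using end' by eventually_elim (auto intro: dde_sol_C1p[OF fs p \<phi>s _ T(1)])
  have sup0: "(\<lambda>n. SUP t\<in>{-1..T}. norm (?x n t - ?y t)) \<longlonglongrightarrow> 0"
  proof (rule tendstoI)
    fix e :: real assume "0 < e"
    then have "0 < min (e/2) (1/2)" "min (e/2) (1/2) \<le> 1/2" by auto
    from ev[OF this] show "\<forall>\<^sub>F n in sequentially. dist (SUP t\<in>{-1..T}. norm (?x n t - ?y t)) 0 < e"
    proof eventually_elim
      case (elim n)
      have ne: "{-1..T} \<noteq> {}" using T(1) by simp
      have le: "norm (?x n t - ?y t) \<le> e / 2" if "t \<in> {-1..T}" for t using elim that by fastforce
      have "(SUP t\<in>{-1..T}. norm (?x n t - ?y t)) \<le> e / 2" by (rule cSUP_least[OF ne le])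
      \<comment> \<open>The point -1 lies in the interval because T \<ge> -1; it shows that the
        supremum is nonnegative.\<close>
      moreover have "norm (?x n (-1) - ?y (-1)) \<le> (SUP t\<in>{-1..T}. norm (?x n t - ?y t))"
        by (rule cSUP_upper) (use T(1) le in \<open>auto intro!: bdd_aboveI2[of _ _ "e/2"]\<close>)
      then have "0 \<le> (SUP t\<in>{-1..T}. norm (?x n t - ?y t))" by (rule order_trans[OF norm_ge_zero])
      ultimately show ?case using \<open>0 < e\<close> by (simp add: dist_real_def)
    qed
  qed
  have I0: "(\<lambda>n. \<integral>\<^sup>+t\<in>{0..T}. ennreal (norm (?dd n t) ^ p) \<partial>lebesgue) \<longlonglongrightarrow> 0"
  proof (rule tendsto_0_of_linear_bound[OF C])
    fix \<epsilon> :: real assume "0 < \<epsilon>" "\<epsilon> \<le> 1/2"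
    from ev[OF this] show "\<forall>\<^sub>F n in sequentially.
        (\<integral>\<^sup>+t\<in>{0..T}. ennreal (norm (?dd n t) ^ p) \<partial>lebesgue) \<le> ennreal (C * \<epsilon>)"
      by (rule eventually_mono) blast
  qed
  have der: "AE t in lebesgue. t \<in> {-1<..<T} \<longrightarrow> ((\<lambda>t. ?x n t - ?y t) has_vector_derivative ?dd n t) (at t)"
    if "ereal T < dde_end (fs n) (\<phi>s n)" for n
    using dde_sol_has_derivative_AE[OF fs p \<phi>s that] dde_sol_has_derivative_AE[OF f p \<phi> T(2)]
    by eventually_elim (auto intro: has_vector_derivative_diff)
  have ddL: "?dd n \<in> Lp p {-1..T}" if "ereal T < dde_end (fs n) (\<phi>s n)" for n
    by (rule Lp_diff[OF dde_deriv_Lp[OF fs p \<phi>s that T(1)] dde_deriv_Lp[OF f p \<phi> T(2,1)]])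
  \<comment> \<open>Used with \<open>a\<close> equal to 0 and to -1: derivatives relative to
    different intervals differ at most at end points.\<close>
  have derL: "deriv_on {a..T} (\<lambda>t. ?x n t - ?y t) \<in> Lp p {a..T}"
    and deq: "AE t in lebesgue. t \<in> {a..T} \<longrightarrow> deriv_on {a..T} (\<lambda>t. ?x n t - ?y t) t = ?dd n t"
    if "ereal T < dde_end (fs n) (\<phi>s n)" "-1 \<le> a" for n a
  proof -
    have "AE t in lebesgue. t \<in> {a<..<T} \<longrightarrow> ((\<lambda>t. ?x n t - ?y t) has_vector_derivative ?dd n t) (at t)"
      using der[OF that(1)] by eventually_elim (use that(2) in auto)
    then show ae: "AE t in lebesgue. t \<in> {a..T} \<longrightarrow> deriv_on {a..T} (\<lambda>t. ?x n t - ?y t) t = ?dd n t"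
      by (rule deriv_on_AE)
    have "?dd n \<in> Lp p {a..T}" by (rule Lp_subset[OF ddL[OF that(1)]]) (use that(2) in auto)
    then show "deriv_on {a..T} (\<lambda>t. ?x n t - ?y t) \<in> Lp p {a..T}"
    proof (rule Lp_cong_AE[rotated])
      show "AE t in lebesgue. t \<in> {a..T} \<longrightarrow> ?dd n t = deriv_on {a..T} (\<lambda>t. ?x n t - ?y t) t"
        using ae by eventually_elim simp
    qed simp
  qed
  have L0: "(\<lambda>n. Lp_norm p {0..T} (deriv_on {0..T} (\<lambda>t. ?x n t - ?y t))) \<longlonglongrightarrow> 0"
  proof (rule Lp_norm_tendsto_0[OF _ p])
    show "\<forall>\<^sub>F n in sequentially. deriv_on {0..T} (\<lambda>t. ?x n t - ?y t) \<in> borel_measurable (lebesgue_on {0..T})"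
      using end' by eventually_elim (use derL[of _ 0] in \<open>auto simp: Lp_def\<close>)
    have "\<forall>\<^sub>F n in sequentially. (\<integral>\<^sup>+t\<in>{0..T}. ennreal (norm (?dd n t) ^ p) \<partial>lebesgue)
        = (\<integral>\<^sup>+t\<in>{0..T}. ennreal (norm (deriv_on {0..T} (\<lambda>t. ?x n t - ?y t) t) ^ p) \<partial>lebesgue)"
      using end'
    proof eventually_elim
      case (elim n)
      show ?case
      proof (rule nn_integral_cong_AE)
        have "AE t in lebesgue. t \<in> {0..T} \<longrightarrow> deriv_on {0..T} (\<lambda>t. ?x n t - ?y t) t = ?dd n t"
          by (rule deq[OF elim]) simp
        then show "AE t in lebesgue. ennreal (norm (?dd n t) ^ p) * indicator {0..T} t
            = ennreal (norm (deriv_on {0..T} (\<lambda>t. ?x n t - ?y t) t) ^ p) * indicator {0..T} t"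
          by eventually_elim (auto split: split_indicator)
      qed
    qed
    then show "(\<lambda>n. \<integral>\<^sup>+t\<in>{0..T}. ennreal (norm (deriv_on {0..T} (\<lambda>t. ?x n t - ?y t) t) ^ p) \<partial>lebesgue) \<longlonglongrightarrow> 0"
      by (rule Lim_transform_eventually[OF I0])
  qed simp
  have first: "solutions_converge p T fs \<phi>s f \<phi>"
    unfolding solutions_converge_def using yC xC tendsto_add[OF sup0 L0] by simp
  moreover have "solutions_converge_C1p p T fs \<phi>s f \<phi>"
    if D0: "(\<lambda>n. C1p_norm p {-1..0} (\<lambda>t. \<phi>s n t - \<phi> t)) \<longlonglongrightarrow> 0"
  proof -
    let ?\<psi> = "\<lambda>n t. \<phi>s n t - \<phi> t"
    let ?D = "\<lambda>n t. deriv_on {-1..0} (\<phi>s n) t - deriv_on {-1..0} \<phi> t"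
    have \<psi>der: "AE t in lebesgue. t \<in> {-1<..<0} \<longrightarrow> (?\<psi> n has_vector_derivative ?D n t) (at t)" for n
      using C1p_has_derivative_AE[OF \<phi>s] C1p_has_derivative_AE[OF \<phi>]
      by eventually_elim (auto intro: has_vector_derivative_diff)
    have DL: "?D n \<in> Lp p {-1..0}" for n using \<phi>s \<phi> by (intro Lp_diff) (auto simp: C1p_def)
    have \<psi>C: "?\<psi> n \<in> C1p p {-1..0}" for n
      by (rule C1pI[OF _ \<psi>der DL]) (intro continuous_intros c\<phi>s c\<phi>)
    then have \<psi>L: "deriv_on {-1..0} (?\<psi> n) \<in> Lp p {-1..0}" for n by (simp add: C1p_def)
    have "Lp_norm p {-1..0} (deriv_on {-1..0} (?\<psi> n)) \<le> C1p_norm p {-1..0} (?\<psi> n)" for n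
    proof -
      have "continuous_on {-1..0} (?\<psi> n)" by (intro continuous_intros c\<phi>s c\<phi>)
      then have "bdd_above ((\<lambda>t. norm (?\<psi> n t)) ` {-1..0})"
        by (intro compact_imp_bounded[THEN bounded_imp_bdd_above] compact_continuous_image continuous_on_norm) auto
      then have "norm (?\<psi> n 0) \<le> (SUP t\<in>{-1..0}. norm (?\<psi> n t))" by (intro cSUP_upper) auto
      then show ?thesis using norm_ge_zero[of "?\<psi> n 0"] unfolding C1p_norm_def by linarith
    qed
    then have "(\<lambda>n. Lp_norm p {-1..0} (deriv_on {-1..0} (?\<psi> n))) \<longlonglongrightarrow> 0"
      by (intro tendsto_sandwich[OF _ _ tendsto_const D0]) auto
    then have "(\<lambda>n. ennreal (Lp_norm p {-1..0} (deriv_on {-1..0} (?\<psi> n)) ^ p)) \<longlonglongrightarrow> ennreal (0 ^ p)"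
      by (intro tendsto_intros)
    then have J0: "(\<lambda>n. \<integral>\<^sup>+t\<in>{-1..0}. ennreal (norm (deriv_on {-1..0} (?\<psi> n) t) ^ p) \<partial>lebesgue) \<longlonglongrightarrow> 0"
      using p by (simp add: nn_integral_Lp[OF \<psi>L] zero_power)
    have "(\<lambda>n. Lp_norm p {-1..T} (deriv_on {-1..T} (\<lambda>t. ?x n t - ?y t))) \<longlonglongrightarrow> 0"
    proof (rule Lp_norm_tendsto_0[OF _ p])
      show "\<forall>\<^sub>F n in sequentially. deriv_on {-1..T} (\<lambda>t. ?x n t - ?y t) \<in> borel_measurable (lebesgue_on {-1..T})"
        using end' by eventually_elim (use derL[of _ "-1"] in \<open>auto simp: Lp_def\<close>)
      have "\<forall>\<^sub>F n in sequentially. (\<integral>\<^sup>+t\<in>{-1..T}. ennreal (norm (deriv_on {-1..T} (\<lambda>t. ?x n t - ?y t) t) ^ p) \<partial>lebesgue)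
          \<le> (\<integral>\<^sup>+t\<in>{-1..0}. ennreal (norm (deriv_on {-1..0} (?\<psi> n) t) ^ p) \<partial>lebesgue)
            + (\<integral>\<^sup>+t\<in>{0..T}. ennreal (norm (?dd n t) ^ p) \<partial>lebesgue)"
        using end'
      proof eventually_elim
        case (elim n)
        have "(\<integral>\<^sup>+t\<in>{-1..T}. ennreal (norm (deriv_on {-1..T} (\<lambda>t. ?x n t - ?y t) t) ^ p) \<partial>lebesgue)
          \<le> (\<integral>\<^sup>+t. ennreal (norm (deriv_on {-1..0} (?\<psi> n) t) ^ p) * indicator {-1..0} t
            + ennreal (norm (?dd n t) ^ p) * indicator {0..T} t \<partial>lebesgue)"
        proof (rule nn_integral_mono_AE)
          show "AE t in lebesgue. ennreal (norm (deriv_on {-1..T} (\<lambda>t. ?x n t - ?y t) t) ^ p) * indicator {-1..T} t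
            \<le> ennreal (norm (deriv_on {-1..0} (?\<psi> n) t) ^ p) * indicator {-1..0} t
              + ennreal (norm (?dd n t) ^ p) * indicator {0..T} t"
            \<comment> \<open>Before 0, the derivatives relative to [-1,T] and to [-1,0] are both
              almost everywhere the difference of the derivatives of the data.\<close>
            using deq[OF elim order_refl] deriv_on_AE[OF \<psi>der, of n]
          proof eventually_elim
            case (elim t)
            show ?case
            proof (cases "t \<in> {-1..T}")
              case True
              show ?thesis
              proof (cases "t < 0")
                case True
                then show ?thesis using elim \<open>t \<in> {-1..T}\<close> by (simp add: dde_deriv_def)
              next
                case False
                then show ?thesis using elim \<open>t \<in> {-1..T}\<close> by (simp add: add_increasing)
              qed
            qed simp
          qed
        qed
        also have "\<dots> = (\<integral>\<^sup>+t\<in>{-1..0}. ennreal (norm (deriv_on {-1..0} (?\<psi> n) t) ^ p) \<partial>lebesgue)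
            + (\<integral>\<^sup>+t\<in>{0..T}. ennreal (norm (?dd n t) ^ p) \<partial>lebesgue)"
        proof (rule nn_integral_add)
          show "(\<lambda>t. ennreal (norm (deriv_on {-1..0} (?\<psi> n) t) ^ p) * indicator {-1..0} t) \<in> borel_measurable lebesgue"
            by (rule Lp_nn_measurable[OF \<psi>L]) simp
          show "(\<lambda>t. ennreal (norm (?dd n t) ^ p) * indicator {0..T} t) \<in> borel_measurable lebesgue"
            by (rule Lp_nn_measurable[OF Lp_subset[OF ddL[OF elim]]]) auto
        qed
        finally show ?case .
      qed
      moreover have "(\<lambda>n. (\<integral>\<^sup>+t\<in>{-1..0}. ennreal (norm (deriv_on {-1..0} (?\<psi> n) t) ^ p) \<partial>lebesgue)
            + (\<integral>\<^sup>+t\<in>{0..T}. ennreal (norm (?dd n t) ^ p) \<partial>lebesgue)) \<longlonglongrightarrow> 0"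
        using tendsto_add[OF J0 I0] by simp
      ultimately show "(\<lambda>n. \<integral>\<^sup>+t\<in>{-1..T}. ennreal (norm (deriv_on {-1..T} (\<lambda>t. ?x n t - ?y t) t) ^ p) \<partial>lebesgue) \<longlonglongrightarrow> 0"
        by (rule tendsto_sandwich[OF always_eventually[OF allI[OF zero_le]] _ tendsto_const])
    qed simp
    then show ?thesis
      unfolding solutions_converge_C1p_def C1p_norm_def
      using yC xC tendsto_add[OF sup0] by simp
  qed
  ultimately show ?thesis by blast
qed

section \<open>Closures in the seminorm topologies\<close>

text \<open>A supremum of limits is at most the lower limit of the suprema, and countability keeps
  the suprema measurable, so Fatou's lemma applies to the suprema themselves.\<close>

lemma fatou_SUP:
  fixes H :: "nat \<Rightarrow> 'i \<Rightarrow> real \<Rightarrow> real"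
  assumes I: "countable I" and A: "A \<in> sets lebesgue"
    and m: "\<And>k i. i \<in> I \<Longrightarrow> H k i \<in> borel_measurable lebesgue"
    and lim: "AE t in lebesgue. \<forall>i\<in>I. (\<lambda>k. H k i t) \<longlonglongrightarrow> G i t"
    and B: "\<And>k. (\<integral>\<^sup>+t\<in>A. (SUP i\<in>I. ennreal (H k i t)) \<partial>lebesgue) \<le> B"
  shows "(\<integral>\<^sup>+t\<in>A. (SUP i\<in>I. ennreal (G i t)) \<partial>lebesgue) \<le> B"
proof -
  let ?u = "\<lambda>k t. (SUP i\<in>I. ennreal (H k i t)) * indicator A t"
  have "(\<integral>\<^sup>+t\<in>A. (SUP i\<in>I. ennreal (G i t)) \<partial>lebesgue) \<le> (\<integral>\<^sup>+t. liminf (\<lambda>k. ?u k t) \<partial>lebesgue)"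
  proof (rule nn_integral_mono_AE)
    show "AE t in lebesgue. (SUP i\<in>I. ennreal (G i t)) * indicator A t \<le> liminf (\<lambda>k. ?u k t)"
      using lim
    proof eventually_elim
      case (elim t)
      have "(SUP i\<in>I. ennreal (G i t)) \<le> liminf (\<lambda>k. SUP i\<in>I. ennreal (H k i t))"
      proof (rule SUP_least)
        fix i assume i: "i \<in> I"
        have "(\<lambda>k. ennreal (H k i t)) \<longlonglongrightarrow> ennreal (G i t)" using elim i by (intro tendsto_intros) blast
        then have "ennreal (G i t) = liminf (\<lambda>k. ennreal (H k i t))"
          by (simp add: lim_imp_Liminf)
        also have "\<dots> \<le> liminf (\<lambda>k. SUP i\<in>I. ennreal (H k i t))"
          by (intro Liminf_mono always_eventually allI SUP_upper i)
        finally show "ennreal (G i t) \<le> liminf (\<lambda>k. SUP i\<in>I. ennreal (H k i t))" .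
      qed
      then show ?case by (simp split: split_indicator)
    qed
  qed
  also have "\<dots> \<le> liminf (\<lambda>k. \<integral>\<^sup>+t. ?u k t \<partial>lebesgue)"
  proof (rule nn_integral_liminf)
    show "?u k \<in> borel_measurable lebesgue" for k
      using m A by (intro borel_measurable_times_ennreal borel_measurable_SUP[OF I] borel_measurable_indicator
          measurable_compose[OF _ measurable_ennreal]) auto
  qed
  also have "\<dots> \<le> limsup (\<lambda>k. \<integral>\<^sup>+t. ?u k t \<partial>lebesgue)" by (rule Liminf_le_Limsup) simp
  also have "\<dots> \<le> B" by (rule Limsup_bounded) (use B in auto)
  finally show ?thesis .
qed

lemma Lp_cong:
  fixes g h :: "real \<Rightarrow> 'b::euclidean_space"
  assumes "g \<in> Lp p S" "\<And>t. t \<in> S \<Longrightarrow> g t = h t" "S \<in> sets lebesgue"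
  shows "h \<in> Lp p S"
  by (rule Lp_cong_AE[OF assms(3,1)]) (use assms(2) in auto)

lemma LC_Lp_on:
  assumes f: "f \<in> LC p" "0 < p" and w: "continuous_on {a..b} w"
  shows "(\<lambda>t. f (t, w t)) \<in> Lp p {a..b}"
proof (cases "a \<le> b")
  case True
  have "continuous_on UNIV (\<lambda>t. w (max a (min b t)))"
    by (rule continuous_on_compose2[OF w]) (use True in \<open>auto intro!: continuous_intros\<close>)
  then have "(\<lambda>t. f (t, w (max a (min b t)))) \<in> Lp p {a..b}" by (rule LC_comp_Lp[OF f])
  then show ?thesis by (rule Lp_cong) auto
next
  case False
  then have "(\<lambda>t. f (t, 0)) \<in> Lp p {a..b}" by (intro LC_comp_Lp[OF f]) simp
  then show ?thesis by (rule Lp_cong) (use False in auto)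
qed

text \<open>Uniform over all curves in a ball, hence the suprema in the seminorms are taken over
  bounded sets of reals.\<close>

lemma LC_Lp_norm_bound:
  assumes f: "f \<in> LC p" "0 < p"
  shows "\<exists>B. \<forall>w. continuous_on {a..b} w \<and> (\<forall>t\<in>{a..b}. norm (w t) \<le> R) \<longrightarrow>
    Lp_norm p {a..b} (\<lambda>t. f (t, w t)) \<le> B"
proof -
  obtain k where k: "LC_bound p f R k" using ex_LC_bound f by blast
  have kL: "k \<in> Lp p {a..b}"
    using LC_boundD[OF k] by (simp add: Lp_lebesgue_iff)
  have "Lp_norm p {a..b} (\<lambda>t. f (t, w t)) \<le> Lp_norm p {a..b} k"
    if w: "continuous_on {a..b} w" "\<forall>t\<in>{a..b}. norm (w t) \<le> R" for w
  proof -
    have "ennreal (Lp_norm p {a..b} (\<lambda>t. f (t, w t)) ^ p) \<le> (\<integral>\<^sup>+t\<in>{a..b}. ennreal (k t ^ p) \<partial>lebesgue)"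
      using LC_comp_nn_le[OF k, of a b w] w(2) by (simp add: nn_integral_Lp[OF LC_Lp_on[OF f w(1)] _ f(2), symmetric])
    also have "\<dots> = ennreal (Lp_norm p {a..b} k ^ p)"
      using LC_boundD(2)[OF k] by (simp add: nn_integral_Lp[OF kL _ f(2), symmetric])
    finally have "Lp_norm p {a..b} (\<lambda>t. f (t, w t)) ^ p \<le> Lp_norm p {a..b} k ^ p" by simp
    then show ?thesis using f(2) by (simp add: power_mono_iff)
  qed
  then show ?thesis by blast
qed

lemma Lp_norm_zero: "0 < p \<Longrightarrow> Lp_norm p S (\<lambda>_. 0) = 0"
  by (simp add: Lp_norm_def zero_power)

section \<open>Neighbourhoods, limits and approximating sequences\<close>

text \<open>The generating sets centred at \<open>g\<close> contain it because the seminorms vanish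
  at g - g; a finite intersection of them is a neighbourhood of \<open>g\<close> and so meets
  \<open>E\<close>.\<close>

lemma closure_seminorm_topology:
  assumes g: "g \<in> seminorm_topology V P closure_of E" and Q: "finite Q" "Q \<noteq> {}" "Q \<subseteq> P"
    and z: "\<And>\<rho>. \<rho> \<in> Q \<Longrightarrow> \<rho> (g - g) = 0" and "0 < \<epsilon>"
  shows "g \<in> V" "\<exists>e\<in>E. e \<in> V \<and> (\<forall>\<rho>\<in>Q. \<rho> (e - g) < \<epsilon>)"
proof -
  have "g \<in> topspace (seminorm_topology V P)" using g by (simp add: in_closure_of)
  then show gV: "g \<in> V" by (auto simp: seminorm_topology_def)
  let ?U = "\<Inter>\<rho>\<in>Q. {h \<in> V. \<rho> (h - g) < \<epsilon>}"
  have "openin (seminorm_topology V P) ?U"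
  proof (rule openin_Inter)
    show "finite ((\<lambda>\<rho>. {h \<in> V. \<rho> (h - g) < \<epsilon>}) ` Q)" "(\<lambda>\<rho>. {h \<in> V. \<rho> (h - g) < \<epsilon>}) ` Q \<noteq> {}"
      using Q by auto
    fix X assume "X \<in> (\<lambda>\<rho>. {h \<in> V. \<rho> (h - g) < \<epsilon>}) ` Q"
    then show "openin (seminorm_topology V P) X"
      using Q(3) gV \<open>0 < \<epsilon>\<close> unfolding seminorm_topology_def by (intro topology_generated_by_Basis) blast
  qed
  moreover have "g \<in> ?U" by (intro INT_I CollectI conjI gV) (simp only: z \<open>0 < \<epsilon>\<close>)
  ultimately obtain e where "e \<in> E" "e \<in> ?U" using g unfolding in_closure_of by blast
  then show "\<exists>e\<in>E. e \<in> V \<and> (\<forall>\<rho>\<in>Q. \<rho> (e - g) < \<epsilon>)" using Q(2) by blast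
qed

lemma limitin_seminorm_topology:
  assumes lim: "limitin (subtopology (seminorm_topology V P) C) fs f sequentially"
    and \<rho>: "\<rho> \<in> P" "\<rho> (f - f) = 0" and "0 < \<epsilon>"
  shows "\<forall>\<^sub>F n in sequentially. \<rho> (fs n - f) < \<epsilon>"
proof -
  have lim': "limitin (seminorm_topology V P) fs f sequentially"
    using lim by (simp add: limitin_subtopology)
  then have fV: "f \<in> V" by (auto simp: limitin_def seminorm_topology_def)
  have "openin (seminorm_topology V P) {h \<in> V. \<rho> (h - f) < \<epsilon>}"
    unfolding seminorm_topology_def using \<rho>(1) fV \<open>0 < \<epsilon>\<close> by (intro topology_generated_by_Basis) blast
  moreover have "f \<in> {h \<in> V. \<rho> (h - f) < \<epsilon>}" using fV \<rho>(2) \<open>0 < \<epsilon>\<close> by simp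
  ultimately have "\<forall>\<^sub>F n in sequentially. fs n \<in> {h \<in> V. \<rho> (h - f) < \<epsilon>}"
    using lim' unfolding limitin_def by blast
  then show ?thesis by (rule eventually_mono) blast
qed

text \<open>The k-th approximant is 2^(-k)-close at the first points of an enumeration and on
  intervals growing with \<open>k\<close>. The p-th powers of the errors then have summable
  integrals, so the errors themselves tend to 0 almost everywhere, with no passage to a
  subsequence.\<close>

lemma closure_sequence:
  fixes g :: "('n::finite) rhs"
  assumes p: "0 < p" and E: "E \<subseteq> LC p" and g: "g \<in> LC p" and Z: "countable Z"
    and appr: "\<And>F b \<epsilon>. finite F \<Longrightarrow> F \<noteq> {} \<Longrightarrow> F \<subseteq> Z \<Longrightarrow> 0 < \<epsilon> \<Longrightarrow>
      \<exists>e\<in>E. \<forall>z\<in>F. Lp_norm p {- (1 + real b)..1 + real b} (\<lambda>t. (e - g) (t, z)) < \<epsilon>"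
    and ne: "Z \<noteq> {}"
  shows "\<exists>e::nat \<Rightarrow> 'n rhs. (\<forall>k. e k \<in> E) \<and> (AE t in lebesgue. \<forall>z\<in>Z. (\<lambda>k. e k (t, z)) \<longlonglongrightarrow> g (t, z))"
proof -
  define \<zeta> where "\<zeta> = from_nat_into Z"
  have \<zeta>: "range \<zeta> = Z" using Z ne by (simp add: \<zeta>_def range_from_nat_into)
  have "\<exists>e\<in>E. \<forall>z\<in>\<zeta> ` {..k}. Lp_norm p {- (1 + real k)..1 + real k} (\<lambda>t. (e - g) (t, z)) < (1/2) ^ k" for k
    using \<zeta> by (intro appr) auto
  then obtain e where e: "\<And>k. e k \<in> E"
    "\<And>k z. z \<in> \<zeta> ` {..k} \<Longrightarrow> Lp_norm p {- (1 + real k)..1 + real k} (\<lambda>t. (e k - g) (t, z)) < (1/2) ^ k"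
    by metis
  have eL: "e k - g \<in> LC p" for k using e(1) E g p by (intro LC_diff) auto
  have "AE t in lebesgue. t \<in> {- (1 + real b)..1 + real b} \<longrightarrow> (\<lambda>k. e k (t, \<zeta> i)) \<longlonglongrightarrow> g (t, \<zeta> i)" for i b
  proof -
    \<comment> \<open>From this index on, the i-th point is among the controlled ones and the b-th
      interval lies inside the controlled interval; the shift does not affect the limit.\<close>
    define N where "N = max i b"
    define h where "h k t = norm ((e (k + N) - g) (t, \<zeta> i)) ^ p" for k t
    let ?I = "{- (1 + real b)..1 + real b}"
    have m: "(\<lambda>t. (e k - g) (t, \<zeta> i)) \<in> borel_measurable lebesgue" for k
      by (rule LC_comp_measurable[OF eL]) simp
    have mh: "(\<lambda>t. ennreal (h k t) * indicator ?I t) \<in> borel_measurable lebesgue" for k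
      unfolding h_def using Lp_nn_measurable[OF LC_comp_Lp[OF eL p, of "\<lambda>_. \<zeta> i"]] by simp
    have le: "(\<integral>\<^sup>+t\<in>?I. ennreal (h k t) \<partial>lebesgue) \<le> ennreal ((1/2) ^ k)" for k
    proof -
      let ?J = "{- (1 + real (k + N))..1 + real (k + N)}"
      have "(\<integral>\<^sup>+t\<in>?I. ennreal (h k t) \<partial>lebesgue) \<le> (\<integral>\<^sup>+t\<in>?J. ennreal (h k t) \<partial>lebesgue)"
        by (rule nn_set_integral_set_mono) (auto simp: N_def)
      also have "\<dots> = ennreal (Lp_norm p ?J (\<lambda>t. (e (k + N) - g) (t, \<zeta> i)) ^ p)"
        unfolding h_def by (rule nn_integral_Lp[OF LC_comp_Lp[OF eL p] _ p]) auto
      also have "\<dots> \<le> ennreal ((1/2) ^ k)"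
      proof (rule ennreal_leI)
        let ?L = "Lp_norm p ?J (\<lambda>t. (e (k + N) - g) (t, \<zeta> i))"
        have L: "?L < (1/2) ^ (k + N)" by (rule e(2)) (auto simp: N_def)
        have pw: "(1/2::real) ^ (k + N) \<le> (1/2) ^ k" "(1/2::real) ^ (k + N) \<le> 1"
          by (auto intro: power_decreasing power_le_one)
        \<comment> \<open>The norm is below 1, so raising it to the power \<open>p\<close> preserves
          the geometric bound.\<close>
        have "?L ^ p \<le> ?L" using power_decreasing[of 1 p ?L] L pw(2) p by simp
        then show "?L ^ p \<le> (1/2) ^ k" using L pw(1) by linarith
      qed
      finally show ?thesis .
    qed
    have "(\<integral>\<^sup>+t. (\<Sum>k. ennreal (h k t) * indicator ?I t) \<partial>lebesgue) = (\<Sum>k. \<integral>\<^sup>+t\<in>?I. ennreal (h k t) \<partial>lebesgue)"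
      by (rule nn_integral_suminf[OF mh])
    also have "\<dots> \<le> (\<Sum>k. ennreal ((1/2) ^ k))" by (intro suminf_le le) auto
    also have "\<dots> = ennreal (\<Sum>k. (1/2) ^ k)" by (intro suminf_ennreal2) (auto intro: summable_geometric)
    also have "\<dots> < \<infinity>" by simp
    finally have "AE t in lebesgue. (\<Sum>k. ennreal (h k t) * indicator ?I t) \<noteq> \<infinity>"
      by (intro nn_integral_noteq_infinite borel_measurable_suminf_order mh) auto
    then show ?thesis
    proof eventually_elim
      case (elim t)
      show ?case
      proof
        assume t: "t \<in> ?I"
        then have "(\<Sum>k. ennreal (h k t)) \<noteq> top" using elim by simp
        then have "summable (\<lambda>k. h k t)" by (intro summable_suminf_not_top) (auto simp: h_def)
        then have "(\<lambda>k. h k t) \<longlonglongrightarrow> 0" by (rule summable_LIMSEQ_zero)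
        then have "(\<lambda>k. root p (h k t)) \<longlonglongrightarrow> root p 0" by (rule tendsto_real_root)
        then have "(\<lambda>k. norm (e (k + N) (t, \<zeta> i) - g (t, \<zeta> i))) \<longlonglongrightarrow> 0"
          using p by (simp add: h_def real_root_power_cancel)
        then have "(\<lambda>k. e (k + N) (t, \<zeta> i)) \<longlonglongrightarrow> g (t, \<zeta> i)"
          by (simp add: tendsto_norm_zero_iff Lim_null[symmetric])
        then show "(\<lambda>k. e k (t, \<zeta> i)) \<longlonglongrightarrow> g (t, \<zeta> i)" by (rule LIMSEQ_offset)
      qed
    qed
  qed
  then have "AE t in lebesgue. \<forall>i b. t \<in> {- (1 + real b)..1 + real b} \<longrightarrow> (\<lambda>k. e k (t, \<zeta> i)) \<longlonglongrightarrow> g (t, \<zeta> i)"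
    unfolding AE_all_countable by blast
  then have "AE t in lebesgue. \<forall>z\<in>Z. (\<lambda>k. e k (t, z)) \<longlonglongrightarrow> g (t, z)"
  proof eventually_elim
    case (elim t)
    obtain b where "\<bar>t\<bar> \<le> real b" using real_arch_simple by blast
    then have "t \<in> {- (1 + real b)..1 + real b}" by auto
    then have "(\<lambda>k. e k (t, \<zeta> i)) \<longlonglongrightarrow> g (t, \<zeta> i)" for i using elim by blast
    then show ?case using \<zeta> by blast
  qed
  then show ?thesis using e(1) by blast
qed

section \<open>Optimal bounds as countable suprema\<close>

lemma ennreal_le_on_closure:
  fixes h :: "'a::metric_space \<Rightarrow> real"
  assumes "continuous_on S h" "Z \<subseteq> S" "S \<subseteq> closure Z" "\<And>z. z \<in> Z \<Longrightarrow> ennreal (h z) \<le> M" "z \<in> S"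
  shows "ennreal (h z) \<le> M"
proof -
  obtain \<zeta> where \<zeta>: "\<And>n. \<zeta> n \<in> Z" "\<zeta> \<longlonglongrightarrow> z" using assms(3,5) closure_sequential by blast
  have "(\<lambda>n. h (\<zeta> n)) \<longlonglongrightarrow> h z"
    using assms(1,2,5) \<zeta> unfolding continuous_on_sequentially comp_def by blast
  then have "(\<lambda>n. ennreal (h (\<zeta> n))) \<longlonglongrightarrow> ennreal (h z)" by (rule tendsto_ennrealI)
  then show ?thesis by (rule LIMSEQ_le_const2) (use assms(4) \<zeta>(1) in blast)
qed

lemma LC_continuous_AE:
  assumes f: "f \<in> LC p" "0 < p"
  shows "AE t in lebesgue. continuous_on (cball 0 R) (\<lambda>z. f (t, z))"
proof -
  obtain k where k: "LC_bound p f R k" using ex_LC_bound f by blast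
  show ?thesis
    using LC_boundD(5)[OF k]
  proof eventually_elim
    case (elim t)
    have "(k t)-lipschitz_on (cball 0 R) (\<lambda>z. f (t, z))"
      using elim LC_boundD(2)[OF k] by (intro lipschitz_onI) (auto simp: dist_norm simp del: mem_cball)
    then show ?case by (rule lipschitz_on_continuous_on)
  qed
qed

text \<open>A dense set is dense in every open set, here the open ball, whose closure is the closed
  ball because the radius is positive; a ball of radius 0 might miss \<open>D\<close>.\<close>

lemma ball_subset_closure_dense:
  fixes D :: "'a::euclidean_space set"
  assumes "closure D = UNIV" "0 < r"
  shows "cball 0 r \<subseteq> closure (D \<inter> cball 0 r)"
proof -
  have "ball 0 r \<subseteq> closure (ball 0 r \<inter> D)"
    using open_Int_closure_subset[of "ball 0 r" D] assms(1) by auto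
  also have "\<dots> \<subseteq> closure (D \<inter> cball 0 r)" by (rule closure_mono) auto
  finally have "closure (ball 0 r) \<subseteq> closure (D \<inter> cball 0 r)" by (rule closure_minimal) simp
  then show ?thesis using assms(2) by simp
qed

text \<open>For almost every time \<open>f\<close> is continuous in the state, so a dense subset
  gives the same supremum. With a countable one the bound becomes measurable up to a null
  set.\<close>

lemma m_bound_AE:
  assumes f: "f \<in> LC p" "0 < p" and Z: "Z \<subseteq> cball 0 (real j)" "cball 0 (real j) \<subseteq> closure Z"
  shows "AE t in lebesgue. m_bound f j t = (SUP z\<in>Z. ennreal (norm (f (t, z))))"
  using LC_continuous_AE[OF f, of "real j"]
proof eventually_elim
  case (elim t)
  have "m_bound f j t \<le> (SUP z\<in>Z. ennreal (norm (f (t, z))))"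
    unfolding m_bound_def
  proof (rule SUP_least)
    fix z :: "(real ^ 'a) \<times> (real ^ 'a)" assume "z \<in> cball 0 (real j)"
    from continuous_on_norm[OF elim] Z _ this
    show "ennreal (norm (f (t, z))) \<le> (SUP z\<in>Z. ennreal (norm (f (t, z))))"
      by (rule ennreal_le_on_closure) (rule SUP_upper)
  qed
  moreover have "(SUP z\<in>Z. ennreal (norm (f (t, z)))) \<le> m_bound f j t"
    unfolding m_bound_def using Z(1) by (rule SUP_subset_mono) simp
  ultimately show ?case by (rule antisym)
qed

lemma set_nn_integral_split_le:
  assumes "G \<in> borel_measurable lebesgue"
  shows "(\<integral>\<^sup>+t\<in>{a..c::real}. G t \<partial>lebesgue) \<le> (\<integral>\<^sup>+t\<in>{a..b}. G t \<partial>lebesgue) + (\<integral>\<^sup>+t\<in>{b..c}. G t \<partial>lebesgue)"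
proof -
  have m: "(\<lambda>t. G t * indicator {u..v} t) \<in> borel_measurable lebesgue" for u v
    using assms by (intro borel_measurable_times_ennreal borel_measurable_indicator) simp_all
  have "(\<integral>\<^sup>+t\<in>{a..c}. G t \<partial>lebesgue) \<le> (\<integral>\<^sup>+t. G t * indicator {a..b} t + G t * indicator {b..c} t \<partial>lebesgue)"
    by (rule nn_integral_mono) (auto split: split_indicator)
  also have "\<dots> = (\<integral>\<^sup>+t\<in>{a..b}. G t \<partial>lebesgue) + (\<integral>\<^sup>+t\<in>{b..c}. G t \<partial>lebesgue)"
    by (rule nn_integral_add[OF m m])
  finally show ?thesis .
qed

lemma LC_const_measurable:
  fixes f :: "('n::finite) rhs"
  assumes "f \<in> LC p"
  shows "(\<lambda>t. f (t, z)) \<in> borel_measurable lebesgue"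
  by (rule LC_comp_measurable[OF assms continuous_on_const])

text \<open>Equicontinuity bounds the integral over a short interval by 1 uniformly on
  \<open>E\<close>; the number of pieces covering [-r,r] is the bound.\<close>

lemma m_bound_integrals_bounded:
  assumes E: "E \<subseteq> LC p" "0 < p" and eq: "L1_equicontinuous_m_bounds E" and "0 < r"
  shows "\<exists>N::nat. \<forall>f\<in>E. (\<integral>\<^sup>+t\<in>{-r..r}. m_bound f j t \<partial>lebesgue) \<le> ennreal (real N)"
proof -
  obtain \<delta> where \<delta>: "0 < \<delta>" "\<And>s t. - r \<le> s \<Longrightarrow> s \<le> t \<Longrightarrow> t \<le> r \<Longrightarrow> t - s < \<delta> \<Longrightarrow>
      (SUP f\<in>E. \<integral>\<^sup>+u\<in>{s..t}. m_bound f j u \<partial>lebesgue) < ennreal 1"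
    using eq[unfolded L1_equicontinuous_m_bounds_def, rule_format, OF \<open>0 < r\<close> zero_less_one, of j] by blast
  \<comment> \<open>Steps of \<delta>/2 because lengths strictly below \<delta> are required; the
    minimum makes the last grid point equal to \<open>r\<close>.\<close>
  define c where "c i = min r (- r + real i * (\<delta> / 2))" for i
  obtain N where N: "2 * r / (\<delta> / 2) \<le> real N" using real_arch_simple by blast
  then have "2 * r \<le> real N * (\<delta> / 2)" using \<delta>(1) by (simp add: pos_divide_le_eq)
  then have cN: "c N = r" unfolding c_def by linarith
  have "(\<integral>\<^sup>+t\<in>{-r..c i}. m_bound f j t \<partial>lebesgue) \<le> ennreal (real i)" if f: "f \<in> E" for f i
  proof -
    have fL: "f \<in> LC p" using f E by blast
    obtain Z :: "((real ^ 'a) \<times> (real ^ 'a)) set" where Z: "countable Z" "Z \<subseteq> cball 0 (real j)" "cball 0 (real j) \<subseteq> closure Z"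
      using separable by blast
    \<comment> \<open>A measurable stand-in for the optimal bound, since splitting the integral at a
      grid point needs measurability.\<close>
    define M where "M t = (SUP z\<in>Z. ennreal (norm (f (t, z))))" for t
    have Mm: "M \<in> borel_measurable lebesgue"
      unfolding M_def
    proof (rule borel_measurable_SUP[OF Z(1)])
      fix z
      note [measurable] = LC_const_measurable[OF fL, of z]
      show "(\<lambda>t. ennreal (norm (f (t, z)))) \<in> borel_measurable lebesgue" by measurable
    qed
    have eqM: "(\<integral>\<^sup>+t\<in>A. m_bound f j t \<partial>lebesgue) = (\<integral>\<^sup>+t\<in>A. M t \<partial>lebesgue)" for A
      unfolding M_def by (rule nn_set_integral_cong[OF m_bound_AE[OF fL E(2) Z(2,3)]])
    show ?thesis
    proof (induction i)
      case 0
      have "c 0 = - r" using \<open>0 < r\<close> by (simp add: c_def)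
      have "(\<integral>\<^sup>+t\<in>{-r..c 0}. m_bound f j t \<partial>lebesgue) = (\<integral>\<^sup>+t. 0 \<partial>(lebesgue :: real measure))"
      proof (rule nn_integral_cong_AE)
        show "AE t in lebesgue. m_bound f j t * indicator {-r..c 0} t = 0"
          using AE_not_eq[of "- r"] by eventually_elim (auto simp: \<open>c 0 = - r\<close> split: split_indicator)
      qed
      then show ?case by simp
    next
      case (Suc i)
      have "(\<integral>\<^sup>+t\<in>{c i..c (Suc i)}. m_bound f j t \<partial>lebesgue) \<le> (SUP f\<in>E. \<integral>\<^sup>+u\<in>{c i..c (Suc i)}. m_bound f j u \<partial>lebesgue)"
        using f by (rule SUP_upper)
      also have "\<dots> < ennreal 1"
      proof (rule \<delta>(2))
        have step: "real (Suc i) * (\<delta> / 2) = real i * (\<delta> / 2) + \<delta> / 2" by (simp add: algebra_simps)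
        have "0 \<le> real i * (\<delta> / 2)" using \<delta>(1) by simp
        then show "- r \<le> c i" using \<open>0 < r\<close> unfolding c_def by linarith
        show "c i \<le> c (Suc i)" "c (Suc i) - c i < \<delta>" "c (Suc i) \<le> r"
          using \<delta>(1) unfolding c_def step by (auto simp: min_def)
      qed
      finally have "(\<integral>\<^sup>+t\<in>{c i..c (Suc i)}. m_bound f j t \<partial>lebesgue) \<le> ennreal 1" by (rule less_imp_le)
      then have "(\<integral>\<^sup>+t\<in>{-r..c i}. M t \<partial>lebesgue) + (\<integral>\<^sup>+t\<in>{c i..c (Suc i)}. M t \<partial>lebesgue)
          \<le> ennreal (real i) + ennreal 1"
        using Suc unfolding eqM by (intro add_mono)
      also have "\<dots> = ennreal (real i + 1)" by (rule ennreal_plus[symmetric]) simp_all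
      also have "real i + 1 = real (Suc i)" by simp
      finally show ?case
        unfolding eqM using set_nn_integral_split_le[OF Mm] by (rule order_trans[rotated])
    qed
  qed
  from this[of _ N] show ?thesis unfolding cN by blast
qed

section \<open>The modulus theta and trajectories in the sets K\<close>

context
  fixes p :: nat and E :: "('n::finite) rhs set"
  assumes p: "0 < p" and E: "E \<subseteq> LC p" and eq: "L1_equicontinuous_m_bounds E"
begin

text \<open>Without finiteness \<open>enn2real\<close> would turn the supremum into 0, and
  \<open>theta\<close> would bound nothing.\<close>

lemma theta_SUP_finite:
  "(SUP t\<in>{a..b}. SUP f\<in>E. \<integral>\<^sup>+u\<in>{t..t + s}. m_bound f j u \<partial>lebesgue) < \<infinity>"
proof -
  define r where "r = \<bar>a\<bar> + \<bar>b\<bar> + \<bar>s\<bar> + 1"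
  have "0 < r" by (simp add: r_def)
  then obtain N :: nat where N: "\<And>f. f \<in> E \<Longrightarrow> (\<integral>\<^sup>+t\<in>{-r..r}. m_bound f j t \<partial>lebesgue) \<le> ennreal (real N)"
    using m_bound_integrals_bounded[OF E p eq] by blast
  have "(\<integral>\<^sup>+u\<in>{t..t + s}. m_bound f j u \<partial>lebesgue) \<le> ennreal (real N)" if "t \<in> {a..b}" "f \<in> E" for t f
  proof -
    have "{t..t + s} \<subseteq> {-r..r}" using that(1) by (auto simp: r_def)
    from order_trans[OF nn_set_integral_set_mono[OF this] N[OF that(2)]] show ?thesis .
  qed
  then have "(SUP t\<in>{a..b}. SUP f\<in>E. \<integral>\<^sup>+u\<in>{t..t + s}. m_bound f j u \<partial>lebesgue) \<le> ennreal (real N)"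
    by (intro SUP_least)
  then show ?thesis by (rule le_less_trans) simp
qed

lemma theta_ge:
  assumes "f \<in> E" "t \<in> {a..b}"
  shows "(\<integral>\<^sup>+u\<in>{t..t + s}. m_bound f j u \<partial>lebesgue) \<le> ennreal (theta E a b j s)"
proof -
  have "(\<integral>\<^sup>+u\<in>{t..t + s}. m_bound f j u \<partial>lebesgue)
      \<le> (SUP t\<in>{a..b}. SUP f\<in>E. \<integral>\<^sup>+u\<in>{t..t + s}. m_bound f j u \<partial>lebesgue)"
    by (rule SUP_upper2[OF assms(2) SUP_upper[OF assms(1)]])
  then show ?thesis using theta_SUP_finite by (simp add: theta_def)
qed

lemma theta_mono:
  assumes "s \<le> s'"
  shows "theta E a b j s \<le> theta E a b j s'"
  unfolding theta_def
proof (rule enn2real_mono)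
  show "(SUP t\<in>{a..b}. SUP f\<in>E. \<integral>\<^sup>+u\<in>{t..t + s}. m_bound f j u \<partial>lebesgue)
      \<le> (SUP t\<in>{a..b}. SUP f\<in>E. \<integral>\<^sup>+u\<in>{t..t + s'}. m_bound f j u \<partial>lebesgue)"
    by (intro SUP_mono' nn_set_integral_set_mono) (use assms in auto)
qed (use theta_SUP_finite in simp)

lemma closure_theta:
  assumes e: "\<And>k. e k \<in> E" "AE t in lebesgue. \<forall>z\<in>Z. (\<lambda>k. e k (t, z)) \<longlonglongrightarrow> g (t, z)"
    and Z: "countable Z" "Z \<subseteq> cball 0 (real j)" and t: "t \<in> {a..b}"
  shows "(\<integral>\<^sup>+u\<in>{t..t + s}. (SUP z\<in>Z. ennreal (norm (g (u, z)))) \<partial>lebesgue) \<le> ennreal (theta E a b j s)"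
proof (rule fatou_SUP[OF Z(1), of _ "\<lambda>k z u. norm (e k (u, z))"])
  show "(\<lambda>u. norm (e k (u, z))) \<in> borel_measurable lebesgue" for k z
  proof -
    have "e k \<in> LC p" using e(1)[of k] E by blast
    note [measurable] = LC_const_measurable[OF this, of z]
    show ?thesis by measurable
  qed
  show "AE u in lebesgue. \<forall>z\<in>Z. (\<lambda>k. norm (e k (u, z))) \<longlonglongrightarrow> norm (g (u, z))"
    using e(2) by (rule eventually_mono) (intro ballI tendsto_norm, blast)
  show "(\<integral>\<^sup>+u\<in>{t..t + s}. (SUP z\<in>Z. ennreal (norm (e k (u, z)))) \<partial>lebesgue) \<le> ennreal (theta E a b j s)" for k
  proof -
    have "(\<integral>\<^sup>+u\<in>{t..t + s}. (SUP z\<in>Z. ennreal (norm (e k (u, z)))) \<partial>lebesgue)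
        \<le> (\<integral>\<^sup>+u\<in>{t..t + s}. m_bound (e k) j u \<partial>lebesgue)"
      unfolding m_bound_def by (intro set_nn_integral_mono_AE AE_I2 impI SUP_subset_mono Z(2) order_refl)
    also have "\<dots> \<le> ennreal (theta E a b j s)" by (rule theta_ge[OF e(1) t])
    finally show ?thesis .
  qed
qed simp

text \<open>An increment of the solution is at most the integral of the optimal bound of
  \<open>g\<close>, which inherits the modulus of \<open>E\<close>. The radius is \<open>j\<close>
  \<ge> 2R because that bound is taken over pairs of states.\<close>

lemma clip_in_Kset:
  fixes g :: "'n rhs"
  assumes e: "\<And>k. e k \<in> E" "AE t in lebesgue. \<forall>z\<in>Z. (\<lambda>k. e k (t, z)) \<longlonglongrightarrow> g (t, z)"
    and Z: "countable Z" "Z \<subseteq> cball 0 (real j)" "cball 0 (real j) \<subseteq> closure Z"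
    and g: "g \<in> LC p" and x: "dde_upto g \<phi> S x" and S: "0 \<le> S" "S \<le> b"
    and R: "\<And>t. t \<in> {-1..S} \<Longrightarrow> norm (x t) \<le> R" "2 * R \<le> real j"
  shows "clip S x \<in> Kset (theta E) 0 b j"
proof -
  have inc: "norm (x t - x s) \<le> theta E 0 b j (t - s)" if st: "0 \<le> s" "s \<le> t" "t \<le> S" for s t
  proof -
    let ?F = "\<lambda>u. g (u, x u, x (u - 1))"
    have F: "?F absolutely_integrable_on {s..t}" by (rule dde_upto_diff(2)[OF x st])
    have "norm (x t - x s) \<le> integral {s..t} (\<lambda>u. norm (?F u))"
      unfolding dde_upto_diff(1)[OF x st]
      using set_integrable_norm[OF F] by (intro norm_integral_le_AE[OF F]) auto
    then have "ennreal (norm (x t - x s)) \<le> (\<integral>\<^sup>+u\<in>{s..t}. ennreal (norm (?F u)) \<partial>lebesgue)"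
      unfolding nn_integral_absolutely_integrable[OF F] by (rule ennreal_leI)
    also have "\<dots> \<le> (\<integral>\<^sup>+u\<in>{s..t}. (SUP z\<in>Z. ennreal (norm (g (u, z)))) \<partial>lebesgue)"
    proof (rule set_nn_integral_mono_AE)
      show "AE u in lebesgue. u \<in> {s..t} \<longrightarrow> ennreal (norm (?F u)) \<le> (SUP z\<in>Z. ennreal (norm (g (u, z))))"
        using m_bound_AE[OF g p Z(2,3)]
      proof eventually_elim
        case (elim u)
        show ?case
        proof
          assume u: "u \<in> {s..t}"
          have "(x u, x (u - 1)) \<in> cball 0 (real j)"
            by (rule pair_mem_cball[of _ R _ R]) (use R u st in auto)
          then show "ennreal (norm (?F u)) \<le> (SUP z\<in>Z. ennreal (norm (g (u, z))))"
            unfolding elim[symmetric] m_bound_def by (rule SUP_upper)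
        qed
      qed
    qed
    also have "\<dots> \<le> ennreal (theta E 0 b j (t - s))"
      using closure_theta[OF e Z(1,2), of s 0 b "t - s"] st S by simp
    finally show ?thesis
      by (subst (asm) ennreal_le_iff) (simp_all add: theta_def)
  qed
  have "norm (clip S x t - clip S x s) \<le> theta E 0 b j \<bar>t - s\<bar>" if "t \<in> {0..b}" "s \<in> {0..b}" for s t
    using that
  proof (induction s t rule: linorder_wlog)
    case (le s t)
    \<comment> \<open>Beyond \<open>S\<close> the clipped function is constant, so its increment is
      one over a shorter interval; monotonicity of \<open>theta\<close> does the rest.\<close>
    have "norm (x (min t S) - x (min s S)) \<le> theta E 0 b j (min t S - min s S)"
      using le S by (intro inc) auto
    also have "\<dots> \<le> theta E 0 b j \<bar>t - s\<bar>" using le by (intro theta_mono) auto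
    finally show ?case using le S by (simp add: clip_def max_absorb2)
  next
    case (sym s t)
    then show ?case by (simp add: norm_minus_commute abs_minus_commute)
  qed
  moreover have "continuous_on {0..b} (clip S x)"
    using x S by (intro continuous_on_clip) (auto simp: dde_upto_def)
  moreover have "norm (clip S x t) \<le> real j" for t
  proof -
    have "norm (clip S x t) \<le> R" by (rule norm_clip_le) (use R S in auto)
    moreover have "0 \<le> R" using order_trans[OF norm_ge_zero R(1)[of 0]] S by simp
    ultimately show ?thesis using R(2) by linarith
  qed
  ultimately show ?thesis by (auto simp: Kset_def)
qed

end

text \<open>Constants make the sets K nonempty and let the seminorms control evaluation at fixed
  points.\<close>

lemma const_in_Kset:
  assumes "norm c \<le> real j" "\<And>s. 0 \<le> \<theta> a b j s"
  shows "(\<lambda>_. c) \<in> Kset \<theta> a b j"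
  using assms by (auto simp: Kset_def)

text \<open>Fatou's lemma for difference quotients over a countable set \<open>I\<close> of pairs,
  followed by continuity to reach \<open>W\<close>. The choice of \<open>I\<close> and
  \<open>W\<close> covers both full Lipschitz bounds and those in the delayed variable
  alone.\<close>

lemma closure_lipschitz:
  fixes g :: "('n::finite) rhs"
  assumes p: "0 < p" and E: "E \<subseteq> LC p" and g: "g \<in> LC p"
    and e: "\<And>k. e k \<in> E" "AE t in lebesgue. \<forall>z\<in>Z. (\<lambda>k. e k (t, z)) \<longlonglongrightarrow> g (t, z)"
    and I: "countable I" "I \<subseteq> Z \<times> Z" "I \<subseteq> cball 0 J \<times> cball 0 J" "\<And>z1 z2. (z1, z2) \<in> I \<Longrightarrow> z1 \<noteq> z2"
    and bound: "\<And>f. f \<in> E \<Longrightarrow> (\<integral>\<^sup>+t\<in>{0..T}. (SUP (z1, z2)\<in>I.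
        ennreal ((norm (f (t, z1) - f (t, z2)) / norm (z1 - z2)) ^ p)) \<partial>lebesgue) \<le> ennreal C"
    and W: "W \<subseteq> cball 0 J \<times> cball 0 J" "\<And>z1 z2. (z1, z2) \<in> W \<Longrightarrow> z1 \<noteq> z2 \<Longrightarrow> (z1, z2) \<in> closure I"
  shows "\<exists>L. Lp_le p T C L \<and>
    (AE t in lebesgue. t \<in> {0..T} \<longrightarrow> (\<forall>(z1, z2)\<in>W. norm (g (t, z1) - g (t, z2)) \<le> L t * norm (z1 - z2)))"
proof -
  define q where "q f i t = (norm (f (t, fst i) - f (t, snd i)) / norm (fst i - snd i)) ^ p"
    for f :: "'n rhs" and i t
  define S where "S t = (SUP i\<in>I. ennreal (q g i t))" for t
  have mq: "q f i \<in> borel_measurable lebesgue" if "f \<in> LC p" for f i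
  proof -
    note [measurable] = LC_const_measurable[OF that]
    show ?thesis unfolding q_def by measurable
  qed
  have Sm: "S \<in> borel_measurable lebesgue"
    unfolding S_def by (intro borel_measurable_SUP[OF I(1)] measurable_compose[OF _ measurable_ennreal] mq[OF g])
  have SC: "(\<integral>\<^sup>+t\<in>{0..T}. S t \<partial>lebesgue) \<le> ennreal C"
    unfolding S_def
  proof (rule fatou_SUP[OF I(1), of _ "\<lambda>k. q (e k)"])
    show "q (e k) i \<in> borel_measurable lebesgue" for k i using e(1) E by (intro mq) auto
    show "AE t in lebesgue. \<forall>i\<in>I. (\<lambda>k. q (e k) i t) \<longlonglongrightarrow> q g i t"
      using e(2)
    proof eventually_elim
      case (elim t)
      show ?case
      proof
        fix i assume i: "i \<in> I"
        then have "fst i \<in> Z" "snd i \<in> Z" "fst i \<noteq> snd i" using I(2,4) by (auto simp: prod_eq_iff)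
        then show "(\<lambda>k. q (e k) i t) \<longlonglongrightarrow> q g i t"
          unfolding q_def using elim by (intro tendsto_intros) auto
      qed
    qed
    show "(\<integral>\<^sup>+t\<in>{0..T}. (SUP i\<in>I. ennreal (q (e k) i t)) \<partial>lebesgue) \<le> ennreal C" for k
      using bound[OF e(1)] by (simp add: q_def case_prod_beta)
  qed simp
  have "(\<lambda>t. S t * indicator {0..T} t) \<in> borel_measurable lebesgue"
    using Sm by (intro borel_measurable_times_ennreal borel_measurable_indicator) simp_all
  then have fin: "AE t in lebesgue. S t * indicator {0..T} t \<noteq> \<infinity>"
    by (rule nn_integral_noteq_infinite) (use SC in \<open>auto simp: top_unique\<close>)
  \<comment> \<open>Where the supremum is infinite this yields 0, which is no Lipschitz constant;
    \<open>fin\<close> confines such times in [0,T] to a null set.\<close>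
  define L where "L t = root p (enn2real (S t))" for t
  have L0: "0 \<le> L t" for t by (simp add: L_def real_root_ge_zero)
  have Lp: "L t ^ p = enn2real (S t)" for t using p by (simp add: L_def)
  have "root p \<in> borel_measurable borel"
    by (intro borel_measurable_continuous_onI continuous_intros)
  then have "L \<in> borel_measurable lebesgue"
    unfolding L_def using Sm by measurable
  moreover have "(\<integral>\<^sup>+t\<in>{0..T}. ennreal (L t ^ p) \<partial>lebesgue) \<le> ennreal C"
  proof (rule order_trans[OF _ SC])
    have "ennreal (enn2real (S t)) \<le> S t" for t by (cases "S t") auto
    then show "(\<integral>\<^sup>+t\<in>{0..T}. ennreal (L t ^ p) \<partial>lebesgue) \<le> (\<integral>\<^sup>+t\<in>{0..T}. S t \<partial>lebesgue)"
      unfolding Lp by (intro set_nn_integral_mono_AE AE_I2 impI)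
  qed
  moreover have "AE t in lebesgue. t \<in> {0..T} \<longrightarrow> (\<forall>(z1, z2)\<in>W. norm (g (t, z1) - g (t, z2)) \<le> L t * norm (z1 - z2))"
    using fin LC_continuous_AE[OF g p, of J]
  proof eventually_elim
    case (elim t)
    show ?case
    proof (intro impI ballI, clarify)
      fix z1 z2 assume t: "t \<in> {0..T}" and z: "(z1, z2) \<in> W"
      have St: "ennreal (L t ^ p) = S t" using elim(1) t unfolding Lp by (cases "S t") auto
      have onI: "norm (g (t, fst i) - g (t, snd i)) \<le> L t * norm (fst i - snd i)" if "i \<in> I" for i
      proof -
        have "ennreal (q g i t) \<le> ennreal (L t ^ p)" unfolding St S_def using that by (rule SUP_upper)
        then have "(norm (g (t, fst i) - g (t, snd i)) / norm (fst i - snd i)) ^ p \<le> L t ^ p"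
          using L0 by (simp add: q_def)
        then have "norm (g (t, fst i) - g (t, snd i)) / norm (fst i - snd i) \<le> L t"
          using p L0 by (simp add: power_mono_iff)
        moreover have "fst i \<noteq> snd i" using I(4)[of "fst i" "snd i"] that by simp
        ultimately show ?thesis by (simp add: pos_divide_le_eq)
      qed
      show "norm (g (t, z1) - g (t, z2)) \<le> L t * norm (z1 - z2)"
      proof (cases "z1 = z2")
        case False
        \<comment> \<open>Both sides of the inequality are continuous along pairs from
          \<open>I\<close> converging to the given pair.\<close>
        then obtain \<zeta> where \<zeta>: "\<And>n. \<zeta> n \<in> I" "\<zeta> \<longlonglongrightarrow> (z1, z2)" using W(2)[OF z] closure_sequential by blast
        have l: "(\<lambda>n. fst (\<zeta> n)) \<longlonglongrightarrow> z1" "(\<lambda>n. snd (\<zeta> n)) \<longlonglongrightarrow> z2"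
          using tendsto_fst[OF \<zeta>(2)] tendsto_snd[OF \<zeta>(2)] by auto
        have mem: "fst (\<zeta> n) \<in> cball 0 J" "snd (\<zeta> n) \<in> cball 0 J" for n using \<zeta>(1)[of n] I(3) by auto
        have zm: "z1 \<in> cball 0 J" "z2 \<in> cball 0 J" using W(1) z by auto
        have "(\<lambda>n. g (t, \<xi> n)) \<longlonglongrightarrow> g (t, z)"
          if "\<And>n. \<xi> n \<in> cball 0 J" "z \<in> cball 0 J" "\<xi> \<longlonglongrightarrow> z" for \<xi> z
          using elim(2) that unfolding continuous_on_sequentially comp_def by blast
        from this[OF mem(1) zm(1) l(1)] this[OF mem(2) zm(2) l(2)] have "(\<lambda>n. norm (g (t, fst (\<zeta> n)) - g (t, snd (\<zeta> n)))) \<longlonglongrightarrow> norm (g (t, z1) - g (t, z2))"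
          by (intro tendsto_intros)
        moreover have "(\<lambda>n. L t * norm (fst (\<zeta> n) - snd (\<zeta> n))) \<longlonglongrightarrow> L t * norm (z1 - z2)"
          using l by (intro tendsto_intros)
        ultimately show ?thesis by (rule LIMSEQ_le) (use onI \<zeta>(1) in blast)
      qed simp
    qed
  qed
  ultimately show ?thesis using L0 unfolding Lp_le_def by blast
qed

lemma topspace_seminorm_topology_subset: "topspace (seminorm_topology V P) \<subseteq> V"
  by (auto simp: seminorm_topology_def)

lemma closure_of_seminorm_topology_subset: "seminorm_topology V P closure_of E \<subseteq> V"
  using closure_of_subset_topspace topspace_seminorm_topology_subset by (rule order_trans)

lemma fun_diff_self: "(f :: 'a \<Rightarrow> 'b::ab_group_add) - f = (\<lambda>_. 0)"
  by (simp add: fun_diff_def)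

text \<open>The common interface to the three topologies: it is enough that for each point and each
  large interval some seminorm dominates the evaluation there.\<close>

lemma closure_sequence_of_seminorms:
  fixes g :: "('n::finite) rhs"
  assumes p: "0 < p" and E: "E \<subseteq> LC p" and g: "g \<in> seminorm_topology (LC p) P closure_of E"
    and Z: "countable Z" "Z \<noteq> {}"
    and dom: "\<And>z b. z \<in> Z \<Longrightarrow> \<exists>\<rho>\<in>P. \<rho> (\<lambda>_. 0) = 0 \<and>
      (\<forall>h\<in>LC p. Lp_norm p {- (1 + real b)..1 + real b} (\<lambda>t. h (t, z)) \<le> \<rho> h)"
  shows "\<exists>e::nat \<Rightarrow> 'n rhs. (\<forall>k. e k \<in> E) \<and> (AE t in lebesgue. \<forall>z\<in>Z. (\<lambda>k. e k (t, z)) \<longlonglongrightarrow> g (t, z))"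
proof (rule closure_sequence[OF p E _ Z(1) _ Z(2)])
  show gL: "g \<in> LC p" using g closure_of_seminorm_topology_subset by blast
  fix F :: "((real ^ 'n) \<times> (real ^ 'n)) set" and b :: nat and \<epsilon> :: real
  assume F: "finite F" "F \<noteq> {}" "F \<subseteq> Z" and "0 < \<epsilon>"
  have "\<forall>z\<in>F. \<exists>\<rho>. \<rho> \<in> P \<and> \<rho> (\<lambda>_. 0) = 0 \<and>
      (\<forall>h\<in>LC p. Lp_norm p {- (1 + real b)..1 + real b} (\<lambda>t. h (t, z)) \<le> \<rho> h)"
    using dom F(3) by blast
  then obtain \<rho> where \<rho>: "\<forall>z\<in>F. \<rho> z \<in> P \<and> \<rho> z (\<lambda>_. 0) = 0 \<and>
      (\<forall>h\<in>LC p. Lp_norm p {- (1 + real b)..1 + real b} (\<lambda>t. h (t, z)) \<le> \<rho> z h)"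
    by (rule bchoice[THEN exE])
  have "\<exists>e\<in>E. e \<in> LC p \<and> (\<forall>\<rho>\<in>\<rho> ` F. \<rho> (e - g) < \<epsilon>)"
    by (rule closure_seminorm_topology(2)[OF g _ _ _ _ \<open>0 < \<epsilon>\<close>]) (use F \<rho> in \<open>auto simp: fun_diff_self\<close>)
  then obtain e where e: "e \<in> E" "e \<in> LC p" "\<And>z. z \<in> F \<Longrightarrow> \<rho> z (e - g) < \<epsilon>" by blast
  have "Lp_norm p {- (1 + real b)..1 + real b} (\<lambda>t. (e - g) (t, z)) < \<epsilon>" if "z \<in> F" for z
    using \<rho> that e(3)[OF that] LC_diff[OF e(2) gL p] by (meson le_less_trans)
  then show "\<exists>e\<in>E. \<forall>z\<in>F. Lp_norm p {- (1 + real b)..1 + real b} (\<lambda>t. (e - g) (t, z)) < \<epsilon>"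
    using e(1) by blast
qed

lemma Lp_norm_le_SUP:
  assumes f: "f \<in> LC p" "0 < p"
    and w: "\<And>k. k \<in> K \<Longrightarrow> continuous_on {a..b} (w k)" "\<And>k t. k \<in> K \<Longrightarrow> t \<in> {a..b} \<Longrightarrow> norm (w k t) \<le> R"
    and "k \<in> K"
  shows "Lp_norm p {a..b} (\<lambda>t. f (t, w k t)) \<le> (SUP k\<in>K. Lp_norm p {a..b} (\<lambda>t. f (t, w k t)))"
proof (rule cSUP_upper[OF \<open>k \<in> K\<close>])
  obtain B where "\<forall>w. continuous_on {a..b} w \<and> (\<forall>t\<in>{a..b}. norm (w t) \<le> R) \<longrightarrow>
      Lp_norm p {a..b} (\<lambda>t. f (t, w t)) \<le> B" using LC_Lp_norm_bound[OF f] by blast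
  then show "bdd_above ((\<lambda>k. Lp_norm p {a..b} (\<lambda>t. f (t, w k t))) ` K)"
    using w by (intro bdd_aboveI2[of _ _ B]) blast
qed

section \<open>The seminorms with suprema over the sets K\<close>

definition rho_TT :: "nat \<Rightarrow> moduli \<Rightarrow> moduli \<Rightarrow> real \<Rightarrow> real \<Rightarrow> nat \<Rightarrow> ('n::finite) rhs \<Rightarrow> real" where
  "rho_TT p \<theta> \<theta>' a b j f = (SUP (x, u)\<in>Kset \<theta> a b j \<times> Kset \<theta>' (a - 1) (b - 1) j.
      Lp_norm p {a..b} (\<lambda>t. f (t, x t, u (t - 1))))"

definition rho_TD :: "nat \<Rightarrow> moduli \<Rightarrow> real \<Rightarrow> real \<Rightarrow> nat \<Rightarrow> real^'n \<Rightarrow> ('n::finite) rhs \<Rightarrow> real" where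
  "rho_TD p \<theta> a b j u f = (SUP x\<in>Kset \<theta> a b j. Lp_norm p {a..b} (\<lambda>t. f (t, x t, u)))"

lemma T_Theta_Theta_eq:
  "T_Theta_Theta p \<theta> \<theta>' = seminorm_topology (LC p) {rho_TT p \<theta> \<theta>' a b j | a b j. a \<in> \<rat> \<and> b \<in> \<rat> \<and> a < b}"
  by (simp add: T_Theta_Theta_def rho_TT_def[abs_def])

lemma T_Theta_D_eq:
  "T_Theta_D p \<theta> D' = seminorm_topology (LC p) {rho_TD p \<theta> a b j u | a b j u. a \<in> \<rat> \<and> b \<in> \<rat> \<and> a < b \<and> u \<in> D'}"
  by (simp add: T_Theta_D_def rho_TD_def[abs_def])

lemma Lp_norm_le_rho_TT:
  assumes f: "f \<in> LC p" "0 < p" and x: "x \<in> Kset \<theta> a b j" and u: "u \<in> Kset \<theta>' (a - 1) (b - 1) j"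
  shows "Lp_norm p {a..b} (\<lambda>t. f (t, x t, u (t - 1))) \<le> rho_TT p \<theta> \<theta>' a b j f"
proof -
  have "Lp_norm p {a..b} (\<lambda>t. f (t, fst (x, u) t, snd (x, u) (t - 1)))
      \<le> (SUP k\<in>Kset \<theta> a b j \<times> Kset \<theta>' (a - 1) (b - 1) j. Lp_norm p {a..b} (\<lambda>t. f (t, fst k t, snd k (t - 1))))"
  proof (rule Lp_norm_le_SUP[OF f, where w = "\<lambda>k t. (fst k t, snd k (t - 1))" and R = "2 * real j"])
    fix k :: "(real \<Rightarrow> real^'a) \<times> (real \<Rightarrow> real^'a)"
    assume k: "k \<in> Kset \<theta> a b j \<times> Kset \<theta>' (a - 1) (b - 1) j"
    then have c: "continuous_on {a..b} (fst k)" "continuous_on {a - 1..b - 1} (snd k)"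
      by (auto simp: Kset_def)
    show "continuous_on {a..b} (\<lambda>t. (fst k t, snd k (t - 1)))"
      by (intro continuous_on_Pair c(1) continuous_on_compose2[OF c(2)] continuous_intros) auto
    fix t assume t: "t \<in> {a..b}"
    have "norm (fst k t) \<le> real j" "norm (snd k (t - 1)) \<le> real j"
      using k t by (auto simp: Kset_def image_subset_iff)
    then show "norm (fst k t, snd k (t - 1)) \<le> 2 * real j"
      using norm_Pair_le[of "fst k t" "snd k (t - 1)"] by linarith
  qed (use x u in auto)
  then show ?thesis by (simp add: rho_TT_def case_prod_beta)
qed

lemma Lp_norm_le_rho_TD:
  assumes f: "f \<in> LC p" "0 < p" and x: "x \<in> Kset \<theta> a b j"
  shows "Lp_norm p {a..b} (\<lambda>t. f (t, x t, u)) \<le> rho_TD p \<theta> a b j u f"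
  unfolding rho_TD_def
proof (rule Lp_norm_le_SUP[OF f, where w = "\<lambda>x t. (x t, u)" and R = "real j + norm u"])
  fix x :: "real \<Rightarrow> real^'a" assume x: "x \<in> Kset \<theta> a b j"
  then show "continuous_on {a..b} (\<lambda>t. (x t, u))"
    by (intro continuous_on_Pair continuous_on_const) (simp add: Kset_def)
  fix t assume "t \<in> {a..b}"
  then have "norm (x t) \<le> real j" using x by (auto simp: Kset_def image_subset_iff)
  then show "norm (x t, u) \<le> real j + norm u" using norm_Pair_le[of "x t" u] by linarith
qed fact

text \<open>The supremum of a constant has the expected value only over a nonempty set; constant
  functions provide the members.\<close>

lemma rho_TT_zero:
  assumes "0 < p" "\<And>s. 0 \<le> \<theta> a b j s" "\<And>s. 0 \<le> \<theta>' (a - 1) (b - 1) j s"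
  shows "rho_TT p \<theta> \<theta>' a b j (\<lambda>_. 0) = 0"
proof -
  have "(\<lambda>_. 0) \<in> Kset \<theta> a b j" "(\<lambda>_. 0) \<in> Kset \<theta>' (a - 1) (b - 1) j"
    using assms by (auto intro: const_in_Kset)
  then have "Kset \<theta> a b j \<times> Kset \<theta>' (a - 1) (b - 1) j \<noteq> {}" by blast
  then show ?thesis
    unfolding rho_TT_def case_prod_beta Lp_norm_zero[OF assms(1)] by (rule cSUP_const)
qed

lemma rho_TD_zero:
  assumes "0 < p" "\<And>s. 0 \<le> \<theta> a b j s"
  shows "rho_TD p \<theta> a b j u (\<lambda>_. 0) = 0"
proof -
  have "(\<lambda>_. 0) \<in> Kset \<theta> a b j" using assms by (auto intro: const_in_Kset)
  then have "Kset \<theta> a b j \<noteq> {}" by blast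
  then show ?thesis unfolding rho_TD_def Lp_norm_zero[OF assms(1)] by (rule cSUP_const)
qed

lemma theta_nonneg: "0 \<le> theta E a b j s"
  by (simp add: theta_def)

lemma theta_hat_nonneg: "0 \<le> theta_hat p E a b j s"
  by (simp add: theta_hat_def theta_nonneg max.coboundedI1)

text \<open>\<open>perturbation\<close> is requested for every continuous curve \<open>y\<close> in
  the ball, so of the limit trajectory only continuity and size enter the three
  verifications.\<close>

lemma continuous_dependence_of_perturbation:
  fixes E :: "('n::finite) rhs set"
  assumes p: "0 < p" and X: "X = seminorm_topology (LC p) P"
    and pert: "\<And>fs f \<phi>s y T R. (\<And>n. fs n \<in> X closure_of E) \<Longrightarrow> f \<in> LC p \<Longrightarrow>
      limitin (subtopology X (X closure_of E)) fs f sequentially \<Longrightarrow> 0 \<le> T \<Longrightarrow>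
      continuous_on {-1..T} y \<Longrightarrow> (\<And>t. t \<in> {-1..T} \<Longrightarrow> norm (y t) \<le> R) \<Longrightarrow> perturbation p T R fs \<phi>s f y"
  shows "continuous_dependence p X E"
  unfolding continuous_dependence_def
proof (intro allI impI)
  fix fs f \<phi>s \<phi> T
  assume A: "(\<forall>n. fs n \<in> X closure_of E) \<and> limitin (subtopology X (X closure_of E)) fs f sequentially \<and>
        (\<forall>n. \<phi>s n \<in> C1p p {-1..0}) \<and> \<phi> \<in> C1p p {-1..0} \<and> uniform_limit {-1..0} \<phi>s \<phi> sequentially"
    and T: "-1 \<le> T" "ereal T < dde_end f \<phi>"
  have lim: "limitin (subtopology X (X closure_of E)) fs f sequentially" using A by blast
  then have "f \<in> X closure_of E" by (simp add: limitin_subtopology)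
  then have f: "f \<in> LC p" using closure_of_seminorm_topology_subset[of "LC p" P E] X by blast
  have fs: "fs n \<in> LC p" for n using A closure_of_seminorm_topology_subset[of "LC p" P E] X by blast
  have c\<phi>: "continuous_on {-1..0} \<phi>" using A by (simp add: C1p_def)
  show "solutions_converge p T fs \<phi>s f \<phi> \<and>
    ((\<lambda>n. C1p_norm p {-1..0} (\<lambda>t. \<phi>s n t - \<phi> t)) \<longlonglongrightarrow> 0 \<longrightarrow> solutions_converge_C1p p T fs \<phi>s f \<phi>)"
  proof (rule solutions_converge_of_perturbation[OF p fs f _ _ _ T])
    fix R assume R: "0 \<le> T" "\<And>t. t \<in> {-1..T} \<Longrightarrow> norm (dde_sol f \<phi> t) \<le> R"
    show "perturbation p T R fs \<phi>s f (dde_sol f \<phi>)"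
      by (rule pert[OF _ f lim R(1) dde_sol_continuous[OF f p c\<phi> T(2)] R(2)]) (use A in blast)
  qed (use A in blast)+
qed

section \<open>Finite nets along a trajectory and their error terms\<close>

text \<open>A finite subcover of the compact image by balls centred in \<open>D\<close>. Centres far
  from the curve are discarded, so that the net stays bounded along with the curve.\<close>

lemma finite_net:
  fixes w :: "real \<Rightarrow> 'a::real_normed_vector"
  assumes w: "continuous_on {a..b} w" and D: "closure D = UNIV" and "0 < \<delta>"
  obtains F where "finite F" "F \<subseteq> D" "\<And>t. t \<in> {a..b} \<Longrightarrow> \<exists>z\<in>F. norm (w t - z) \<le> \<delta>"
    "\<And>z. z \<in> F \<Longrightarrow> \<exists>t\<in>{a..b}. norm (w t - z) \<le> \<delta>"
proof -
  have c: "compact (w ` {a..b})" using w by (intro compact_continuous_image) auto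
  have cover: "w ` {a..b} \<subseteq> (\<Union>d\<in>D. ball d \<delta>)"
  proof
    fix v assume "v \<in> w ` {a..b}"
    have "v \<in> closure D" using D by simp
    then obtain d where "d \<in> D" "dist d v < \<delta>" using \<open>0 < \<delta>\<close> unfolding closure_approachable by blast
    then show "v \<in> (\<Union>d\<in>D. ball d \<delta>)" by auto
  qed
  obtain F where F: "F \<subseteq> D" "finite F" "w ` {a..b} \<subseteq> (\<Union>d\<in>F. ball d \<delta>)"
    using compactE_image[OF c _ cover] by (metis open_ball)
  let ?F = "{z \<in> F. \<exists>t\<in>{a..b}. norm (w t - z) \<le> \<delta>}"
  have "\<exists>z\<in>?F. norm (w t - z) \<le> \<delta>" if "t \<in> {a..b}" for t
  proof -
    obtain z where "z \<in> F" "dist z (w t) < \<delta>" using F(3) \<open>t \<in> {a..b}\<close> by (force simp: image_subset_iff)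
    then have "z \<in> F" "norm (w t - z) \<le> \<delta>" by (auto simp: dist_norm norm_minus_commute)
    then show ?thesis using that by blast
  qed
  then show thesis using F by (intro that[of ?F]) auto
qed

lemma sum_power_le:
  fixes a :: "'i \<Rightarrow> real"
  assumes "finite F" "\<And>i. i \<in> F \<Longrightarrow> 0 \<le> a i" "0 < p"
  shows "(\<Sum>i\<in>F. a i) ^ p \<le> real (card F) ^ p * (\<Sum>i\<in>F. a i ^ p)"
proof (cases "F = {}")
  case False
  then obtain i0 where i0: "i0 \<in> F" "\<And>i. i \<in> F \<Longrightarrow> a i \<le> a i0"
  proof -
    have "Max (a ` F) \<in> a ` F" using assms(1) False by (intro Max_in) auto
    then obtain i0 where "i0 \<in> F" "Max (a ` F) = a i0" by blast
    then show thesis using that[of i0] Max_ge[of "a ` F"] assms(1) by auto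
  qed
  have "(\<Sum>i\<in>F. a i) \<le> real (card F) * a i0" using sum_bounded_above[of F a "a i0"] i0(2) by simp
  then have "(\<Sum>i\<in>F. a i) ^ p \<le> (real (card F) * a i0) ^ p" by (intro power_mono sum_nonneg assms(2))
  also have "\<dots> = real (card F) ^ p * a i0 ^ p" by (simp add: power_mult_distrib)
  also have "\<dots> \<le> real (card F) ^ p * (\<Sum>i\<in>F. a i ^ p)"
    using assms i0(1) by (intro mult_left_mono member_le_sum) auto
  finally show ?thesis .
qed (use assms(3) in \<open>simp add: zero_power\<close>)

lemma ex_small_power:
  fixes K \<eta> :: real
  assumes "0 \<le> K" "0 < \<eta>" "0 < p"
  obtains \<delta> where "0 < \<delta>" "\<delta> \<le> 1" "K * \<delta> ^ p \<le> \<eta>"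
proof -
  define \<delta> where "\<delta> = min 1 (\<eta> / (K + 1))"
  have \<delta>: "0 < \<delta>" "\<delta> \<le> 1" "\<delta> \<le> \<eta> / (K + 1)" using assms by (auto simp: \<delta>_def)
  have "\<delta> ^ p \<le> \<delta>" using power_decreasing[of 1 p \<delta>] \<delta> assms(3) by simp
  then have "K * \<delta> ^ p \<le> K * (\<eta> / (K + 1))" using \<delta>(3) assms(1) by (intro mult_left_mono) auto
  also have "\<dots> \<le> \<eta>" using assms by (simp add: field_simps)
  finally show thesis using that \<delta> by blast
qed

text \<open>The factor 2^p comes from separating the two summands; the power of
  \<open>card F\<close> is the price of the p-th power of a sum, each term being at most the
  largest.\<close>

lemma net_error:
  fixes L :: "real \<Rightarrow> real" and G :: "'i \<Rightarrow> real \<Rightarrow> real"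
  assumes "Lp_le p T C L" and F: "finite F" and "\<And>z. z \<in> F \<Longrightarrow> Lp_le p T \<kappa> (G z)"
    and "0 \<le> C" "0 \<le> \<kappa>" "0 \<le> \<delta>" "0 < p"
  shows "Lp_le p T (2 ^ p * C * \<delta> ^ p + 2 ^ p * real (card F) ^ p * real (card F) * \<kappa>)
      (\<lambda>t. \<delta> * L t + (\<Sum>z\<in>F. G z t))"
proof -
  note L = Lp_leD[OF assms(1)] and G = Lp_leD[OF assms(3)]
  let ?N = "real (card F)"
  have mI: "(\<lambda>t. c t * indicator {0..T} t) \<in> borel_measurable lebesgue"
    if "c \<in> borel_measurable lebesgue" for c :: "real \<Rightarrow> ennreal"
    using that by (intro borel_measurable_times_ennreal borel_measurable_indicator) simp_all
  have mG: "(\<lambda>t. \<Sum>z\<in>F. G z t) \<in> borel_measurable lebesgue" using G(1) by (rule borel_measurable_sum)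
  have m: "(\<lambda>t. \<delta> * L t + (\<Sum>z\<in>F. G z t)) \<in> borel_measurable lebesgue"
    using L(1) mG by measurable
  have sG: "0 \<le> (\<Sum>z\<in>F. G z t)" for t by (intro sum_nonneg G(2))
  have nonneg: "0 \<le> \<delta> * L t + (\<Sum>z\<in>F. G z t)" for t
    using \<open>0 \<le> \<delta>\<close> L(2)[of t] sG[of t] by simp
  have "(\<integral>\<^sup>+t\<in>{0..T}. ennreal (norm (\<delta> * L t + (\<Sum>z\<in>F. G z t)) ^ p) \<partial>lebesgue)
    \<le> ennreal (2 ^ p) * ((\<integral>\<^sup>+t\<in>{0..T}. ennreal (norm (\<delta> * L t) ^ p) \<partial>lebesgue)
        + (\<integral>\<^sup>+t\<in>{0..T}. ennreal (norm (\<Sum>z\<in>F. G z t) ^ p) \<partial>lebesgue))"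
    by (rule Lp_nn_add) (use L(1) mG norm_triangle_ineq in auto)
  also have "\<dots> \<le> ennreal (2 ^ p) * (ennreal (\<delta> ^ p * C) + ennreal (?N ^ p * (?N * \<kappa>)))"
  proof (intro mult_left_mono add_mono)
    have "(\<integral>\<^sup>+t\<in>{0..T}. ennreal (norm (\<delta> * L t) ^ p) \<partial>lebesgue)
        = (\<integral>\<^sup>+t. ennreal (\<delta> ^ p) * (ennreal (L t ^ p) * indicator {0..T} t) \<partial>lebesgue)"
      using L(2) \<open>0 \<le> \<delta>\<close>
      by (intro nn_integral_cong) (auto simp: power_mult_distrib ennreal_mult abs_mult split: split_indicator)
    also have "\<dots> = ennreal (\<delta> ^ p) * (\<integral>\<^sup>+t\<in>{0..T}. ennreal (L t ^ p) \<partial>lebesgue)"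
    proof (rule nn_integral_cmult[OF mI])
      show "(\<lambda>t. ennreal (L t ^ p)) \<in> borel_measurable lebesgue" using L(1) by measurable
    qed
    also have "\<dots> \<le> ennreal (\<delta> ^ p) * ennreal C" using L(3) by (rule mult_left_mono) simp
    also have "\<dots> = ennreal (\<delta> ^ p * C)" using \<open>0 \<le> \<delta>\<close> by (simp add: ennreal_mult')
    finally show "(\<integral>\<^sup>+t\<in>{0..T}. ennreal (norm (\<delta> * L t) ^ p) \<partial>lebesgue) \<le> ennreal (\<delta> ^ p * C)" .
    have "(\<integral>\<^sup>+t\<in>{0..T}. ennreal (norm (\<Sum>z\<in>F. G z t) ^ p) \<partial>lebesgue)
        \<le> (\<integral>\<^sup>+t. ennreal (?N ^ p) * (\<Sum>z\<in>F. ennreal (G z t ^ p) * indicator {0..T} t) \<partial>lebesgue)"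
    proof (rule nn_integral_mono)
      fix t
      have "ennreal (norm (\<Sum>z\<in>F. G z t) ^ p) \<le> ennreal (?N ^ p * (\<Sum>z\<in>F. G z t ^ p))"
        using sum_power_le[OF F, of "\<lambda>z. G z t" p] G(2) sG \<open>0 < p\<close> by (intro ennreal_leI) simp
      also have "\<dots> = ennreal (?N ^ p) * (\<Sum>z\<in>F. ennreal (G z t ^ p))"
        using G(2) by (simp add: ennreal_mult' sum_ennreal)
      finally show "ennreal (norm (\<Sum>z\<in>F. G z t) ^ p) * indicator {0..T} t
          \<le> ennreal (?N ^ p) * (\<Sum>z\<in>F. ennreal (G z t ^ p) * indicator {0..T} t)"
        by (simp split: split_indicator)
    qed
    also have "\<dots> = ennreal (?N ^ p) * (\<integral>\<^sup>+t. (\<Sum>z\<in>F. ennreal (G z t ^ p) * indicator {0..T} t) \<partial>lebesgue)"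
    proof (rule nn_integral_cmult[OF borel_measurable_sum[OF mI]])
      fix z assume "z \<in> F"
      from G(1)[OF this] show "(\<lambda>t. ennreal (G z t ^ p)) \<in> borel_measurable lebesgue" by measurable
    qed
    also have "(\<integral>\<^sup>+t. (\<Sum>z\<in>F. ennreal (G z t ^ p) * indicator {0..T} t) \<partial>lebesgue)
        = (\<Sum>z\<in>F. \<integral>\<^sup>+t\<in>{0..T}. ennreal (G z t ^ p) \<partial>lebesgue)"
    proof (rule nn_integral_sum[OF mI])
      fix z assume "z \<in> F"
      from G(1)[OF this] show "(\<lambda>t. ennreal (G z t ^ p)) \<in> borel_measurable lebesgue" by measurable
    qed
    also have "ennreal (?N ^ p) * (\<Sum>z\<in>F. \<integral>\<^sup>+t\<in>{0..T}. ennreal (G z t ^ p) \<partial>lebesgue) \<le> ennreal (?N ^ p) * (\<Sum>z\<in>F. ennreal \<kappa>)"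
      using G(3) by (intro mult_left_mono sum_mono) auto
    also have "(\<Sum>z\<in>F. ennreal \<kappa>) = ennreal (?N * \<kappa>)"
      using \<open>0 \<le> \<kappa>\<close> by (simp add: ennreal_mult ennreal_of_nat_eq_real_of_nat)
    also have "ennreal (?N ^ p) * ennreal (?N * \<kappa>) = ennreal (?N ^ p * (?N * \<kappa>))"
      by (simp add: ennreal_mult')
    finally show "(\<integral>\<^sup>+t\<in>{0..T}. ennreal (norm (\<Sum>z\<in>F. G z t) ^ p) \<partial>lebesgue) \<le> ennreal (?N ^ p * (?N * \<kappa>))" .
  qed auto
  also have "\<dots> = ennreal (2 ^ p * C * \<delta> ^ p + 2 ^ p * ?N ^ p * ?N * \<kappa>)"
    using assms by (simp add: algebra_simps flip: ennreal_plus ennreal_mult')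
  finally show ?thesis using m nonneg by (simp add: Lp_le_def)
qed

section \<open>The three topologies\<close>

lemma LC_bound_Lp_le:
  assumes "LC_bound p f R k"
  shows "\<exists>C\<ge>0. Lp_le p T C k"
proof -
  obtain c where "0 \<le> c" "(\<integral>\<^sup>+t\<in>{0..T}. ennreal (k t ^ p) \<partial>lebesgue) = ennreal c"
    using LC_boundD(3)[OF assms, of 0 T] by (cases "\<integral>\<^sup>+t\<in>{0..T}. ennreal (k t ^ p) \<partial>lebesgue") auto
  then show ?thesis using LC_boundD(1,2)[OF assms] by (intro exI[of _ c]) (simp add: Lp_le_def)
qed

text \<open>The solution lives on [-1,S], whereas the seminorm sees [0,b] and the delayed interval
  [-1,b-1]; clipping at \<open>S\<close> provides members of both families K, and on [0,S] nothing
  changes.\<close>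

lemma perturbation_TT:
  fixes fs :: "nat \<Rightarrow> ('n::finite) rhs"
  assumes p: "0 < p" and E: "E \<subseteq> LC p" and eq: "L1_equicontinuous_m_bounds E"
    and X: "X = T_Theta_Theta p (theta E) (theta_hat p E)"
    and fs: "\<And>n. fs n \<in> X closure_of E" and f: "f \<in> LC p"
    and lim: "limitin (subtopology X (X closure_of E)) fs f sequentially"
    and T: "0 \<le> T" and y: "continuous_on {-1..T} y" "\<And>t. t \<in> {-1..T} \<Longrightarrow> norm (y t) \<le> R"
  shows "perturbation p T R fs \<phi>s f y"
proof -
  let ?P = "{rho_TT p (theta E) (theta_hat p E) a b j | a b j. a \<in> \<rat> \<and> b \<in> \<rat> \<and> a < b}"
  have X': "X = seminorm_topology (LC p) ?P" using X by (simp only: T_Theta_Theta_eq)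
  have fsL: "fs n \<in> LC p" for n using fs closure_of_seminorm_topology_subset unfolding X' by blast
  have R: "0 \<le> R" using order_trans[OF norm_ge_zero y(2)[of 0]] T by simp
  obtain j0 :: nat where j0: "2 * R + 1 \<le> real j0" using real_arch_simple by blast
  define j where "j = j0"
  have j: "2 * R \<le> real j" "0 < real j" "R \<le> real j" using j0 R by (auto simp: j_def)
  define b where "b = 1 + real (nat \<lceil>T\<rceil>)"
  have b: "b \<in> \<rat>" "0 < b" "T \<le> b" unfolding b_def by (auto, linarith)
  obtain Z :: "((real^'n) \<times> (real^'n)) set" where Z: "countable Z" "Z \<subseteq> cball 0 (real j)" "cball 0 (real j) \<subseteq> closure Z"
    using separable by blast
  have "Z \<noteq> {}" using Z(3) by auto
  have seq: "\<exists>e::nat \<Rightarrow> 'n rhs. (\<forall>k. e k \<in> E) \<and> (AE t in lebesgue. \<forall>z\<in>Z. (\<lambda>k. e k (t, z)) \<longlonglongrightarrow> fs n (t, z))" for n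
  proof (rule closure_sequence_of_seminorms[OF p E fs[of n, unfolded X'] Z(1) \<open>Z \<noteq> {}\<close>])
    fix z :: "(real^'n) \<times> (real^'n)" and c :: nat
    obtain x u where z: "z = (x, u)" by (cases z)
    \<comment> \<open>The two components, as constant functions, belong to the sets K of radius
      \<open>i\<close>, so one seminorm controls the evaluation at \<open>z\<close>.\<close>
    obtain i :: nat where i: "max (norm x) (norm u) \<le> real i" using real_arch_simple by blast
    let ?\<rho> = "rho_TT p (theta E) (theta_hat p E) (- (1 + real c)) (1 + real c) i"
    have "Lp_norm p {- (1 + real c)..1 + real c} (\<lambda>t. h (t, z)) \<le> ?\<rho> h" if "h \<in> LC p" for h
      unfolding z by (rule Lp_norm_le_rho_TT[OF that p, of "\<lambda>_. x" _ _ _ _ "\<lambda>_. u"])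
        (use i in \<open>auto intro!: const_in_Kset theta_nonneg theta_hat_nonneg\<close>)
    moreover have "?\<rho> (\<lambda>_. 0) = 0" by (rule rho_TT_zero) (rule p theta_nonneg theta_hat_nonneg)+
    moreover have "?\<rho> \<in> ?P" by (intro CollectI exI conjI refl) auto
    ultimately show "\<exists>\<rho>\<in>?P. \<rho> (\<lambda>_. 0) = 0 \<and>
        (\<forall>h\<in>LC p. Lp_norm p {- (1 + real c)..1 + real c} (\<lambda>t. h (t, z)) \<le> \<rho> h)" by blast
  qed
  obtain k where k: "LC_bound p f (real j) k" using ex_LC_bound[OF f p] by blast
  obtain C where C: "0 \<le> C" "Lp_le p T C k" using LC_bound_Lp_le[OF k] by blast
  have "\<forall>\<^sub>F n in sequentially. \<forall>S x. bounded_solution T R (fs n) (\<phi>s n) S x \<longrightarrow>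
      gronwall_bound p T C \<eta> S (fs n) x f y"
    if "0 < \<eta>" for \<eta>
  proof -
    \<comment> \<open>The seminorm is a p-th root, while the remainder is measured by p-th
      powers.\<close>
    obtain \<kappa> where \<kappa>: "0 < \<kappa>" "\<kappa> \<le> 1" "1 * \<kappa> ^ p \<le> \<eta>" using ex_small_power[of 1 \<eta> p] \<open>0 < \<eta>\<close> p by auto
    let ?\<rho> = "rho_TT p (theta E) (theta_hat p E) 0 b j"
    have "\<forall>\<^sub>F n in sequentially. ?\<rho> (fs n - f) < \<kappa>"
    proof (rule limitin_seminorm_topology[OF lim[unfolded X'] _ _ \<kappa>(1)])
      show "?\<rho> \<in> ?P" using b by (intro CollectI exI conjI refl) auto
      show "?\<rho> (f - f) = 0" unfolding fun_diff_self by (rule rho_TT_zero) (rule p theta_nonneg theta_hat_nonneg)+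
    qed
    then show ?thesis
    proof (rule eventually_mono, unfold bounded_solution_def, intro allI impI, elim conjE)
      fix n S x assume \<rho>: "?\<rho> (fs n - f) < \<kappa>" and S: "0 \<le> S" "S \<le> T"
        and x: "dde_upto (fs n) (\<phi>s n) S x" and xR: "\<forall>t\<in>{-1..S}. norm (x t) \<le> R"
      obtain e :: "nat \<Rightarrow> 'n rhs" where e: "\<And>k. e k \<in> E" "AE t in lebesgue. \<forall>z\<in>Z. (\<lambda>k. e k (t, z)) \<longlonglongrightarrow> fs n (t, z)"
        using seq[of n] by blast
      have xK: "clip S x \<in> Kset (theta E) 0 b j"
        by (rule clip_in_Kset[OF p E eq e Z fsL x S(1) _ _ j(1)]) (use S b xR in auto)
      have cx: "continuous_on {-1..S} x" using x by (simp add: dde_upto_def)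
      have cc: "continuous_on A (clip S x)" for A using S by (intro continuous_on_clip[OF cx]) simp
      have cR: "norm (clip S x t) \<le> R" for t using S xR by (intro norm_clip_le) auto
      have uK: "clip S x \<in> Kset (theta_hat p E) (0 - 1) (b - 1) j"
        by (rule Kset_theta_hat[OF cc _ p]) (use cR j(3) in \<open>auto intro: order_trans\<close>)
      define r where "r t = norm ((fs n - f) (t, clip S x t, clip S x (t - 1)))" for t
      have dL: "fs n - f \<in> LC p" by (rule LC_diff[OF fsL f p])
      have cw: "continuous_on UNIV (\<lambda>t. (clip S x t, clip S x (t - 1)))"
        by (intro continuous_on_Pair cc continuous_on_compose2[OF cc[of UNIV]] continuous_intros) auto
      have "r \<in> borel_measurable lebesgue"
        using LC_comp_measurable[OF dL cw] unfolding r_def by measurable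
      moreover have "(\<integral>\<^sup>+t\<in>{0..T}. ennreal (r t ^ p) \<partial>lebesgue) \<le> ennreal \<eta>"
      proof -
        let ?N = "Lp_norm p {0..b} (\<lambda>t. (fs n - f) (t, clip S x t, clip S x (t - 1)))"
        have "(\<integral>\<^sup>+t\<in>{0..T}. ennreal (r t ^ p) \<partial>lebesgue) \<le> (\<integral>\<^sup>+t\<in>{0..b}. ennreal (r t ^ p) \<partial>lebesgue)"
          using b by (intro nn_set_integral_set_mono) auto
        also have "\<dots> = ennreal (?N ^ p)"
          unfolding r_def by (rule nn_integral_Lp[OF LC_comp_Lp[OF dL p cw] _ p]) simp
        also have "\<dots> \<le> ennreal (\<kappa> ^ p)"
          using Lp_norm_le_rho_TT[OF dL p xK uK] \<rho> by (intro ennreal_leI power_mono) auto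
        also have "\<dots> \<le> ennreal \<eta>" using \<kappa>(3) by (intro ennreal_leI) simp
        finally show ?thesis .
      qed
      moreover have "AE t in lebesgue. t \<in> {0..S} \<longrightarrow> norm (fs n (t, x t, x (t - 1)) - f (t, y t, y (t - 1)))
          \<le> k t * (norm (x t - y t) + norm (x (t - 1) - y (t - 1))) + r t"
        using LC_boundD(5)[OF k]
      proof eventually_elim
        case (elim t)
        show ?case
        proof
          assume t: "t \<in> {0..S}"
          have "(x t, x (t - 1)) \<in> cball 0 (real j)" "(y t, y (t - 1)) \<in> cball 0 (real j)"
            by (rule pair_mem_cball[of _ R _ R]; use xR y(2) t S j in auto)+
          then have "norm (f (t, x t, x (t - 1)) - f (t, y t, y (t - 1)))
              \<le> k t * norm ((x t, x (t - 1)) - (y t, y (t - 1)))" using elim by blast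
          also have "\<dots> \<le> k t * (norm (x t - y t) + norm (x (t - 1) - y (t - 1)))"
            using norm_Pair_le[of "x t - y t" "x (t - 1) - y (t - 1)"] LC_boundD(2)[OF k] by (intro mult_left_mono) auto
          finally have "norm (f (t, x t, x (t - 1)) - f (t, y t, y (t - 1)))
              \<le> k t * (norm (x t - y t) + norm (x (t - 1) - y (t - 1)))" .
          moreover have "r t = norm (fs n (t, x t, x (t - 1)) - f (t, x t, x (t - 1)))"
            using t by (simp add: r_def)
          ultimately show "norm (fs n (t, x t, x (t - 1)) - f (t, y t, y (t - 1)))
              \<le> k t * (norm (x t - y t) + norm (x (t - 1) - y (t - 1))) + r t"
            using norm_triangle_ineq[of "fs n (t, x t, x (t - 1)) - f (t, x t, x (t - 1))" "f (t, x t, x (t - 1)) - f (t, y t, y (t - 1))"]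
            by simp
        qed
      qed
      moreover have "0 \<le> r t" for t by (simp add: r_def)
      ultimately show "gronwall_bound p T C \<eta> S (fs n) x f y"
        using C(2) unfolding gronwall_bound_def Lp_le_def[of p T \<eta>] by blast
    qed
  qed
  then show ?thesis unfolding perturbation_def using C(1) by blast
qed

lemma SUP_finite_real:
  fixes F :: "'i \<Rightarrow> ennreal"
  assumes "(SUP i\<in>I. F i) < \<infinity>"
  shows "\<exists>C\<ge>0. \<forall>i\<in>I. F i \<le> ennreal C"
proof -
  obtain c where "0 \<le> c" "(SUP i\<in>I. F i) = ennreal c" using assms by (cases "SUP i\<in>I. F i") auto
  then have "\<forall>i\<in>I. F i \<le> ennreal c" using SUP_upper[of _ I F] by simp
  then show ?thesis using \<open>0 \<le> c\<close> by blast
qed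

lemma closure_l_bounded:
  fixes E :: "('n::finite) rhs set"
  assumes p: "0 < p" and E: "E \<subseteq> LC p" and l: "Lp_bounded_l_bounds p E"
    and D: "countable D" "closure D = UNIV" and T: "0 \<le> T"
  shows "\<exists>C\<ge>0. \<forall>g\<in>LC p. (\<exists>e::nat \<Rightarrow> 'n rhs. (\<forall>k. e k \<in> E) \<and> (AE t in lebesgue. \<forall>z\<in>D. (\<lambda>k. e k (t, z)) \<longlonglongrightarrow> g (t, z))) \<longrightarrow>
    (\<exists>L. Lp_le p T C L \<and>
      (AE t in lebesgue. t \<in> {0..T} \<longrightarrow> (\<forall>(z1, z2)\<in>ball 0 (real j) \<times> ball 0 (real j).
          norm (g (t, z1) - g (t, z2)) \<le> L t * norm (z1 - z2))))"
proof -
  \<comment> \<open>\<open>T\<close> may be 0, but the bounds are given for positive radii.\<close>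
  define r where "r = T + 1"
  have r: "0 < r" "T \<le> r" using T by (auto simp: r_def)
  obtain C where C: "0 \<le> C" "\<And>f. f \<in> E \<Longrightarrow> (\<integral>\<^sup>+t\<in>{-r..r}. l_bound f j t ^ p \<partial>lebesgue) \<le> ennreal C"
    using SUP_finite_real[OF l[unfolded Lp_bounded_l_bounds_def, rule_format, OF r(1), of j]] by blast
  \<comment> \<open>Open balls with the diagonal removed form an open set, in which the pairs from
    \<open>D\<close> are dense; off the diagonal the difference quotients make sense.\<close>
  let ?O = "ball 0 (real j) \<times> ball 0 (real j) \<inter> {z :: ((real^'n) \<times> (real^'n)) \<times> ((real^'n) \<times> (real^'n)). fst z \<noteq> snd z}"
  let ?I = "?O \<inter> D \<times> D"
  have "open ?O" by (intro open_Int open_Times open_ball open_Collect_neq continuous_intros)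
  then have cl: "?O \<subseteq> closure ?I"
    using open_Int_closure_subset[of ?O "D \<times> D"] D(2) by (simp add: closure_Times)
  have "\<exists>L. Lp_le p T C L \<and>
      (AE t in lebesgue. t \<in> {0..T} \<longrightarrow> (\<forall>(z1, z2)\<in>ball 0 (real j) \<times> ball 0 (real j).
          norm (g (t, z1) - g (t, z2)) \<le> L t * norm (z1 - z2)))"
    if g: "g \<in> LC p" and e: "\<And>k. e k \<in> E" "AE t in lebesgue. \<forall>z\<in>D. (\<lambda>k. e k (t, z)) \<longlonglongrightarrow> g (t, z)"
    for g and e :: "nat \<Rightarrow> 'n rhs"
  proof (rule closure_lipschitz[OF p E g e, where I = ?I and J = "real j"])
    show "countable ?I" using D(1) by (intro countable_Int2 countable_SIGMA)
    show "(\<integral>\<^sup>+t\<in>{0..T}. (SUP (z1, z2)\<in>?I. ennreal ((norm (f (t, z1) - f (t, z2)) / norm (z1 - z2)) ^ p)) \<partial>lebesgue)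
        \<le> ennreal C" if f: "f \<in> E" for f
    proof -
      have "(\<integral>\<^sup>+t\<in>{0..T}. (SUP (z1, z2)\<in>?I. ennreal ((norm (f (t, z1) - f (t, z2)) / norm (z1 - z2)) ^ p)) \<partial>lebesgue)
          \<le> (\<integral>\<^sup>+t\<in>{0..T}. l_bound f j t ^ p \<partial>lebesgue)"
      proof (intro set_nn_integral_mono_AE AE_I2 impI SUP_least)
        fix t i assume i: "i \<in> ?I"
        obtain z1 z2 where z12: "i = (z1, z2)" by (cases i)
        have z: "z1 \<in> cball 0 (real j)" "z2 \<in> cball 0 (real j)" "z1 \<noteq> z2" using i unfolding z12 by auto
        have "ennreal (norm (f (t, z1) - f (t, z2)) / norm (z1 - z2)) \<le> l_bound f j t"
          unfolding l_bound_def by (rule SUP_upper2[of "(z1, z2)"]) (use z in auto)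
        then have "ennreal (norm (f (t, z1) - f (t, z2)) / norm (z1 - z2)) ^ p \<le> l_bound f j t ^ p"
          by (rule power_mono) simp
        then show "(case i of (z1, z2) \<Rightarrow> ennreal ((norm (f (t, z1) - f (t, z2)) / norm (z1 - z2)) ^ p)) \<le> l_bound f j t ^ p"
          unfolding z12 by (simp add: ennreal_power)
      qed
      also have "\<dots> \<le> (\<integral>\<^sup>+t\<in>{-r..r}. l_bound f j t ^ p \<partial>lebesgue)"
        using r by (intro nn_set_integral_set_mono) auto
      also have "\<dots> \<le> ennreal C" by (rule C(2)[OF f])
      finally show ?thesis .
    qed
    show "(z1, z2) \<in> closure ?I" if "(z1, z2) \<in> ball 0 (real j) \<times> ball 0 (real j)" "z1 \<noteq> z2" for z1 z2
      using that by (intro subsetD[OF cl]) auto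
  qed auto
  then show ?thesis using C(1) by blast
qed

text \<open>The constant comes from \<open>E\<close> alone, hence serves the whole closure. The
  state variable runs over a separate dense set \<open>Q\<close>, since \<open>D'\<close> concerns
  the delayed variable only.\<close>

lemma closure_l2_bounded:
  fixes E :: "('n::finite) rhs set"
  assumes p: "0 < p" and E: "E \<subseteq> LC p" and l: "Lp_bounded_l2_bounds p E"
    and Q: "countable Q" "closure Q = UNIV" and D': "countable D'" "closure D' = UNIV" and T: "0 \<le> T"
  shows "\<exists>C\<ge>0. \<forall>g\<in>LC p. (\<exists>e::nat \<Rightarrow> 'n rhs. (\<forall>k. e k \<in> E) \<and>
      (AE t in lebesgue. \<forall>z\<in>Q \<times> D'. (\<lambda>k. e k (t, z)) \<longlonglongrightarrow> g (t, z))) \<longrightarrow>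
    (\<exists>L. Lp_le p T C L \<and>
      (AE t in lebesgue. t \<in> {0..T} \<longrightarrow> (\<forall>x u1 u2. (x, u1) \<in> ball 0 (real j) \<and> (x, u2) \<in> ball 0 (real j) \<longrightarrow>
          norm (g (t, x, u1) - g (t, x, u2)) \<le> L t * norm (u1 - u2))))"
proof -
  define r where "r = T + 1"
  have r: "0 < r" "T \<le> r" using T by (auto simp: r_def)
  obtain C where C: "0 \<le> C" "\<And>f. f \<in> E \<Longrightarrow> (\<integral>\<^sup>+t\<in>{-r..r}. l2_bound f j t ^ p \<partial>lebesgue) \<le> ennreal C"
    using SUP_finite_real[OF l[unfolded Lp_bounded_l2_bounds_def, rule_format, OF r(1), of j]] by blast
  let ?B = "ball 0 (real j) :: ((real^'n) \<times> (real^'n)) set"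
  \<comment> \<open>Pairs sharing their first component do not form an open set of pairs. In the
    coordinates (x, u1, u2) the relevant set is open; density is obtained there and transported by
    this continuous map.\<close>
  let ?m = "\<lambda>(x, u1, u2). ((x, u1), (x, u2)) :: ((real^'n) \<times> (real^'n)) \<times> ((real^'n) \<times> (real^'n))"
  let ?O = "{v :: (real^'n) \<times> (real^'n) \<times> (real^'n). norm (fst v, fst (snd v)) < real j} \<inter>
      {v. norm (fst v, snd (snd v)) < real j} \<inter> {v. fst (snd v) \<noteq> snd (snd v)}"
  let ?I = "?m ` (?O \<inter> Q \<times> D' \<times> D')"
  let ?W = "{((x, u1), (x, u2)) | x u1 u2. (x, u1) \<in> ?B \<and> (x, u2) \<in> ?B}"
  have "open ?O" by (intro open_Int open_Collect_less open_Collect_neq continuous_intros)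
  then have cl: "?O \<subseteq> closure (?O \<inter> Q \<times> D' \<times> D')"
    using open_Int_closure_subset[of ?O "Q \<times> D' \<times> D'"] Q(2) D'(2) by (simp add: closure_Times)
  have cm: "continuous_on UNIV ?m" unfolding case_prod_beta by (intro continuous_intros)
  have main: "\<exists>L. Lp_le p T C L \<and>
      (AE t in lebesgue. t \<in> {0..T} \<longrightarrow> (\<forall>(z1, z2)\<in>?W. norm (g (t, z1) - g (t, z2)) \<le> L t * norm (z1 - z2)))"
    if g: "g \<in> LC p" and e: "\<And>k. e k \<in> E" "AE t in lebesgue. \<forall>z\<in>Q \<times> D'. (\<lambda>k. e k (t, z)) \<longlonglongrightarrow> g (t, z)"
    for g and e :: "nat \<Rightarrow> 'n rhs"
  proof (rule closure_lipschitz[OF p E g e, where I = ?I and J = "real j"])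
    show "countable ?I" using Q(1) D'(1) by (intro countable_image countable_Int2 countable_SIGMA)
    show "(\<integral>\<^sup>+t\<in>{0..T}. (SUP (z1, z2)\<in>?I. ennreal ((norm (f (t, z1) - f (t, z2)) / norm (z1 - z2)) ^ p)) \<partial>lebesgue)
        \<le> ennreal C" if f: "f \<in> E" for f
    proof -
      have "(\<integral>\<^sup>+t\<in>{0..T}. (SUP (z1, z2)\<in>?I. ennreal ((norm (f (t, z1) - f (t, z2)) / norm (z1 - z2)) ^ p)) \<partial>lebesgue)
          \<le> (\<integral>\<^sup>+t\<in>{0..T}. l2_bound f j t ^ p \<partial>lebesgue)"
      proof (intro set_nn_integral_mono_AE AE_I2 impI SUP_least)
        fix t i assume i: "i \<in> ?I"
        then obtain x u1 u2 where xu: "i = ((x, u1), (x, u2))"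
          and z: "norm (x, u1) < real j" "norm (x, u2) < real j" "u1 \<noteq> u2"
          by auto
        have "ennreal (norm (f (t, x, u1) - f (t, x, u2)) / norm (u1 - u2)) \<le> l2_bound f j t"
          unfolding l2_bound_def by (rule SUP_upper2[of "(x, u1, u2)"]) (use z in \<open>auto simp: mem_cball_0 simp del: mem_cball\<close>)
        then have "ennreal (norm (f (t, x, u1) - f (t, x, u2)) / norm (u1 - u2)) ^ p \<le> l2_bound f j t ^ p"
          by (rule power_mono) simp
        then show "(case i of (z1, z2) \<Rightarrow> ennreal ((norm (f (t, z1) - f (t, z2)) / norm (z1 - z2)) ^ p)) \<le> l2_bound f j t ^ p"
          unfolding xu by (simp add: ennreal_power norm_Pair)
      qed
      also have "\<dots> \<le> (\<integral>\<^sup>+t\<in>{-r..r}. l2_bound f j t ^ p \<partial>lebesgue)"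
        using r by (intro nn_set_integral_set_mono) auto
      also have "\<dots> \<le> ennreal C" by (rule C(2)[OF f])
      finally show ?thesis .
    qed
    show "(z1, z2) \<in> closure ?I" if z: "(z1, z2) \<in> ?W" "z1 \<noteq> z2" for z1 z2
    proof -
      obtain x u1 u2 where *: "z1 = (x, u1)" "z2 = (x, u2)" "norm (x, u1) < real j" "norm (x, u2) < real j"
        using z(1) by (auto simp: mem_ball_0 simp del: mem_ball)
      then have "(x, u1, u2) \<in> closure (?O \<inter> Q \<times> D' \<times> D')" using z(2) by (intro subsetD[OF cl]) auto
      then have "?m (x, u1, u2) \<in> closure ?I"
        using image_closure_subset[OF continuous_on_subset[OF cm] closed_closure closure_subset] by blast
      then show ?thesis using * by simp
    qed
  qed (auto simp: mem_ball_0 mem_cball_0 simp del: mem_ball mem_cball)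
  have conv: "norm (g (t, x, u1) - g (t, x, u2)) \<le> L t * norm (u1 - u2)"
    if "\<forall>(z1, z2)\<in>?W. norm (g (t, z1) - g (t, z2)) \<le> L t * norm (z1 - z2)"
      "(x, u1) \<in> ?B" "(x, u2) \<in> ?B" for g :: "'n rhs" and L t x u1 u2
  proof -
    have "((x, u1), (x, u2)) \<in> ?W" using that by blast
    from bspec[OF that(1) this] show ?thesis by (simp add: norm_Pair)
  qed
  have "\<exists>L. Lp_le p T C L \<and>
      (AE t in lebesgue. t \<in> {0..T} \<longrightarrow> (\<forall>x u1 u2. (x, u1) \<in> ?B \<and> (x, u2) \<in> ?B \<longrightarrow>
          norm (g (t, x, u1) - g (t, x, u2)) \<le> L t * norm (u1 - u2)))"
    if g: "g \<in> LC p" and e: "\<And>k. e k \<in> E" "AE t in lebesgue. \<forall>z\<in>Q \<times> D'. (\<lambda>k. e k (t, z)) \<longlonglongrightarrow> g (t, z)"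
    for g and e :: "nat \<Rightarrow> 'n rhs"
  proof -
    obtain L where L: "Lp_le p T C L"
      "AE t in lebesgue. t \<in> {0..T} \<longrightarrow> (\<forall>(z1, z2)\<in>?W. norm (g (t, z1) - g (t, z2)) \<le> L t * norm (z1 - z2))"
      using main[OF g e] by blast
    have "AE t in lebesgue. t \<in> {0..T} \<longrightarrow> (\<forall>x u1 u2. (x, u1) \<in> ?B \<and> (x, u2) \<in> ?B \<longrightarrow>
          norm (g (t, x, u1) - g (t, x, u2)) \<le> L t * norm (u1 - u2))"
      using L(2)
    proof eventually_elim
      case (elim t)
      then show ?case using conv[of g t L] by blast
    qed
    then show ?thesis using L(1) by blast
  qed
  then show ?thesis using C(1) by blast
qed

text \<open>Every value of the trajectory is within \<open>\<delta>\<close> of some point of the net \<open>F\<close>; the sum over all of \<open>F\<close>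
  takes the place of a measurable choice of that point.\<close>

definition net_bound ::
  "nat \<Rightarrow> real \<Rightarrow> real \<Rightarrow> 'i set \<Rightarrow> real \<Rightarrow> real \<Rightarrow> real \<Rightarrow> ('n::finite) rhs \<Rightarrow> (real \<Rightarrow> real^'n) \<Rightarrow> 'n rhs \<Rightarrow> (real \<Rightarrow> real^'n) \<Rightarrow> bool" where
  "net_bound p T C F \<delta> \<kappa> S f x g y \<longleftrightarrow> (\<exists>L G. Lp_le p T C L \<and> (\<forall>z\<in>F. Lp_le p T (\<kappa> ^ p) (G z)) \<and>
     (AE t in lebesgue. t \<in> {0..S} \<longrightarrow> norm (f (t, x t, x (t - 1)) - g (t, y t, y (t - 1)))
        \<le> L t * (norm (x t - y t) + norm (x (t - 1) - y (t - 1))) + (\<delta> * L t + (\<Sum>z\<in>F. G z t))))"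

text \<open>The net is fixed by \<delta>, independently of \<open>n\<close>; only then can the
  seminorms attached to its finitely many points be made small together.\<close>

lemma perturbation_of_net_bound:
  fixes fs :: "nat \<Rightarrow> ('n::finite) rhs"
  assumes p: "0 < p" and C: "0 \<le> C" and F: "\<And>\<delta>. 0 < \<delta> \<Longrightarrow> \<delta> \<le> 1 \<Longrightarrow> finite (F \<delta>)"
    and step: "\<And>\<delta> \<kappa>. 0 < \<delta> \<Longrightarrow> \<delta> \<le> 1 \<Longrightarrow> 0 < \<kappa> \<Longrightarrow> \<forall>\<^sub>F n in sequentially. \<forall>S x.
      bounded_solution T R (fs n) (\<phi>s n) S x \<longrightarrow> net_bound p T C (F \<delta>) \<delta> \<kappa> S (fs n) x f y"
  shows "perturbation p T R fs \<phi>s f y"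
  unfolding perturbation_def
proof (intro exI[of _ C] conjI C allI impI)
  fix \<eta> :: real assume "0 < \<eta>"
  obtain \<delta> where \<delta>: "0 < \<delta>" "\<delta> \<le> 1" "(2 ^ p * C) * \<delta> ^ p \<le> \<eta> / 2"
    using ex_small_power[of "2 ^ p * C" "\<eta> / 2" p] C \<open>0 < \<eta>\<close> p by auto
  let ?N = "real (card (F \<delta>))"
  \<comment> \<open>Chosen after \<delta>, because the number of net points appears in the error;
    each of the two contributions gets \<eta>/2.\<close>
  obtain \<kappa> where \<kappa>: "0 < \<kappa>" "(2 ^ p * ?N ^ p * ?N) * \<kappa> ^ p \<le> \<eta> / 2"
    using ex_small_power[of "2 ^ p * ?N ^ p * ?N" "\<eta> / 2" p] \<open>0 < \<eta>\<close> p by auto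
  have "gronwall_bound p T C \<eta> S g x f y" if "net_bound p T C (F \<delta>) \<delta> \<kappa> S g x f y" for S g x
  proof -
    obtain L G where L: "Lp_le p T C L" and G: "\<And>z. z \<in> F \<delta> \<Longrightarrow> Lp_le p T (\<kappa> ^ p) (G z)"
      and ae: "AE t in lebesgue. t \<in> {0..S} \<longrightarrow> norm (g (t, x t, x (t - 1)) - f (t, y t, y (t - 1)))
          \<le> L t * (norm (x t - y t) + norm (x (t - 1) - y (t - 1))) + (\<delta> * L t + (\<Sum>z\<in>F \<delta>. G z t))"
      using \<open>net_bound p T C (F \<delta>) \<delta> \<kappa> S g x f y\<close> unfolding net_bound_def by blast
    let ?r = "\<lambda>t. \<delta> * L t + (\<Sum>z\<in>F \<delta>. G z t)"
    have "0 \<le> \<kappa> ^ p" using \<kappa>(1) by simp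
    then have "Lp_le p T (2 ^ p * C * \<delta> ^ p + 2 ^ p * ?N ^ p * ?N * \<kappa> ^ p) ?r"
      using L F[OF \<delta>(1,2)] G C \<delta>(1) p by (intro net_error) auto
    moreover have "2 ^ p * C * \<delta> ^ p + 2 ^ p * ?N ^ p * ?N * \<kappa> ^ p \<le> \<eta>" using \<delta>(3) \<kappa>(2) by linarith
    ultimately have "Lp_le p T \<eta> ?r" by (rule Lp_le_mono)
    then show ?thesis unfolding gronwall_bound_def using L ae by blast
  qed
  then show "\<forall>\<^sub>F n in sequentially. \<forall>S x.
     bounded_solution T R (fs n) (\<phi>s n) S x \<longrightarrow> gronwall_bound p T C \<eta> S (fs n) x f y"
    using step[OF \<delta>(1,2) \<kappa>(1)] by (auto elim: eventually_mono)
qed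

lemma ex_countable_dense: "\<exists>Q :: 'a::euclidean_space set. countable Q \<and> closure Q = UNIV"
proof (rule separable[of "UNIV :: 'a set"])
  fix Q :: "'a set" assume "countable Q" "UNIV \<subseteq> closure Q"
  then show ?thesis by (intro exI[of _ Q] conjI equalityI subset_UNIV)
qed

lemma finite_nets:
  fixes w :: "real \<Rightarrow> 'a::real_normed_vector"
  assumes "continuous_on {a..b} w" "closure D = UNIV"
  shows "\<exists>F. \<forall>\<delta>. 0 < \<delta> \<longrightarrow> finite (F \<delta>) \<and> F \<delta> \<subseteq> D \<and>
    (\<forall>t\<in>{a..b}. \<exists>z\<in>F \<delta>. norm (w t - z) \<le> \<delta>) \<and> (\<forall>z\<in>F \<delta>. \<exists>t\<in>{a..b}. norm (w t - z) \<le> \<delta>)"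
proof (rule choice, rule allI)
  fix \<delta> :: real
  show "\<exists>F. 0 < \<delta> \<longrightarrow> finite F \<and> F \<subseteq> D \<and>
    (\<forall>t\<in>{a..b}. \<exists>z\<in>F. norm (w t - z) \<le> \<delta>) \<and> (\<forall>z\<in>F. \<exists>t\<in>{a..b}. norm (w t - z) \<le> \<delta>)"
  proof (cases "0 < \<delta>")
    case True
    show ?thesis by (rule finite_net[OF assms True]) blast
  qed simp
qed

lemma add_Lp_le:
  assumes "Lp_le p T C L" "Lp_le p T C' k" "0 \<le> C" "0 \<le> C'"
  shows "Lp_le p T (2 ^ p * (C + C')) (\<lambda>t. L t + k t)"
proof -
  note L = Lp_leD[OF assms(1)] and k = Lp_leD[OF assms(2)]
  have m: "(\<lambda>t. L t + k t) \<in> borel_measurable lebesgue" using L(1) k(1) by measurable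
  have "(\<integral>\<^sup>+t\<in>{0..T}. ennreal (norm (L t + k t) ^ p) \<partial>lebesgue) \<le> ennreal (2 ^ p) *
      ((\<integral>\<^sup>+t\<in>{0..T}. ennreal (norm (L t) ^ p) \<partial>lebesgue) + (\<integral>\<^sup>+t\<in>{0..T}. ennreal (norm (k t) ^ p) \<partial>lebesgue))"
    by (rule Lp_nn_add) (use L(1) k(1) norm_triangle_ineq in auto)
  also have "\<dots> \<le> ennreal (2 ^ p) * (ennreal C + ennreal C')"
    using L k by (intro mult_left_mono add_mono) auto
  also have "\<dots> = ennreal (2 ^ p * (C + C'))" using assms by (simp add: ennreal_mult)
  finally show ?thesis using m L(2) k(2) by (simp add: Lp_le_def)
qed

lemma norm_diff_telescope:
  fixes a b c d e f :: "'a::real_normed_vector"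
  shows "norm (a - f) \<le> norm (a - b) + norm (b - c) + norm (c - d) + norm (d - e) + norm (e - f)"
proof -
  have "norm ((a - b) + (b - c) + (c - d) + (d - e) + (e - f))
      \<le> norm (a - b) + norm (b - c) + norm (c - d) + norm (d - e) + norm (e - f)"
    by (intro order_trans[OF norm_triangle_ineq] add_right_mono order_refl)
  then show ?thesis by simp
qed

lemma ex_rational_ge:
  assumes "0 \<le> (T::real)"
  obtains b where "b \<in> \<rat>" "0 < b" "T \<le> b"
proof (rule that[of "1 + real (nat \<lceil>T\<rceil>)"])
  show "T \<le> 1 + real (nat \<lceil>T\<rceil>)" by linarith
qed auto

text \<open>Only the delayed argument is discretised. The chain moves it from the solution to
  \<open>y\<close> and on to a net point by the bound of the perturbed function in the delayed
  variable, exchanges \<open>fs n\<close> for \<open>f\<close> along the clipped solution with that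
  point fixed, and returns to \<open>y\<close> by the Lipschitz bound of \<open>f\<close>.\<close>

lemma perturbation_TD:
  fixes fs :: "nat \<Rightarrow> ('n::finite) rhs"
  assumes p: "0 < p" and E: "E \<subseteq> LC p" and eq: "L1_equicontinuous_m_bounds E" and l2: "Lp_bounded_l2_bounds p E"
    and D': "countable D'" "closure D' = UNIV"
    and X: "X = T_Theta_D p (theta E) D'"
    and fs: "\<And>n. fs n \<in> X closure_of E" and f: "f \<in> LC p"
    and lim: "limitin (subtopology X (X closure_of E)) fs f sequentially"
    and T: "0 \<le> T" and y: "continuous_on {-1..T} y" "\<And>t. t \<in> {-1..T} \<Longrightarrow> norm (y t) \<le> R"
  shows "perturbation p T R fs \<phi>s f y"
proof -
  let ?P = "{rho_TD p (theta E) a b j u | a b j u. a \<in> \<rat> \<and> b \<in> \<rat> \<and> a < b \<and> u \<in> D'}"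
  have X': "X = seminorm_topology (LC p) ?P" using X by (simp only: T_Theta_D_eq)
  have fsL: "fs n \<in> LC p" for n using fs closure_of_seminorm_topology_subset unfolding X' by blast
  have R: "0 \<le> R" using order_trans[OF norm_ge_zero y(2)[of 0]] T by simp
  \<comment> \<open>Net points have norm at most R + 1, so pairs have norm at most 2R + 1 and lie
    strictly inside the open ball where the bounds of the closure hold.\<close>
  obtain j :: nat where j0: "2 * R + 2 \<le> real j" using real_arch_simple by blast
  have j: "2 * R \<le> real j" "0 < real j" using j0 R by auto
  obtain b where b: "b \<in> \<rat>" "0 < b" "T \<le> b" using ex_rational_ge[OF T] by blast
  obtain Q :: "(real^'n) set" where Q: "countable Q" and Q': "closure Q = UNIV"
    using ex_countable_dense by blast
  have QD: "closure (Q \<times> D') = UNIV" using Q' D'(2) by (simp add: closure_Times)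
  have neQD: "Q \<times> D' \<noteq> {}" using QD by auto
  have cQD: "countable (Q \<times> D')" using Q D'(1) by (rule countable_SIGMA)
  have seq: "\<exists>e::nat \<Rightarrow> 'n rhs. (\<forall>k. e k \<in> E) \<and> (AE t in lebesgue. \<forall>z\<in>Q \<times> D'. (\<lambda>k. e k (t, z)) \<longlonglongrightarrow> fs n (t, z))" for n
  proof (rule closure_sequence_of_seminorms[OF p E fs[of n, unfolded X'] cQD neQD])
    fix z and c :: nat assume "z \<in> Q \<times> D'"
    then obtain x u where z: "z = (x, u)" "u \<in> D'" by blast
    obtain i :: nat where i: "norm x \<le> real i" using real_arch_simple by blast
    let ?\<rho> = "rho_TD p (theta E) (- (1 + real c)) (1 + real c) i u"
    have "Lp_norm p {- (1 + real c)..1 + real c} (\<lambda>t. h (t, z)) \<le> ?\<rho> h" if "h \<in> LC p" for h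
      unfolding z by (rule Lp_norm_le_rho_TD[OF that p, of "\<lambda>_. x"]) (use i in \<open>auto intro!: const_in_Kset theta_nonneg\<close>)
    moreover have "?\<rho> (\<lambda>_. 0) = 0" by (rule rho_TD_zero) (rule p theta_nonneg)+
    moreover have "?\<rho> \<in> ?P" using z(2) by (intro CollectI exI conjI refl) auto
    ultimately show "\<exists>\<rho>\<in>?P. \<rho> (\<lambda>_. 0) = 0 \<and>
        (\<forall>h\<in>LC p. Lp_norm p {- (1 + real c)..1 + real c} (\<lambda>t. h (t, z)) \<le> \<rho> h)" by blast
  qed
  define Z where "Z = (Q \<times> D') \<inter> cball 0 (real j)"
  have Z: "countable Z" "Z \<subseteq> cball 0 (real j)" "cball 0 (real j) \<subseteq> closure Z"
    using cQD ball_subset_closure_dense[OF QD j(2)] by (auto simp: Z_def)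
  obtain Cl where Cl: "0 \<le> Cl" and ex_l: "\<And>n. \<exists>L. Lp_le p T Cl L \<and>
      (AE t in lebesgue. t \<in> {0..T} \<longrightarrow> (\<forall>x u1 u2. (x, u1) \<in> ball 0 (real j) \<and> (x, u2) \<in> ball 0 (real j) \<longrightarrow>
          norm (fs n (t, x, u1) - fs n (t, x, u2)) \<le> L t * norm (u1 - u2)))"
    using closure_l2_bounded[OF p E l2 Q Q' D' T, of j] seq fsL by blast
  obtain k where k: "LC_bound p f (real j) k" using ex_LC_bound[OF f p] by blast
  obtain Ck where Ck: "0 \<le> Ck" "Lp_le p T Ck k" using LC_bound_Lp_le[OF k] by blast
  have cy: "continuous_on {0..T} (\<lambda>t. y (t - 1))"
    by (rule continuous_on_compose2[OF y(1)]) (auto intro!: continuous_intros)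
  obtain F where net: "\<forall>\<delta>. 0 < \<delta> \<longrightarrow> finite (F \<delta>) \<and> F \<delta> \<subseteq> D' \<and>
      (\<forall>t\<in>{0..T}. \<exists>z\<in>F \<delta>. norm (y (t - 1) - z) \<le> \<delta>) \<and> (\<forall>z\<in>F \<delta>. \<exists>t\<in>{0..T}. norm (y (t - 1) - z) \<le> \<delta>)"
    using finite_nets[OF cy D'(2)] by blast
  have F: "\<And>\<delta>. 0 < \<delta> \<Longrightarrow> finite (F \<delta>)" "\<And>\<delta>. 0 < \<delta> \<Longrightarrow> F \<delta> \<subseteq> D'"
    "\<And>\<delta> t. 0 < \<delta> \<Longrightarrow> t \<in> {0..T} \<Longrightarrow> \<exists>z\<in>F \<delta>. norm (y (t - 1) - z) \<le> \<delta>"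
    "\<And>\<delta> z. 0 < \<delta> \<Longrightarrow> z \<in> F \<delta> \<Longrightarrow> \<exists>t\<in>{0..T}. norm (y (t - 1) - z) \<le> \<delta>"
    using net by blast+
  show ?thesis
  proof (rule perturbation_of_net_bound[OF p, where C = "2 ^ p * (Cl + Ck)" and F = F])
    show "0 \<le> 2 ^ p * (Cl + Ck)" using Cl Ck(1) by simp
    show "finite (F \<delta>)" if "0 < \<delta>" for \<delta> using F(1)[OF that] .
    fix \<delta> \<kappa> :: real assume \<delta>: "0 < \<delta>" "\<delta> \<le> 1" and \<kappa>: "0 < \<kappa>"
    have Fb: "norm z \<le> R + 1" if z: "z \<in> F \<delta>" for z
    proof -
      obtain t where t: "t \<in> {0..T}" "norm (y (t - 1) - z) \<le> \<delta>" using F(4)[OF \<delta>(1) z] by blast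
      then have "norm (y (t - 1)) \<le> R" using y(2)[of "t - 1"] by auto
      then show ?thesis using t(2) \<delta>(2) norm_triangle_sub[of z "y (t - 1)"] by (simp add: norm_minus_commute)
    qed
    let ?\<rho> = "\<lambda>u. rho_TD p (theta E) 0 b j u"
    have "\<forall>\<^sub>F n in sequentially. ?\<rho> u (fs n - f) < \<kappa>" if "u \<in> F \<delta>" for u
    proof (rule limitin_seminorm_topology[OF lim[unfolded X'] _ _ \<kappa>])
      have "u \<in> D'" using F(2)[OF \<delta>(1)] that by blast
      then show "?\<rho> u \<in> ?P" using b by (intro CollectI exI conjI refl) auto
      show "?\<rho> u (f - f) = 0" unfolding fun_diff_self by (rule rho_TD_zero) (rule p theta_nonneg)+
    qed
    then have "\<forall>\<^sub>F n in sequentially. \<forall>u\<in>F \<delta>. ?\<rho> u (fs n - f) < \<kappa>"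
      using F(1)[OF \<delta>(1)] by (simp add: eventually_ball_finite)
    then show "\<forall>\<^sub>F n in sequentially. \<forall>S x. bounded_solution T R (fs n) (\<phi>s n) S x \<longrightarrow>
        net_bound p T (2 ^ p * (Cl + Ck)) (F \<delta>) \<delta> \<kappa> S (fs n) x f y"
    proof (rule eventually_mono, unfold bounded_solution_def, intro allI impI, elim conjE)
      fix n S x assume \<rho>: "\<forall>u\<in>F \<delta>. ?\<rho> u (fs n - f) < \<kappa>" and S: "0 \<le> S" "S \<le> T"
        and x: "dde_upto (fs n) (\<phi>s n) S x" and xR: "\<forall>t\<in>{-1..S}. norm (x t) \<le> R"
      obtain e :: "nat \<Rightarrow> 'n rhs" where e: "\<And>k. e k \<in> E" "AE t in lebesgue. \<forall>z\<in>Q \<times> D'. (\<lambda>k. e k (t, z)) \<longlonglongrightarrow> fs n (t, z)"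
        using seq[of n] by blast
      have eZ: "AE t in lebesgue. \<forall>z\<in>Z. (\<lambda>k. e k (t, z)) \<longlonglongrightarrow> fs n (t, z)"
        using e(2) by (rule eventually_mono) (unfold Z_def, blast)
      have xK: "clip S x \<in> Kset (theta E) 0 b j"
        by (rule clip_in_Kset[OF p E eq e(1) eZ Z fsL x S(1) _ _ j(1)]) (use S b xR in auto)
      have cx: "continuous_on {-1..S} x" using x by (simp add: dde_upto_def)
      have cc: "continuous_on A (clip S x)" for A using S by (intro continuous_on_clip[OF cx]) simp
      obtain L where L: "Lp_le p T Cl L"
        and Lae: "AE t in lebesgue. t \<in> {0..T} \<longrightarrow> (\<forall>x u1 u2. (x, u1) \<in> ball 0 (real j) \<and> (x, u2) \<in> ball 0 (real j) \<longrightarrow>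
          norm (fs n (t, x, u1) - fs n (t, x, u2)) \<le> L t * norm (u1 - u2))"
        using ex_l[of n] by blast
      let ?L = "\<lambda>t. L t + k t"
      define G where "G u t = norm ((fs n - f) (t, clip S x t, u))" for u t
      have dL: "fs n - f \<in> LC p" by (rule LC_diff[OF fsL f p])
      have cw: "continuous_on UNIV (\<lambda>t. (clip S x t, u))" for u by (intro continuous_on_Pair cc continuous_on_const)
      note L0 = Lp_leD(2)[OF L]
      have L': "Lp_le p T (2 ^ p * (Cl + Ck)) ?L" by (rule add_Lp_le[OF L Ck(2) Cl Ck(1)])
      have Gm: "G u \<in> borel_measurable lebesgue" for u
        using LC_comp_measurable[OF dL cw[of u]] unfolding G_def by measurable
      have G0: "0 \<le> G u t" for u t by (simp add: G_def)
      have G\<kappa>: "(\<integral>\<^sup>+t\<in>{0..T}. ennreal (G u t ^ p) \<partial>lebesgue) \<le> ennreal (\<kappa> ^ p)" if u: "u \<in> F \<delta>" for u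
      proof -
        have "(\<integral>\<^sup>+t\<in>{0..T}. ennreal (G u t ^ p) \<partial>lebesgue) \<le> (\<integral>\<^sup>+t\<in>{0..b}. ennreal (G u t ^ p) \<partial>lebesgue)"
          using b by (intro nn_set_integral_set_mono) auto
        also have "\<dots> = ennreal (Lp_norm p {0..b} (\<lambda>t. (fs n - f) (t, clip S x t, u)) ^ p)"
          unfolding G_def by (rule nn_integral_Lp[OF LC_comp_Lp[OF dL p cw] _ p]) simp
        also have "\<dots> \<le> ennreal (\<kappa> ^ p)"
          using Lp_norm_le_rho_TD[OF dL p xK, of u] \<rho> u by (intro ennreal_leI power_mono) auto
        finally show ?thesis .
      qed
      have ae: "AE t in lebesgue. t \<in> {0..S} \<longrightarrow> norm (fs n (t, x t, x (t - 1)) - f (t, y t, y (t - 1)))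
          \<le> ?L t * (norm (x t - y t) + norm (x (t - 1) - y (t - 1))) + (\<delta> * ?L t + (\<Sum>u\<in>F \<delta>. G u t))"
        using Lae LC_boundD(5)[OF k]
      proof eventually_elim
        case (elim t)
        show ?case
        proof
          assume t: "t \<in> {0..S}"
          then have tT: "t \<in> {0..T}" using S by auto
          have xb: "norm (x t) \<le> R" "norm (x (t - 1)) \<le> R" "norm (y t) \<le> R" "norm (y (t - 1)) \<le> R"
            using xR y(2) t S by auto
          obtain u where u: "u \<in> F \<delta>" "norm (y (t - 1) - u) \<le> \<delta>" using F(3)[OF \<delta>(1) tT] by blast
          have ub: "norm u \<le> R + 1" by (rule Fb[OF u(1)])
          have in_ball: "(a, c) \<in> ball 0 (real j)" "(a, c) \<in> cball 0 (real j)"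
            if "norm a \<le> R" "norm c \<le> R + 1" for a c :: "real^'n"
            using norm_Pair_le[of a c] that j0 by (auto simp: mem_ball_0 mem_cball_0 simp del: mem_ball mem_cball)
          have l1: "norm (fs n (t, x t, v1) - fs n (t, x t, v2)) \<le> L t * norm (v1 - v2)"
            if "norm v1 \<le> R + 1" "norm v2 \<le> R + 1" for v1 v2
            using elim(1) tT in_ball(1)[OF xb(1) that(1)] in_ball(1)[OF xb(1) that(2)] by blast
          have l3: "norm (f (t, v) - f (t, v')) \<le> k t * norm (v - v')"
            if "v \<in> cball 0 (real j)" "v' \<in> cball 0 (real j)" for v v'
            using elim(2) that by blast
          have a1: "norm (fs n (t, x t, x (t - 1)) - fs n (t, x t, y (t - 1))) \<le> L t * norm (x (t - 1) - y (t - 1))"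
            using xb by (intro l1) auto
          have a2: "norm (fs n (t, x t, y (t - 1)) - fs n (t, x t, u)) \<le> L t * \<delta>"
            using l1[of "y (t - 1)" u] xb ub mult_left_mono[OF u(2) L0[of t]] by auto
          have a3: "norm (fs n (t, x t, u) - f (t, x t, u)) \<le> (\<Sum>u\<in>F \<delta>. G u t)"
          proof -
            have "norm (fs n (t, x t, u) - f (t, x t, u)) = G u t" using t by (simp add: G_def)
            also have "\<dots> \<le> (\<Sum>u\<in>F \<delta>. G u t)"
              using F(1)[OF \<delta>(1)] u(1) by (intro member_le_sum) (auto simp: G_def)
            finally show ?thesis .
          qed
          have "norm (f (t, x t, u) - f (t, x t, y (t - 1))) \<le> k t * norm ((x t, u) - (x t, y (t - 1)))"
            using xb ub by (intro l3 in_ball(2)) auto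
          also have "\<dots> = k t * norm (y (t - 1) - u)" by (simp add: norm_Pair norm_minus_commute)
          also have "\<dots> \<le> k t * \<delta>" using u(2) LC_boundD(2)[OF k] by (intro mult_left_mono)
          finally have a4: "norm (f (t, x t, u) - f (t, x t, y (t - 1))) \<le> k t * \<delta>" .
          have "norm (f (t, x t, y (t - 1)) - f (t, y t, y (t - 1))) \<le> k t * norm ((x t, y (t - 1)) - (y t, y (t - 1)))"
            using xb by (intro l3 in_ball(2)) auto
          then have a5: "norm (f (t, x t, y (t - 1)) - f (t, y t, y (t - 1))) \<le> k t * norm (x t - y t)"
            by (simp add: norm_Pair)
          have "norm (fs n (t, x t, x (t - 1)) - f (t, y t, y (t - 1)))
            \<le> norm (fs n (t, x t, x (t - 1)) - fs n (t, x t, y (t - 1)))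
              + norm (fs n (t, x t, y (t - 1)) - fs n (t, x t, u)) + norm (fs n (t, x t, u) - f (t, x t, u))
              + norm (f (t, x t, u) - f (t, x t, y (t - 1))) + norm (f (t, x t, y (t - 1)) - f (t, y t, y (t - 1)))"
            by (rule norm_diff_telescope)
          also have "\<dots> \<le> L t * norm (x (t - 1) - y (t - 1)) + L t * \<delta> + (\<Sum>u\<in>F \<delta>. G u t) + k t * \<delta> + k t * norm (x t - y t)"
            by (intro add_mono a1 a2 a3 a4 a5)
          also have "\<dots> \<le> ?L t * (norm (x t - y t) + norm (x (t - 1) - y (t - 1))) + (\<delta> * ?L t + (\<Sum>u\<in>F \<delta>. G u t))"
          proof -
            \<comment> \<open>The two nonnegative cross terms that complete the product of L + k
              with the sum of distances.\<close>
            have "0 \<le> L t * norm (x t - y t)" "0 \<le> k t * norm (x (t - 1) - y (t - 1))"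
              using L0 LC_boundD(2)[OF k] by simp_all
            then show ?thesis by (simp add: algebra_simps)
          qed
          finally show "norm (fs n (t, x t, x (t - 1)) - f (t, y t, y (t - 1)))
              \<le> ?L t * (norm (x t - y t) + norm (x (t - 1) - y (t - 1))) + (\<delta> * ?L t + (\<Sum>u\<in>F \<delta>. G u t))" .
        qed
      qed
      have "Lp_le p T (\<kappa> ^ p) (G z)" if "z \<in> F \<delta>" for z
        using Gm G0 G\<kappa>[OF that] by (simp add: Lp_le_def)
      then show "net_bound p T (2 ^ p * (Cl + Ck)) (F \<delta>) \<delta> \<kappa> S (fs n) x f y"
        unfolding net_bound_def using L' ae by blast
    qed
  qed
qed

text \<open>Both arguments are discretised. The full Lipschitz bound first moves the perturbed
  function from its own solution to \<open>y\<close> and then to a net point, so the difference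
  \<open>fs n - f\<close> is evaluated at fixed points only, which is what these seminorms
  measure.\<close>

lemma perturbation_D:
  fixes fs :: "nat \<Rightarrow> ('n::finite) rhs"
  assumes p: "0 < p" and E: "E \<subseteq> LC p" and l: "Lp_bounded_l_bounds p E"
    and D: "countable D" "closure D = UNIV"
    and X: "X = T_D p D"
    and fs: "\<And>n. fs n \<in> X closure_of E" and f: "f \<in> LC p"
    and lim: "limitin (subtopology X (X closure_of E)) fs f sequentially"
    and T: "0 \<le> T" and y: "continuous_on {-1..T} y" "\<And>t. t \<in> {-1..T} \<Longrightarrow> norm (y t) \<le> R"
  shows "perturbation p T R fs \<phi>s f y"
proof -
  define \<rho> where "\<rho> a b z h = Lp_norm p {a..b} (\<lambda>t. h (t, z))" for a b z and h :: "'n rhs"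
  let ?P = "{\<rho> a b z | a b z. a \<in> \<rat> \<and> b \<in> \<rat> \<and> a < b \<and> z \<in> D}"
  have X': "X = seminorm_topology (LC p) ?P" using X by (simp add: T_D_def \<rho>_def[abs_def])
  have \<rho>0: "\<rho> a b z (\<lambda>_. 0) = 0" for a b z by (simp add: \<rho>_def Lp_norm_zero[OF p])
  have fsL: "fs n \<in> LC p" for n using fs closure_of_seminorm_topology_subset unfolding X' by blast
  have R: "0 \<le> R" using order_trans[OF norm_ge_zero y(2)[of 0]] T by simp
  \<comment> \<open>Here the net consists of pairs: the curve of pairs has norm at most 2R, net
    points at most 2R + 1, strictly inside the ball.\<close>
  obtain j :: nat where j: "2 * R + 2 \<le> real j" using real_arch_simple by blast
  obtain b where b: "b \<in> \<rat>" "0 < b" "T \<le> b" using ex_rational_ge[OF T] by blast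
  have neD: "D \<noteq> {}" using D(2) by auto
  have seq: "\<exists>e::nat \<Rightarrow> 'n rhs. (\<forall>k. e k \<in> E) \<and> (AE t in lebesgue. \<forall>z\<in>D. (\<lambda>k. e k (t, z)) \<longlonglongrightarrow> fs n (t, z))" for n
  proof (rule closure_sequence_of_seminorms[OF p E fs[of n, unfolded X'] D(1) neD])
    fix z and c :: nat assume z: "z \<in> D"
    let ?\<rho> = "\<rho> (- (1 + real c)) (1 + real c) z"
    have "?\<rho> \<in> ?P" using z by (intro CollectI exI conjI refl) auto
    moreover have "\<forall>h\<in>LC p. Lp_norm p {- (1 + real c)..1 + real c} (\<lambda>t. h (t, z)) \<le> ?\<rho> h"
      by (simp add: \<rho>_def)
    ultimately show "\<exists>\<rho>\<in>?P. \<rho> (\<lambda>_. 0) = 0 \<and>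
        (\<forall>h\<in>LC p. Lp_norm p {- (1 + real c)..1 + real c} (\<lambda>t. h (t, z)) \<le> \<rho> h)" using \<rho>0 by blast
  qed
  obtain Cl where Cl: "0 \<le> Cl" and ex_l: "\<And>n. \<exists>L. Lp_le p T Cl L \<and>
      (AE t in lebesgue. t \<in> {0..T} \<longrightarrow> (\<forall>(z1, z2)\<in>ball 0 (real j) \<times> ball 0 (real j).
          norm (fs n (t, z1) - fs n (t, z2)) \<le> L t * norm (z1 - z2)))"
    using closure_l_bounded[OF p E l D T, of j] seq fsL by blast
  obtain k where k: "LC_bound p f (real j) k" using ex_LC_bound[OF f p] by blast
  obtain Ck where Ck: "0 \<le> Ck" "Lp_le p T Ck k" using LC_bound_Lp_le[OF k] by blast
  let ?w = "\<lambda>t. (y t, y (t - 1))"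
  have cy: "continuous_on {0..T} ?w"
    by (intro continuous_on_Pair continuous_on_subset[OF y(1)] continuous_on_compose2[OF y(1)] continuous_intros) auto
  have wR: "norm (?w t) \<le> 2 * R" if "t \<in> {0..T}" for t
  proof -
    have "norm (y t) \<le> R" "norm (y (t - 1)) \<le> R" using that by (auto intro!: y(2))
    then show ?thesis using norm_Pair_le[of "y t" "y (t - 1)"] by linarith
  qed
  obtain F where net: "\<forall>\<delta>. 0 < \<delta> \<longrightarrow> finite (F \<delta>) \<and> F \<delta> \<subseteq> D \<and>
      (\<forall>t\<in>{0..T}. \<exists>z\<in>F \<delta>. norm (?w t - z) \<le> \<delta>) \<and> (\<forall>z\<in>F \<delta>. \<exists>t\<in>{0..T}. norm (?w t - z) \<le> \<delta>)"
    using finite_nets[OF cy D(2)] by blast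
  have F: "\<And>\<delta>. 0 < \<delta> \<Longrightarrow> finite (F \<delta>)" "\<And>\<delta>. 0 < \<delta> \<Longrightarrow> F \<delta> \<subseteq> D"
    "\<And>\<delta> t. 0 < \<delta> \<Longrightarrow> t \<in> {0..T} \<Longrightarrow> \<exists>z\<in>F \<delta>. norm (?w t - z) \<le> \<delta>"
    "\<And>\<delta> z. 0 < \<delta> \<Longrightarrow> z \<in> F \<delta> \<Longrightarrow> \<exists>t\<in>{0..T}. norm (?w t - z) \<le> \<delta>"
    using net by blast+
  show ?thesis
  proof (rule perturbation_of_net_bound[OF p, where C = "2 ^ p * (Cl + Ck)" and F = F])
    show "0 \<le> 2 ^ p * (Cl + Ck)" using Cl Ck(1) by simp
    show "finite (F \<delta>)" if "0 < \<delta>" for \<delta> using F(1)[OF that] .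
    fix \<delta> \<kappa> :: real assume \<delta>: "0 < \<delta>" "\<delta> \<le> 1" and \<kappa>: "0 < \<kappa>"
    have Fb: "norm z \<le> 2 * R + 1" if z: "z \<in> F \<delta>" for z
    proof -
      obtain t where t: "t \<in> {0..T}" "norm (?w t - z) \<le> \<delta>" using F(4)[OF \<delta>(1) z] by blast
      have "norm z \<le> norm (?w t) + norm (?w t - z)" using norm_triangle_sub[of z "?w t"] by (simp only: norm_minus_commute)
      then show ?thesis using wR[OF t(1)] t(2) \<delta>(2) by linarith
    qed
    have "\<forall>\<^sub>F n in sequentially. \<rho> 0 b z (fs n - f) < \<kappa>" if "z \<in> F \<delta>" for z
    proof (rule limitin_seminorm_topology[OF lim[unfolded X'] _ _ \<kappa>])
      have "z \<in> D" using F(2)[OF \<delta>(1)] that by blast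
      then show "\<rho> 0 b z \<in> ?P" using b by (intro CollectI exI conjI refl) auto
      show "\<rho> 0 b z (f - f) = 0" unfolding fun_diff_self by (rule \<rho>0)
    qed
    then have "\<forall>\<^sub>F n in sequentially. \<forall>z\<in>F \<delta>. \<rho> 0 b z (fs n - f) < \<kappa>"
      using F(1)[OF \<delta>(1)] by (simp add: eventually_ball_finite)
    then show "\<forall>\<^sub>F n in sequentially. \<forall>S x. bounded_solution T R (fs n) (\<phi>s n) S x \<longrightarrow>
        net_bound p T (2 ^ p * (Cl + Ck)) (F \<delta>) \<delta> \<kappa> S (fs n) x f y"
    proof (rule eventually_mono, unfold bounded_solution_def, intro allI impI, elim conjE)
      fix n S x assume \<rho>: "\<forall>z\<in>F \<delta>. \<rho> 0 b z (fs n - f) < \<kappa>" and S: "0 \<le> S" "S \<le> T"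
        and x: "dde_upto (fs n) (\<phi>s n) S x" and xR: "\<forall>t\<in>{-1..S}. norm (x t) \<le> R"
      obtain L where L: "Lp_le p T Cl L"
        and Lae: "AE t in lebesgue. t \<in> {0..T} \<longrightarrow> (\<forall>(z1, z2)\<in>ball 0 (real j) \<times> ball 0 (real j).
          norm (fs n (t, z1) - fs n (t, z2)) \<le> L t * norm (z1 - z2))"
        using ex_l[of n] by blast
      let ?L = "\<lambda>t. L t + k t"
      define G where "G z t = norm ((fs n - f) (t, z))" for z t
      have dL: "fs n - f \<in> LC p" by (rule LC_diff[OF fsL f p])
      note L0 = Lp_leD(2)[OF L]
      have L': "Lp_le p T (2 ^ p * (Cl + Ck)) ?L" by (rule add_Lp_le[OF L Ck(2) Cl Ck(1)])
      have Gm: "G z \<in> borel_measurable lebesgue" for z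
        using LC_const_measurable[OF dL, of z] unfolding G_def by measurable
      have G0: "0 \<le> G z t" for z t by (simp add: G_def)
      have G\<kappa>: "(\<integral>\<^sup>+t\<in>{0..T}. ennreal (G z t ^ p) \<partial>lebesgue) \<le> ennreal (\<kappa> ^ p)" if z: "z \<in> F \<delta>" for z
      proof -
        have "(\<integral>\<^sup>+t\<in>{0..T}. ennreal (G z t ^ p) \<partial>lebesgue) \<le> (\<integral>\<^sup>+t\<in>{0..b}. ennreal (G z t ^ p) \<partial>lebesgue)"
          using b by (intro nn_set_integral_set_mono) auto
        also have "\<dots> = ennreal (\<rho> 0 b z (fs n - f) ^ p)"
          unfolding G_def \<rho>_def by (rule nn_integral_Lp[OF LC_comp_Lp[OF dL p continuous_on_const] _ p]) simp
        also have "\<dots> \<le> ennreal (\<kappa> ^ p)"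
          using \<rho> z by (intro ennreal_leI power_mono) (auto simp: \<rho>_def)
        finally show ?thesis .
      qed
      have ae: "AE t in lebesgue. t \<in> {0..S} \<longrightarrow> norm (fs n (t, x t, x (t - 1)) - f (t, y t, y (t - 1)))
          \<le> ?L t * (norm (x t - y t) + norm (x (t - 1) - y (t - 1))) + (\<delta> * ?L t + (\<Sum>z\<in>F \<delta>. G z t))"
        using Lae LC_boundD(5)[OF k]
      proof eventually_elim
        case (elim t)
        show ?case
        proof
          assume t: "t \<in> {0..S}"
          then have tT: "t \<in> {0..T}" using S by auto
          let ?v = "(x t, x (t - 1))"
          have "norm (x t) \<le> R" "norm (x (t - 1)) \<le> R" using xR t by auto
          then have vR: "norm ?v \<le> 2 * R" using norm_Pair_le[of "x t" "x (t - 1)"] by linarith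
          obtain z where z: "z \<in> F \<delta>" "norm (?w t - z) \<le> \<delta>" using F(3)[OF \<delta>(1) tT] by blast
          have in_ball: "v \<in> ball 0 (real j)" "v \<in> cball 0 (real j)" if "norm v \<le> 2 * R + 1" for v :: "(real^'n) \<times> (real^'n)"
            using that j by (auto simp: mem_ball_0 mem_cball_0 simp del: mem_ball mem_cball)
          have b: "norm ?v \<le> 2 * R + 1" "norm (?w t) \<le> 2 * R + 1" "norm z \<le> 2 * R + 1"
            using vR wR[OF tT] Fb[OF z(1)] by auto
          have l1: "norm (fs n (t, v1) - fs n (t, v2)) \<le> L t * norm (v1 - v2)"
            if "norm v1 \<le> 2 * R + 1" "norm v2 \<le> 2 * R + 1" for v1 v2
            using elim(1) tT in_ball(1)[OF that(1)] in_ball(1)[OF that(2)] by blast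
          have "norm (fs n (t, ?v) - fs n (t, ?w t)) \<le> L t * norm (?v - ?w t)" by (rule l1[OF b(1,2)])
          also have "\<dots> \<le> L t * (norm (x t - y t) + norm (x (t - 1) - y (t - 1)))"
            using norm_Pair_le[of "x t - y t" "x (t - 1) - y (t - 1)"] L0 by (intro mult_left_mono) auto
          finally have a1: "norm (fs n (t, ?v) - fs n (t, ?w t)) \<le> L t * (norm (x t - y t) + norm (x (t - 1) - y (t - 1)))" .
          have a2: "norm (fs n (t, ?w t) - fs n (t, z)) \<le> L t * \<delta>"
            by (rule order_trans[OF l1[OF b(2,3)] mult_left_mono[OF z(2) L0]])
          have a3: "norm (fs n (t, z) - f (t, z)) \<le> (\<Sum>z\<in>F \<delta>. G z t)"
          proof -
            have "norm (fs n (t, z) - f (t, z)) = G z t" by (simp add: G_def)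
            also have "\<dots> \<le> (\<Sum>z\<in>F \<delta>. G z t)"
              using F(1)[OF \<delta>(1)] z(1) by (intro member_le_sum) (auto simp: G_def)
            finally show ?thesis .
          qed
          have "norm (f (t, z) - f (t, ?w t)) \<le> k t * norm (z - ?w t)"
            using elim(2) in_ball(2)[OF b(3)] in_ball(2)[OF b(2)] by blast
          also have "\<dots> \<le> k t * \<delta>" using z(2) LC_boundD(2)[OF k]
            by (intro mult_left_mono) (simp_all only: norm_minus_commute)
          finally have a4: "norm (f (t, z) - f (t, ?w t)) \<le> k t * \<delta>" .
          \<comment> \<open>Four differences suffice here; the fifth slot of the telescoping
            inequality is filled with 0.\<close>
          have "norm (fs n (t, ?v) - f (t, ?w t))
            \<le> norm (fs n (t, ?v) - fs n (t, ?w t)) + norm (fs n (t, ?w t) - fs n (t, z))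
              + norm (fs n (t, z) - f (t, z)) + norm (f (t, z) - f (t, ?w t)) + norm (f (t, ?w t) - f (t, ?w t))"
            by (rule norm_diff_telescope)
          also have "\<dots> \<le> L t * (norm (x t - y t) + norm (x (t - 1) - y (t - 1))) + L t * \<delta> + (\<Sum>z\<in>F \<delta>. G z t) + k t * \<delta> + 0"
            by (intro add_mono a1 a2 a3 a4) simp
          also have "\<dots> \<le> ?L t * (norm (x t - y t) + norm (x (t - 1) - y (t - 1))) + (\<delta> * ?L t + (\<Sum>z\<in>F \<delta>. G z t))"
          proof -
            have "0 \<le> k t * (norm (x t - y t) + norm (x (t - 1) - y (t - 1)))"
              using LC_boundD(2)[OF k] by simp
            then show ?thesis by (simp add: algebra_simps)
          qed
          finally show "norm (fs n (t, x t, x (t - 1)) - f (t, y t, y (t - 1)))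
              \<le> ?L t * (norm (x t - y t) + norm (x (t - 1) - y (t - 1))) + (\<delta> * ?L t + (\<Sum>z\<in>F \<delta>. G z t))" .
        qed
      qed
      have "Lp_le p T (\<kappa> ^ p) (G z)" if "z \<in> F \<delta>" for z
        using Gm G0 G\<kappa>[OF that] by (simp add: Lp_le_def)
      then show "net_bound p T (2 ^ p * (Cl + Ck)) (F \<delta>) \<delta> \<kappa> S (fs n) x f y"
        unfolding net_bound_def using L' ae by blast
    qed
  qed
qed

theorem theorem4p3:
  fixes p :: nat
    and E :: "('n::finite) rhs set"
    and D' :: "(real^'n) set"
    and D :: "((real^'n) \<times> (real^'n)) set"
  assumes "p > 1"
    and "E \<subseteq> LC p"
    and "countable D'" and "closure D' = UNIV"
    and "countable D" and "closure D = UNIV"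
  shows "(L1_equicontinuous_m_bounds E \<longrightarrow>
            continuous_dependence p (T_Theta_Theta p (theta E) (theta_hat p E)) E) \<and>
         (L1_equicontinuous_m_bounds E \<and> Lp_bounded_l2_bounds p E \<longrightarrow>
            continuous_dependence p (T_Theta_D p (theta E) D') E) \<and>
         (Lp_bounded_l_bounds p E \<longrightarrow>
            continuous_dependence p (T_D p D) E)"
proof (intro conjI impI)
  have p: "0 < p" using assms(1) by simp
  show "continuous_dependence p (T_Theta_Theta p (theta E) (theta_hat p E)) E" if "L1_equicontinuous_m_bounds E"
    by (rule continuous_dependence_of_perturbation[OF p T_Theta_Theta_eq])
       (rule perturbation_TT[OF p assms(2) that refl])
  show "continuous_dependence p (T_Theta_D p (theta E) D') E"
    if "L1_equicontinuous_m_bounds E \<and> Lp_bounded_l2_bounds p E"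
    by (rule continuous_dependence_of_perturbation[OF p T_Theta_D_eq])
       (rule perturbation_TD[OF p assms(2) conjunct1[OF that] conjunct2[OF that] assms(3,4) refl])
  show "continuous_dependence p (T_D p D) E" if "Lp_bounded_l_bounds p E"
    by (rule continuous_dependence_of_perturbation[OF p T_D_def])
       (rule perturbation_D[OF p assms(2) that assms(5,6) refl])
qed

end
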